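(* Let $K\ge 1$, $\mathcal{K}=\{1,\dots,K\}$, $\mathcal{B}\subseteq\mathcal{K}$, $\alpha>2$, and for each $i\in\mathcal{K}$ let $\lambda_i>0$, $P_i>0$, $p_i\in[0,1]$ (with the $p_i$ not all zero) and $\beta_i>1$. In the $K$-tier network described in the context, the closed access coverage probability, when a mobile is allowed to connect only to the tiers in $\mathcal{B}$, $$\mathtt{P_c} = 1-\mathbb{E}\left[\prod_{i\in \mathcal{B}}\mathbf{1} \left(\frac{M(\Psi_i)}{I-M(\Psi)}<\beta_i\right)\mathbf{1} \left(\frac{M(\Delta_i)}{I}<\beta_i\right)\right],$$ is given by $$\mathtt{P_c}= \frac{\pi}{C(\alpha)}\, \frac{\sum_{i\in\mathcal{B}} p_i \lambda_iP_i^{2/\alpha} \beta_i^{-2/\alpha}}{\sum_{i=1}^K p_i \lambda_i P_i^{2/\alpha}}-\sum_{m=1}^\infty g_c(m),$$ where $$C(\alpha)=\frac{2\pi^2\csc(2\pi/\alpha)}{\alpha},$$ $$g_c(m)=\left(-\frac{A_c}{\eta}\right)^m\left\{\frac{1}{\Gamma\left(1+\frac{2m}{\alpha}\right)}-\frac{B_{c,m}}{\eta}\,\frac{\pi\,\Gamma\left(1+\frac{2}{\alpha}\right)}{\Gamma\left(1+\frac{2(m+1)}{\alpha}\right)}\right\},$$ $$A_c=\pi\Gamma\left(1+\tfrac{2}{\alpha}\right)\sum_{l\in \mathcal{B}}(1-p_l)\lambda_l P_l^{2/\alpha}\beta_l^{-2/\alpha},\qquad \eta=C(\alpha)\sum_{l=1}^K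 p_l\lambda_lP_l^{2/\alpha},$$ $$B_{c,m}= \sum_{i\in\mathcal{B}}\frac{\lambda_ip_iP_i^{2/\alpha} \beta_i^{-2/\alpha}\;{}_2F_1\left(1,\frac{2m}{\alpha},1+\frac{2(m+1)}{\alpha},\frac{1}{1+\beta_i}\right)}{(1+\beta_i)^{2m/\alpha}},$$ and ${}_2F_1(a,b,c,z)=\frac{\Gamma(c)}{\Gamma(b)\Gamma(c-b)}\int_0^1\frac{t^{b-1}(1-t)^{c-b-1}}{(1-tz)^a}\,dt$.
   Context: Network model. $\mathcal{K}=\{1,\dots,K\}$ indexes the tiers of base stations (BSs). Tier $i$ has BS density $\lambda_i$, transmit power $P_i$, target signal-to-interference ratio $\beta_i$ and activity factor $p_i$. The BSs of tier $i$ form a homogeneous Poisson point process (PPP) $\Phi_i$ on $\mathbb{R}^2$ of density $\lambda_i$, independent across tiers. Each $\Phi_i$ is independently partitioned into $\Psi_i$ (active BSs) and $\Delta_i$ (idle BSs), which are independent homogeneous PPPs of densities $p_i\lambda_i$ and $(1-p_i)\lambda_i$. All $2K$ processes $\Psi_i,\Delta_i$ are mutually independent. Each BS location $x$ carries a fading variable $h_x$; the $h_x$ are i.i.d. exponential with mean $1$ (Rayleigh fading), independent of the point processes. A BS at $x\in\Phi_i$ is received at the origin (the typical mobile) with power $P_ih_x\|x\|^{-\alpha}$. There is no thermal noise. Notation. $\Psi=\bigcup_{i\in\mathcal{K}}\Psi_i$ (active BSs of all tiers). For a set of BSs, $M(\cdot)$ is the maximum received power at the origin from it: $M(\Psi_i)=\sup_{x\in\Psi_i}P_ih_x\|x\|^{-\alpha}$,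 $M(\Delta_i)=\sup_{x\in\Delta_i}P_ih_x\|x\|^{-\alpha}$, $M(\Psi)=\max_{i\in\mathcal{K}}M(\Psi_i)$, with $M(\emptyset)=0$. $I=\sum_{i=1}^K\sum_{x\in\Psi_i}P_ih_x\|x\|^{-\alpha}$ is the total power received from the active BSs of all tiers. $\mathbf{1}(\cdot)$ is the indicator function. *)

theory Defs
  imports "HOL-Probability.Probability"
begin

section \<open>Poisson point processes\<close>

definition locally_finite_set :: "'a::metric_space set \<Rightarrow> bool" where
  "locally_finite_set S \<longleftrightarrow> (\<forall>A. bounded A \<longrightarrow> finite (S \<inter> A))"

text \<open>A simple point process is a random locally finite set. Configurations carry the
  \<open>\<sigma>\<close>-algebra generated by the counts of points in bounded Borel sets.\<close>

definition point_configs :: "'a::euclidean_space set measure" where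
  "point_configs = sigma {S. locally_finite_set S}
     {{S. locally_finite_set S \<and> card (S \<inter> A) = n} | A n. A \<in> sets borel \<and> bounded A}"

text \<open>For \<open>d = 0\<close> this says that the process is almost surely empty (\<open>0 ^ 0 = 1\<close>).\<close>

definition homogeneous_ppp ::
  "'w measure \<Rightarrow> real \<Rightarrow> ('w \<Rightarrow> 'a::euclidean_space set) \<Rightarrow> bool" where
  "homogeneous_ppp M d \<Phi> \<longleftrightarrow>
     \<Phi> \<in> measurable M point_configs \<and>
     (\<forall>A n. A \<in> sets borel \<and> bounded A \<longrightarrow>
        measure M {\<omega> \<in> space M. card (\<Phi> \<omega> \<inter> A) = n} =
          (d * measure lborel A) ^ n / fact n * exp (- (d * measure lborel A))) \<and>
     (\<forall>A :: nat \<Rightarrow> 'a set. disjoint_family A \<and> (\<forall>j. A j \<in> sets borel \<and> bounded (A j)) \<longrightarrow>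
        prob_space.indep_vars M (\<lambda>_. count_space UNIV) (\<lambda>j \<omega>. card (\<Phi> \<omega> \<inter> A j)) UNIV)"

section \<open>The network\<close>

text \<open>The \<open>2K\<close> processes as one family: \<open>(i, True)\<close> indexes the active and \<open>(i, False)\<close> the idle
  base stations of tier \<open>i\<close>.\<close>

definition bs_process ::
  "(nat \<Rightarrow> 'w \<Rightarrow> 'a set) \<Rightarrow> (nat \<Rightarrow> 'w \<Rightarrow> 'a set) \<Rightarrow> nat \<times> bool \<Rightarrow> 'w \<Rightarrow> 'a set" where
  "bs_process \<Psi> \<Delta> = (\<lambda>(i, active). if active then \<Psi> i else \<Delta> i)"

text \<open>I.i.d. unit-mean exponential fading at the random base station locations. The value
  \<open>h x \<omega>\<close> matters only if \<open>x\<close> is a base station location in outcome \<open>\<omega>\<close>. Independence of the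
  marks \<open>h x\<close> from each other and from the point processes is expressed along a
  measurable sequence \<open>X\<close> of distinct locations that exhausts the base stations. The sequence
  may contain further locations, so that an infinite number of base stations
  need not be assumed. The marks must be independent of \<open>X\<close> and the point processes jointly;
  otherwise the order of the enumeration could encode information on the marks. The last
  conjunct spells out \<open>indep_var\<close>, which requires both random elements to have the same type.\<close>

definition rayleigh_fading ::
  "'w measure \<Rightarrow> nat \<Rightarrow> (nat \<Rightarrow> 'w \<Rightarrow> (real^2) set) \<Rightarrow> (nat \<Rightarrow> 'w \<Rightarrow> (real^2) set) \<Rightarrow>
    (real^2 \<Rightarrow> 'w \<Rightarrow> real) \<Rightarrow> bool" where
  "rayleigh_fading M K \<Psi> \<Delta> h \<longleftrightarrow> (\<exists>X :: nat \<Rightarrow> 'w \<Rightarrow> real^2.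
     (\<forall>n. X n \<in> borel_measurable M) \<and>
     (\<forall>\<omega>\<in>space M. inj (\<lambda>n. X n \<omega>) \<and> (\<Union>i\<in>{1..K}. \<Psi> i \<omega> \<union> \<Delta> i \<omega>) \<subseteq> range (\<lambda>n. X n \<omega>)) \<and>
     (\<forall>n. distributed M lborel (\<lambda>\<omega>. h (X n \<omega>) \<omega>) (exponential_density 1)) \<and>
     prob_space.indep_vars M (\<lambda>_. borel) (\<lambda>n \<omega>. h (X n \<omega>) \<omega>) UNIV \<and>
     prob_space.indep_set M
       (sets (vimage_algebra (space M) (\<lambda>\<omega> n. h (X n \<omega>) \<omega>)
          (\<Pi>\<^sub>M n\<in>UNIV. (borel :: real measure))))
       (sets (vimage_algebra (space M)
          (\<lambda>\<omega>. (\<lambda>n. X n \<omega>, \<lambda>j\<in>{1..K} \<times> UNIV. bs_process \<Psi> \<Delta> j \<omega>))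
          ((\<Pi>\<^sub>M n\<in>UNIV. borel) \<Otimes>\<^sub>M (\<Pi>\<^sub>M j\<in>{1..K} \<times> UNIV. point_configs)))))"

locale k_tier_network = prob_space M
  for M :: "'w measure" +
  fixes K :: nat
    and dens act :: "nat \<Rightarrow> real"
    and \<Phi> \<Psi> \<Delta> :: "nat \<Rightarrow> 'w \<Rightarrow> (real^2) set"
    and h :: "real^2 \<Rightarrow> 'w \<Rightarrow> real"
  assumes all_ppp: "\<And>i. i \<in> {1..K} \<Longrightarrow> homogeneous_ppp M (dens i) (\<Phi> i)"
    and tiers_indep: "indep_vars (\<lambda>_. point_configs) \<Phi> {1..K}"
    and partition: "\<And>i \<omega>. i \<in> {1..K} \<Longrightarrow> \<omega> \<in> space M \<Longrightarrow>
          \<Phi> i \<omega> = \<Psi> i \<omega> \<union> \<Delta> i \<omega> \<and> \<Psi> i \<omega> \<inter> \<Delta> i \<omega> = {}"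
    and active_ppp: "\<And>i. i \<in> {1..K} \<Longrightarrow> homogeneous_ppp M (act i * dens i) (\<Psi> i)"
    and idle_ppp: "\<And>i. i \<in> {1..K} \<Longrightarrow> homogeneous_ppp M ((1 - act i) * dens i) (\<Delta> i)"
    and processes_indep:
          "indep_vars (\<lambda>_. point_configs) (bs_process \<Psi> \<Delta>) ({1..K} \<times> UNIV)"
    and fading: "rayleigh_fading M K \<Psi> \<Delta> h"

section \<open>Received powers and coverage\<close>

text \<open>Powers are valued in \<^typ>\<open>ennreal\<close>, so that the interference series always has a value and
  the supremum over the empty set is \<open>0\<close>. A base station exactly at the origin
  has probability zero, as have negative values of \<open>h\<close>.\<close>

definition rx_power ::
  "real \<Rightarrow> (real^2 \<Rightarrow> 'w \<Rightarrow> real) \<Rightarrow> real \<Rightarrow> 'w \<Rightarrow> real^2 \<Rightarrow> ennreal" where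
  "rx_power \<alpha> h P \<omega> x = ennreal (P * h x \<omega> * norm x powr (- \<alpha>))"

definition max_power ::
  "real \<Rightarrow> (real^2 \<Rightarrow> 'w \<Rightarrow> real) \<Rightarrow> real \<Rightarrow> ('w \<Rightarrow> (real^2) set) \<Rightarrow> 'w \<Rightarrow> ennreal" where
  "max_power \<alpha> h P S \<omega> = (SUP x\<in>S \<omega>. rx_power \<alpha> h P \<omega> x)"

definition max_power_active ::
  "nat \<Rightarrow> real \<Rightarrow> (real^2 \<Rightarrow> 'w \<Rightarrow> real) \<Rightarrow> (nat \<Rightarrow> real) \<Rightarrow>
    (nat \<Rightarrow> 'w \<Rightarrow> (real^2) set) \<Rightarrow> 'w \<Rightarrow> ennreal" where
  "max_power_active K \<alpha> h P \<Psi> \<omega> = Max ((\<lambda>i. max_power \<alpha> h (P i) (\<Psi> i) \<omega>) ` {1..K})"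

definition total_power ::
  "nat \<Rightarrow> real \<Rightarrow> (real^2 \<Rightarrow> 'w \<Rightarrow> real) \<Rightarrow> (nat \<Rightarrow> real) \<Rightarrow>
    (nat \<Rightarrow> 'w \<Rightarrow> (real^2) set) \<Rightarrow> 'w \<Rightarrow> ennreal" where
  "total_power K \<alpha> h P \<Psi> \<omega> = (\<Sum>i=1..K. \<Sum>\<^sub>\<infinity>x\<in>\<Psi> i \<omega>. rx_power \<alpha> h (P i) \<omega> x)"

definition closed_access_coverage ::
  "'w measure \<Rightarrow> nat \<Rightarrow> nat set \<Rightarrow> real \<Rightarrow> (nat \<Rightarrow> real) \<Rightarrow> (nat \<Rightarrow> real) \<Rightarrow>
    (nat \<Rightarrow> 'w \<Rightarrow> (real^2) set) \<Rightarrow> (nat \<Rightarrow> 'w \<Rightarrow> (real^2) set) \<Rightarrow> (real^2 \<Rightarrow> 'w \<Rightarrow> real) \<Rightarrow> real" where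
  "closed_access_coverage M K B \<alpha> P \<beta> \<Psi> \<Delta> h =
     1 - (\<integral>\<omega>. (\<Prod>i\<in>B.
        of_bool (max_power \<alpha> h (P i) (\<Psi> i) \<omega> /
                  (total_power K \<alpha> h P \<Psi> \<omega> - max_power_active K \<alpha> h P \<Psi> \<omega>) < ennreal (\<beta> i)) *
        of_bool (max_power \<alpha> h (P i) (\<Delta> i) \<omega> / total_power K \<alpha> h P \<Psi> \<omega> < ennreal (\<beta> i))) \<partial>M)"

section \<open>Constants of the closed form\<close>

definition C_const :: "real \<Rightarrow> real" where
  "C_const \<alpha> = 2 * pi\<^sup>2 * (1 / sin (2 * pi / \<alpha>)) / \<alpha>"

definition hyp2F1 :: "real \<Rightarrow> real \<Rightarrow> real \<Rightarrow> real \<Rightarrow> real" where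
  "hyp2F1 a b c z = Gamma c / (Gamma b * Gamma (c - b)) *
     integral {0..1} (\<lambda>t. t powr (b - 1) * (1 - t) powr (c - b - 1) / (1 - t * z) powr a)"

definition A_c :: "nat set \<Rightarrow> real \<Rightarrow> (nat \<Rightarrow> real) \<Rightarrow> (nat \<Rightarrow> real) \<Rightarrow> (nat \<Rightarrow> real) \<Rightarrow>
    (nat \<Rightarrow> real) \<Rightarrow> real" where
  "A_c B \<alpha> dens act P \<beta> = pi * Gamma (1 + 2 / \<alpha>) *
     (\<Sum>l\<in>B. (1 - act l) * dens l * P l powr (2 / \<alpha>) * \<beta> l powr (- 2 / \<alpha>))"

definition eta :: "nat \<Rightarrow> real \<Rightarrow> (nat \<Rightarrow> real) \<Rightarrow> (nat \<Rightarrow> real) \<Rightarrow> (nat \<Rightarrow> real) \<Rightarrow> real" where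
  "eta K \<alpha> dens act P = C_const \<alpha> * (\<Sum>l=1..K. act l * dens l * P l powr (2 / \<alpha>))"

definition B_c :: "nat set \<Rightarrow> real \<Rightarrow> (nat \<Rightarrow> real) \<Rightarrow> (nat \<Rightarrow> real) \<Rightarrow> (nat \<Rightarrow> real) \<Rightarrow>
    (nat \<Rightarrow> real) \<Rightarrow> nat \<Rightarrow> real" where
  "B_c B \<alpha> dens act P \<beta> m =
     (\<Sum>i\<in>B. dens i * act i * P i powr (2 / \<alpha>) * \<beta> i powr (- 2 / \<alpha>) *
        hyp2F1 1 (2 * real m / \<alpha>) (1 + 2 * (real m + 1) / \<alpha>) (1 / (1 + \<beta> i)) /
        (1 + \<beta> i) powr (2 * real m / \<alpha>))"

definition g_c :: "nat \<Rightarrow> nat set \<Rightarrow> real \<Rightarrow> (nat \<Rightarrow> real) \<Rightarrow> (nat \<Rightarrow> real) \<Rightarrow> (nat \<Rightarrow> real) \<Rightarrow>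
    (nat \<Rightarrow> real) \<Rightarrow> nat \<Rightarrow> real" where
  "g_c K B \<alpha> dens act P \<beta> m =
     (- A_c B \<alpha> dens act P \<beta> / eta K \<alpha> dens act P) ^ m *
     (1 / Gamma (1 + 2 * real m / \<alpha>) -
      B_c B \<alpha> dens act P \<beta> m / eta K \<alpha> dens act P *
        (pi * Gamma (1 + 2 / \<alpha>) / Gamma (1 + 2 * (real m + 1) / \<alpha>)))"

end

theory Submission
  imports Defs "HOL-Real_Asymp.Real_Asymp"
begin

text \<open>Since all thresholds exceed \<open>1\<close>, an active station that covers the mobile is stronger than
  all other active stations together. At most one such station exists, so the event of no coverage
  by active stations has indicator \<open>1\<close> minus the number of covering stations.
  The expectation of that number is a Campbell sum over the stations; the idle stations enter
  through the void probability of a Poisson process, given the total active power \<open>I\<close>.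
  The joint laws that are needed come from the Laplace functional of the marked processes:
  differentiating it in one direction gives the Laplace transform of \<open>I\<close> under the
  Campbell measure, and Laplace transforms determine finite measures. The power \<open>I\<close> is
  \<open>2/\<alpha>\<close>-stable with \<open>E exp (- s I) = exp (- \<eta> s powr (2/\<alpha>))\<close>, so its negative moments of
  order \<open>2m/\<alpha>\<close> are explicit. Expanding \<open>exp (- A\<^sub>c I powr (-2/\<alpha>))\<close> yields the series, whose coefficients contain
  incomplete beta integrals, that is, values of \<open>\<^sub>2F\<^sub>1\<close>.\<close>

section \<open>Laplace exponents and received powers\<close>

text \<open>The powers have no usable moments: \<open>I\<close> is stable of index
  \<open>2 / \<alpha> < 1\<close> and has infinite mean, and neither its finiteness nor its
  positivity is assumed. So everything is phrased with extended values: \<open>eneg x\<close> is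
  \<open>exp (- x)\<close> with \<open>eneg \<top> = 0\<close>. An infinite weight on a set of
  points then turns a Laplace functional into a void probability, and one test function can record
  \<open>I\<close>, a count of active stations and an idle event at once. That \<open>I\<close> is
  finite and positive is read off its transform as the argument tends to \<open>0\<close> or to
  infinity. Fading sits on random locations, so marks are averaged out along the enumeration,
  finitely many at a time; this needs that different processes share no point. In the coordinate
  \<open>y powr (- 2 / \<alpha>)\<close> of a power \<open>y\<close> each marked process has
  constant intensity, and scaling by \<open>I powr (- 2 / \<alpha>)\<close> separates the threshold
  \<open>\<beta>\<close> from \<open>I\<close>. The term \<open>m = 0\<close> stays apart because
  the hypergeometric factor degenerates there; it gives the leading fraction.\<close>

definition eneg :: "ennreal \<Rightarrow> ennreal" where
  "eneg x = (if x = \<top> then 0 else ennreal (exp (- enn2real x)))"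

text \<open>Right inverse of \<open>eneg\<close> on the unit interval. It turns the mean factor of a
  random mark back into an exponent, so that a product over points becomes a sum over points
  again.\<close>

definition lneg :: "ennreal \<Rightarrow> ennreal" where
  "lneg x = (if x = 0 then \<top> else ennreal (- ln (enn2real x)))"

lemma eneg_0 [simp]: "eneg 0 = 1"
  by (simp add: eneg_def)

lemma eneg_top [simp]: "eneg \<top> = 0"
  by (simp add: eneg_def)

lemma eneg_ennreal: "0 \<le> x \<Longrightarrow> eneg (ennreal x) = ennreal (exp (- x))"
  by (simp add: eneg_def)

lemma eneg_le_1: "eneg x \<le> 1"
  by (simp add: eneg_def)

lemma eneg_less_top: "eneg x < \<top>"
  using eneg_le_1[of x] by (rule order_le_less_trans) simp

lemma eneg_add: "eneg (x + y) = eneg x * eneg y"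
  by (cases x; cases y)
     (auto simp: eneg_ennreal exp_add exp_diff exp_minus divide_inverse simp flip: ennreal_plus ennreal_mult)

lemma eneg_sum: "eneg (\<Sum>i\<in>A. f i) = (\<Prod>i\<in>A. eneg (f i))"
  by (induction A rule: infinite_finite_induct) (auto simp: eneg_add)

lemma eneg_mult_of_nat: "eneg (x * of_nat n) = eneg x ^ n"
  by (induction n) (auto simp: eneg_add distrib_left)

lemma eneg_antimono: "x \<le> y \<Longrightarrow> eneg y \<le> eneg x"
  by (cases x; cases y) (auto simp: eneg_ennreal ennreal_leI top_unique)

lemma measurable_eneg [measurable]: "eneg \<in> borel_measurable borel"
  unfolding eneg_def by measurable

lemma measurable_lneg [measurable]: "lneg \<in> borel_measurable borel"
  unfolding lneg_def by measurable

lemma eneg_lneg: "x \<le> 1 \<Longrightarrow> eneg (lneg x) = x"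
  by (cases x) (auto simp: lneg_def eneg_ennreal less_le top_unique)

lemma lneg_1 [simp]: "lneg 1 = 0"
  by (simp add: lneg_def)

text \<open>\<open>eneg\<close> is continuous along increasing sequences up to and including the
  value \<open>\<top>\<close>. That value needs its own case because \<open>enn2real \<top>\<close>
  is \<open>0\<close>.\<close>

lemma tendsto_eneg_incseq:
  assumes "incseq f"
  shows "(\<lambda>k. eneg (f k)) \<longlonglongrightarrow> eneg (SUP k. f k)"
proof (cases "(SUP k. f k) = \<top>")
  case True
  show ?thesis
  proof (rule order_tendstoI)
    fix a assume "a < eneg (SUP k. f k)"
    then show "\<forall>\<^sub>F k in sequentially. a < eneg (f k)"
      using True by simp
  next
    fix a assume "eneg (SUP k. f k) < a"
    then have "0 < a" using True by simp
    \<comment> \<open>Halving the target value \<open>b\<close> leaves room for the strict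
      inequality; the maximum with \<open>0\<close> keeps \<open>r\<close> a legitimate argument of
      \<open>eneg_ennreal\<close>.\<close>
    obtain r where r: "0 \<le> r" "ennreal (exp (- r)) < a"
    proof (cases a)
      case (real b)
      with \<open>0 < a\<close> have "b > 0" by simp
      have "exp (- (max 0 (- ln (b / 2)))) \<le> exp (ln (b / 2))"
        by (intro exp_le_cancel_iff[THEN iffD2]) auto
      also have "\<dots> < b" using \<open>b > 0\<close> by simp
      finally show ?thesis using that[of "max 0 (- ln (b / 2))"] real \<open>b > 0\<close>
        by (auto simp: ennreal_less_iff)
    qed (use that[of 0] in auto)
    obtain k0 where "ennreal r < f k0"
      using True by (metis ennreal_less_top less_SUP_iff)
    have "eneg (f k) < a" if "k \<ge> k0" for k
    proof -
      have "ennreal r \<le> f k"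
        using that assms \<open>ennreal r < f k0\<close> by (meson incseqD less_imp_le order.trans)
      from eneg_antimono[OF this] show ?thesis
        using r by (simp add: eneg_ennreal)
    qed
    then show "\<forall>\<^sub>F k in sequentially. eneg (f k) < a"
      by (auto simp: eventually_sequentially)
  qed
next
  case False
  have lim: "f \<longlonglongrightarrow> (SUP k. f k)"
    using assms by (rule LIMSEQ_SUP)
  have nt: "f k \<noteq> \<top>" for k
    using False by (metis SUP_upper UNIV_I top.extremum_unique)
  have "(\<lambda>k. ennreal (exp (- enn2real (f k)))) \<longlonglongrightarrow> ennreal (exp (- enn2real (SUP k. f k)))"
  proof (intro tendsto_ennrealI tendsto_exp tendsto_minus tendsto_enn2real)
    show "f \<longlonglongrightarrow> ennreal (enn2real (SUP k. f k))"
      using lim False by (subst ennreal_enn2real) (auto simp only: less_top)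
  qed simp
  then show ?thesis
    using False nt by (simp only: eneg_def if_False)
qed

lemma tendsto_eneg_SUP_nn_integral:
  assumes inc: "\<And>x. x \<in> space M \<Longrightarrow> incseq (\<lambda>k. S k x)"
    and meas: "\<And>k. (\<lambda>x. S k x) \<in> borel_measurable M" and fin: "finite_measure M"
  shows "(\<lambda>k. \<integral>\<^sup>+x. eneg (S k x) \<partial>M) \<longlonglongrightarrow> (\<integral>\<^sup>+x. eneg (SUP k. S k x) \<partial>M)"
proof (rule nn_integral_dominated_convergence[where w = "\<lambda>_. 1"])
  interpret finite_measure M by fact
  show "(\<integral>\<^sup>+x. 1 \<partial>M) < \<infinity>" by (simp add: less_top[symmetric])
qed (use assms in \<open>auto intro!: tendsto_eneg_incseq eneg_le_1\<close>)

text \<open>The disc of squared radius \<open>z\<close> has area \<open>pi * z\<close>, so the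
  squared norm maps planar Lebesgue measure to \<open>pi\<close> times length on the half-line. The
  half-lines \<open>{..z}\<close> generate the Borel sets and have finite measure.\<close>

lemma nn_integral_radial:
  fixes g :: "real \<Rightarrow> ennreal"
  assumes [measurable]: "g \<in> borel_measurable borel"
  shows "(\<integral>\<^sup>+(x::real^2). g ((norm x)\<^sup>2) \<partial>lborel) = ennreal pi * (\<integral>\<^sup>+v\<in>{0<..}. g v \<partial>lborel)"
proof -
  let ?N = "distr lborel borel (\<lambda>x::real^2. (norm x)\<^sup>2)"
  let ?L = "density lborel (\<lambda>v::real. ennreal pi * indicator {0<..} v)"
  have eqN: "emeasure ?N {..z} = (if z < 0 then 0 else ennreal (pi * z))" for z
  proof -
    have "emeasure ?N {..z} = emeasure lborel {x::real^2. (norm x)\<^sup>2 \<le> z}"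
      by (subst emeasure_distr) (auto simp: vimage_def)
    also have "{x::real^2. (norm x)\<^sup>2 \<le> z} = (if z < 0 then {} else cball 0 (sqrt z))"
    proof (cases "z < 0")
      case True
      then have "\<not> (norm x)\<^sup>2 \<le> z" for x :: "real^2"
        using zero_le_power2[of "norm x"] by linarith
      then show ?thesis using True by simp
    next
      case False
      then show ?thesis
        by (auto simp: real_le_rsqrt sqrt_ge_absD)
    qed
    also have "emeasure lborel \<dots> = (if z < 0 then 0 else ennreal (pi * z))"
      by (auto simp: emeasure_cball unit_ball_vol_2)
    finally show ?thesis .
  qed
  have eqL: "emeasure ?L {..z} = (if z < 0 then 0 else ennreal (pi * z))" for z
  proof -
    have "emeasure ?L {..z} = (\<integral>\<^sup>+v. ennreal pi * indicator {0<..z} v \<partial>lborel)"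
      by (subst emeasure_density) (auto intro!: nn_integral_cong split: split_indicator)
    also have "\<dots> = ennreal pi * emeasure lborel {0<..z}"
      by (rule nn_integral_cmult_indicator) simp
    also have "\<dots> = (if z < 0 then 0 else ennreal (pi * z))"
      by (auto simp: ennreal_mult')
    finally show ?thesis .
  qed
  have sets_borel: "sets (borel :: real measure) = sigma_sets UNIV (range atMost)"
    unfolding borel_eq_atMost by (rule sets_measure_of) simp
  have "?N = ?L"
  proof (rule measure_eqI_generator_eq[where E = "range atMost" and A = "\<lambda>n. {..real n}" and \<Omega> = UNIV])
    show "Int_stable (range (atMost :: real \<Rightarrow> _))"
      by (auto simp: Int_stable_def)
    show "emeasure ?N X = emeasure ?L X" if "X \<in> range atMost" for X
      using that by (auto simp only: eqN eqL)
    show "sets ?N = sigma_sets UNIV (range atMost)"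
      by (simp only: sets_distr sets_borel)
    show "sets ?L = sigma_sets UNIV (range atMost)"
      by (simp only: sets_density sets_lborel sets_borel)
    show "(\<Union>i. {..real i}) = UNIV"
      using real_nat_ceiling_ge by blast
    show "emeasure ?N {..real i} \<noteq> \<infinity>" for i
      by (simp only: eqN) auto
  qed auto
  have "(\<integral>\<^sup>+(x::real^2). g ((norm x)\<^sup>2) \<partial>lborel) = (\<integral>\<^sup>+v. g v \<partial>?N)"
    by (subst nn_integral_distr) auto
  also have "\<dots> = (\<integral>\<^sup>+v. g v \<partial>?L)"
    by (simp only: \<open>?N = ?L\<close>)
  also have "\<dots> = (\<integral>\<^sup>+v. ennreal pi * (g v * indicator {0<..} v) \<partial>lborel)"
    by (subst nn_integral_density) (auto intro!: nn_integral_cong split: split_indicator)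
  also have "\<dots> = ennreal pi * (\<integral>\<^sup>+v\<in>{0<..}. g v \<partial>lborel)"
    by (rule nn_integral_cmult) simp
  finally show ?thesis .
qed

lemma nn_integral_scale_Ioi:
  fixes g :: "real \<Rightarrow> ennreal"
  assumes [measurable]: "g \<in> borel_measurable borel" and "a > 0"
  shows "(\<integral>\<^sup>+v\<in>{0<..}. g v \<partial>lborel) = ennreal a * (\<integral>\<^sup>+u\<in>{0<..}. g (a * u) \<partial>lborel)"
proof -
  have "(\<integral>\<^sup>+v\<in>{0<..}. g v \<partial>lborel)
      = ennreal \<bar>a\<bar> * (\<integral>\<^sup>+u. g (0 + a * u) * indicator {0<..} (0 + a * u) \<partial>lborel)"
    using assms by (intro nn_integral_real_affine) auto
  then show ?thesis
    using \<open>a > 0\<close> by (auto intro!: arg_cong2[where f = "(*)"] nn_integral_cong simp: zero_less_mult_iff split: split_indicator)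
qed

text \<open>The change of variables sends a base station at \<open>x\<close> with fading \<open>t\<close> to the area
  \<open>u\<close> for which the received power is \<open>u powr (-\<alpha>/2)\<close>; in this coordinate the received
  powers have constant intensity.\<close>

lemma received_power_intensity:
  fixes g :: "real \<Rightarrow> ennreal"
  assumes [measurable]: "g \<in> borel_measurable borel" and "\<alpha> > 2" "P > 0"
    and g0: "\<And>y. y \<le> 0 \<Longrightarrow> g y = 0"
  shows "(\<integral>\<^sup>+(x::real^2). (\<integral>\<^sup>+t. ennreal (exponential_density 1 t) * g (P * t * norm x powr (-\<alpha>)) \<partial>lborel) \<partial>lborel)
    = ennreal (pi * P powr (2/\<alpha>) * Gamma (1 + 2/\<alpha>)) * (\<integral>\<^sup>+u\<in>{0<..}. g (u powr (-\<alpha>/2)) \<partial>lborel)"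
proof -
  let ?G = "\<integral>\<^sup>+u\<in>{0<..}. g (u powr (-\<alpha>/2)) \<partial>lborel"
  \<comment> \<open>For a fixed fading value the substitution
    \<open>v = (P * t) powr (2/\<alpha>) * u\<close> absorbs both transmit power and fading into a
    scalar factor.\<close>
  have inner: "(\<integral>\<^sup>+(x::real^2). g (P * t * norm x powr (-\<alpha>)) \<partial>lborel)
      = ennreal (pi * (P * t) powr (2/\<alpha>)) * ?G" if "t > 0" for t
  proof -
    have "P * t > 0" using that \<open>P > 0\<close> by simp
    have "norm x powr (-\<alpha>) = ((norm x)\<^sup>2) powr (-\<alpha>/2)" for x :: "real^2"
      by (cases "x = 0") (auto simp: powr_numeral[symmetric] powr_powr simp del: powr_numeral)
    then have "(\<integral>\<^sup>+(x::real^2). g (P * t * norm x powr (-\<alpha>)) \<partial>lborel)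
        = (\<integral>\<^sup>+(x::real^2). g (P * t * ((norm x)\<^sup>2) powr (-\<alpha>/2)) \<partial>lborel)"
      by simp
    also have "\<dots> = ennreal pi * (\<integral>\<^sup>+v\<in>{0<..}. g (P * t * v powr (-\<alpha>/2)) \<partial>lborel)"
      by (rule nn_integral_radial) measurable
    also have "(\<integral>\<^sup>+v\<in>{0<..}. g (P * t * v powr (-\<alpha>/2)) \<partial>lborel)
       = ennreal ((P * t) powr (2/\<alpha>)) *
           (\<integral>\<^sup>+u\<in>{0<..}. g (P * t * ((P * t) powr (2/\<alpha>) * u) powr (-\<alpha>/2)) \<partial>lborel)"
      using \<open>P * t > 0\<close> by (intro nn_integral_scale_Ioi) auto
    also have "(\<integral>\<^sup>+u\<in>{0<..}. g (P * t * ((P * t) powr (2/\<alpha>) * u) powr (-\<alpha>/2)) \<partial>lborel) = ?G"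
    proof (rule nn_integral_cong)
      fix u
      have "P * t * ((P * t) powr (2/\<alpha>) * u) powr (-\<alpha>/2) = u powr (-\<alpha>/2)" if "u > 0"
        using \<open>P > 0\<close> \<open>t > 0\<close> \<open>\<alpha> > 2\<close> that by (simp add: powr_mult powr_powr powr_minus field_simps)
      then show "g (P * t * ((P * t) powr (2/\<alpha>) * u) powr (-\<alpha>/2)) * indicator {0<..} u
          = g (u powr (-\<alpha>/2)) * indicator {0<..} u"
        by (auto split: split_indicator)
    qed
    finally show ?thesis
      by (simp add: ennreal_mult' mult_ac)
  qed
  have "(\<integral>\<^sup>+(x::real^2). (\<integral>\<^sup>+t. ennreal (exponential_density 1 t) * g (P * t * norm x powr (-\<alpha>)) \<partial>lborel) \<partial>lborel)
      = (\<integral>\<^sup>+t. (\<integral>\<^sup>+(x::real^2). ennreal (exponential_density 1 t) * g (P * t * norm x powr (-\<alpha>)) \<partial>lborel) \<partial>lborel)"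
    by (rule lborel_pair.Fubini') measurable
  also have "\<dots> = (\<integral>\<^sup>+t. ennreal (exponential_density 1 t) * (\<integral>\<^sup>+(x::real^2). g (P * t * norm x powr (-\<alpha>)) \<partial>lborel) \<partial>lborel)"
    by (intro nn_integral_cong nn_integral_cmult) measurable
  \<comment> \<open>What remains is the moment of order \<open>2/\<alpha>\<close> of the exponential
    law, the origin of \<open>Gamma (1 + 2/\<alpha>)\<close>. At \<open>t = 0\<close> the density is
    \<open>1\<close>, and both sides vanish there by \<open>g0\<close>.\<close>
  also have "\<dots> = (\<integral>\<^sup>+t. (ennreal (pi * P powr (2/\<alpha>)) * ?G) *
        ennreal (indicat_real {0..} t * t powr ((1 + 2/\<alpha>) - 1) / exp t) \<partial>lborel)"
  proof (intro nn_integral_cong)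
    fix t :: real
    show "ennreal (exponential_density 1 t) * (\<integral>\<^sup>+(x::real^2). g (P * t * norm x powr (-\<alpha>)) \<partial>lborel)
       = (ennreal (pi * P powr (2/\<alpha>)) * ?G) * ennreal (indicat_real {0..} t * t powr ((1 + 2/\<alpha>) - 1) / exp t)"
    proof (cases "t > 0")
      case True
      have "ennreal (exp (- t)) * (ennreal (pi * (P * t) powr (2/\<alpha>)) * ?G)
          = ennreal (exp (- t) * (pi * (P * t) powr (2/\<alpha>))) * ?G"
        by (simp add: ennreal_mult' mult.assoc)
      also have "exp (- t) * (pi * (P * t) powr (2/\<alpha>)) = pi * P powr (2/\<alpha>) * (t powr (2/\<alpha>) / exp t)"
        using True \<open>P > 0\<close> by (simp add: powr_mult exp_minus field_simps)
      also have "ennreal \<dots> = ennreal (pi * P powr (2/\<alpha>)) * ennreal (t powr (2/\<alpha>) / exp t)"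
        by (rule ennreal_mult) auto
      finally show ?thesis
        using True by (simp only: inner[OF True]) (simp add: exponential_density_def mult_ac)
    next
      case False
      then show ?thesis
        using \<open>\<alpha> > 2\<close> g0 by (cases "t = 0") (auto simp: exponential_density_def)
    qed
  qed
  also have "\<dots> = (ennreal (pi * P powr (2/\<alpha>)) * ?G) * ennreal (Gamma (1 + 2/\<alpha>))"
    using \<open>\<alpha> > 2\<close> by (subst nn_integral_cmult) (auto simp: Gamma_conv_nn_integral_real add_pos_pos)
  also have "\<dots> = ennreal (pi * P powr (2/\<alpha>) * Gamma (1 + 2/\<alpha>)) * ?G"
    using \<open>\<alpha> > 2\<close> by (subst (2) ennreal_mult') (auto simp: mult_ac Gamma_real_nonneg)
  finally show ?thesis .
qed

text \<open>Writing \<open>1 - exp (- w)\<close> as the integral of \<open>exp (- v)\<close> over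
  \<open>{0..w}\<close> and exchanging integrals leaves the length
  \<open>(s / v) powr (2/\<alpha>)\<close> of a set of \<open>u\<close>, hence a Gamma integral. It
  converges at \<open>v = 0\<close> because \<open>\<alpha> > 2\<close>. This exponent is what makes
  the total power stable.\<close>

lemma nn_integral_stable_exponent:
  fixes \<alpha> s :: real
  assumes "\<alpha> > 2" "s > 0"
  shows "(\<integral>\<^sup>+u\<in>{0<..}. ennreal (1 - exp (- (s * u powr (-\<alpha>/2)))) \<partial>lborel)
    = ennreal (s powr (2/\<alpha>) * Gamma (1 - 2/\<alpha>))"
proof -
  have e: "ennreal (1 - exp (- w)) = (\<integral>\<^sup>+v. ennreal (exp (- v)) * indicator {0..w} v \<partial>lborel)" if "w \<ge> 0" for w :: real
    by (subst nn_integral_FTC_Icc[where F = "\<lambda>v. - exp (- v)"])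
       (use that in \<open>auto intro!: derivative_eq_intros\<close>)
  have "(\<integral>\<^sup>+u\<in>{0<..}. ennreal (1 - exp (- (s * u powr (-\<alpha>/2)))) \<partial>lborel)
     = (\<integral>\<^sup>+u. (\<integral>\<^sup>+v. ennreal (exp (- v)) * indicator {0..s * u powr (-\<alpha>/2)} v * indicator {0<..} u \<partial>lborel) \<partial>lborel)"
  proof (intro nn_integral_cong)
    fix u :: real
    show "ennreal (1 - exp (- (s * u powr (-\<alpha>/2)))) * indicator {0<..} u
      = (\<integral>\<^sup>+v. ennreal (exp (- v)) * indicator {0..s * u powr (-\<alpha>/2)} v * indicator {0<..} u \<partial>lborel)"
      using assms by (subst nn_integral_multc) (auto simp: e)
  qed
  also have "\<dots> = (\<integral>\<^sup>+v. (\<integral>\<^sup>+u. ennreal (exp (- v)) * indicator {0..s * u powr (-\<alpha>/2)} v * indicator {0<..} u \<partial>lborel) \<partial>lborel)"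
  proof (rule lborel_pair.Fubini')
    \<comment> \<open>The interval in \<open>v\<close> depends on \<open>u\<close>; written as a set
      of pairs it is accessible to \<open>measurable\<close>.\<close>
    have "(\<lambda>(v, u). ennreal (exp (- v)) * indicator {x. 0 \<le> snd x \<and> snd x \<le> s * fst x powr (-\<alpha>/2)} (u, v) * indicator {0<..} u)
        \<in> borel_measurable (lborel \<Otimes>\<^sub>M lborel)"
      by measurable
    also have "(\<lambda>(v, u). ennreal (exp (- v)) * indicator {x. 0 \<le> snd x \<and> snd x \<le> s * fst x powr (-\<alpha>/2)} (u, v) * indicator {0<..} u)
       = (\<lambda>(v, u). ennreal (exp (- v)) * indicator {0..s * u powr (-\<alpha>/2)} v * indicator {0<..} u)"
      by (auto simp: fun_eq_iff split: split_indicator)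
    finally show "(\<lambda>(v, u). ennreal (exp (- v)) * indicator {0..s * u powr (-\<alpha>/2)} v * indicator {0<..} u)
        \<in> borel_measurable (lborel \<Otimes>\<^sub>M lborel)" .
  qed
  also have "\<dots> = (\<integral>\<^sup>+v. ennreal (s powr (2/\<alpha>)) * ennreal (indicat_real {0..} v * v powr ((1 - 2/\<alpha>) - 1) / exp v) \<partial>lborel)"
  proof (rule nn_integral_cong_AE, rule AE_mp[OF AE_lborel_singleton[of 0]], rule AE_I2, rule impI)
    fix v :: real assume "v \<noteq> 0"
    have "(\<integral>\<^sup>+u. ennreal (exp (- v)) * indicator {0..s * u powr (-\<alpha>/2)} v * indicator {0<..} u \<partial>lborel)
       = (\<integral>\<^sup>+u. ennreal (exp (- v)) * indicator {0..} v * indicator {0<..(s / v) powr (2/\<alpha>)} u \<partial>lborel)"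
    proof (rule nn_integral_cong)
      fix u :: real
      have "v \<le> s * u powr (-\<alpha>/2) \<longleftrightarrow> u \<le> (s / v) powr (2/\<alpha>)" if "v > 0" "u > 0"
      proof -
        have "v \<le> s * u powr (-\<alpha>/2) \<longleftrightarrow> u powr (\<alpha>/2) \<le> s / v"
          using that by (simp add: powr_minus field_simps)
        also have "\<dots> \<longleftrightarrow> u \<le> (s / v) powr (2/\<alpha>)"
        proof
          assume "u powr (\<alpha>/2) \<le> s / v"
          then have "(u powr (\<alpha>/2)) powr (2/\<alpha>) \<le> (s / v) powr (2/\<alpha>)"
            using assms by (intro powr_mono2) auto
          then show "u \<le> (s / v) powr (2/\<alpha>)" using that assms by (simp add: powr_powr)
        next
          assume "u \<le> (s / v) powr (2/\<alpha>)"
          then have "u powr (\<alpha>/2) \<le> ((s / v) powr (2/\<alpha>)) powr (\<alpha>/2)"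
            using assms that by (intro powr_mono2) auto
          then show "u powr (\<alpha>/2) \<le> s / v" using that assms by (simp add: powr_powr)
        qed
        finally show ?thesis .
      qed
      then show "ennreal (exp (- v)) * indicator {0..s * u powr (-\<alpha>/2)} v * indicator {0<..} u
        = ennreal (exp (- v)) * indicator {0..} v * indicator {0<..(s / v) powr (2/\<alpha>)} u"
        using \<open>v \<noteq> 0\<close> by (auto split: split_indicator)
    qed
    also have "\<dots> = ennreal (exp (- v)) * indicator {0..} v * ennreal ((s / v) powr (2/\<alpha>))"
      by (subst nn_integral_cmult_indicator) auto
    also have "\<dots> = ennreal (s powr (2/\<alpha>)) * ennreal (indicat_real {0..} v * v powr ((1 - 2/\<alpha>) - 1) / exp v)"
      using assms \<open>v \<noteq> 0\<close>
      by (auto simp: powr_divide powr_minus exp_minus field_simps simp flip: ennreal_mult split: split_indicator)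
    finally show "(\<integral>\<^sup>+u. ennreal (exp (- v)) * indicator {0..s * u powr (-\<alpha>/2)} v * indicator {0<..} u \<partial>lborel)
       = ennreal (s powr (2/\<alpha>)) * ennreal (indicat_real {0..} v * v powr ((1 - 2/\<alpha>) - 1) / exp v)" .
  qed
  also have "\<dots> = ennreal (s powr (2/\<alpha>)) * ennreal (Gamma (1 - 2/\<alpha>))"
    using assms by (subst nn_integral_cmult) (auto simp: Gamma_conv_nn_integral_real)
  finally show ?thesis
    using assms by (simp add: ennreal_mult Gamma_real_nonneg)
qed

text \<open>The Gamma integral after rescaling. Read from right to left it writes a negative power
  as a mixture of exponentials, which is how the negative moments of \<open>I\<close> come out of
  its Laplace transform.\<close>

lemma nn_integral_powr_exp:
  fixes p x :: real
  assumes "p > 0" "x > 0"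
  shows "(\<integral>\<^sup>+s\<in>{0<..}. ennreal (s powr (p - 1) * exp (- (s * x))) \<partial>lborel) = ennreal (Gamma p * x powr (- p))"
proof -
  have "(\<integral>\<^sup>+s\<in>{0<..}. ennreal (s powr (p - 1) * exp (- (s * x))) \<partial>lborel)
     = ennreal (1 / x) * (\<integral>\<^sup>+t\<in>{0<..}. ennreal ((1 / x * t) powr (p - 1) * exp (- (1 / x * t * x))) \<partial>lborel)"
    using assms by (intro nn_integral_scale_Ioi) auto
  also have "(\<integral>\<^sup>+t\<in>{0<..}. ennreal ((1 / x * t) powr (p - 1) * exp (- (1 / x * t * x))) \<partial>lborel)
     = (\<integral>\<^sup>+t. ennreal (x powr (1 - p)) * ennreal (indicat_real {0..} t * t powr (p - 1) / exp t) \<partial>lborel)"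
  proof (rule nn_integral_cong_AE, rule AE_mp[OF AE_lborel_singleton[of 0]], rule AE_I2, rule impI)
    fix t :: real assume "t \<noteq> 0"
    have "(1 / x * t) powr (p - 1) = x powr (1 - p) * t powr (p - 1)" if "t > 0"
      using that assms powr_minus[of x "p - 1"] by (simp add: powr_divide field_simps)
    then show "ennreal ((1 / x * t) powr (p - 1) * exp (- (1 / x * t * x))) * indicator {0<..} t
      = ennreal (x powr (1 - p)) * ennreal (indicat_real {0..} t * t powr (p - 1) / exp t)"
      using assms \<open>t \<noteq> 0\<close> by (auto simp: exp_minus field_simps simp flip: ennreal_mult split: split_indicator)
  qed
  also have "\<dots> = ennreal (x powr (1 - p)) * ennreal (Gamma p)"
    using assms by (subst nn_integral_cmult) (auto simp: Gamma_conv_nn_integral_real)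
  also have "ennreal (1 / x) * \<dots> = ennreal (Gamma p * x powr (- p))"
    using assms by (simp add: powr_diff powr_minus field_simps flip: ennreal_mult)
  finally show ?thesis .
qed

text \<open>In place of the substitution \<open>w = s powr \<delta>\<close>, the factor
  \<open>exp (- (\<eta> * s powr \<delta>))\<close> is written as the tail integral of
  \<open>\<eta> * exp (- (\<eta> * w))\<close> over \<open>w \<ge> s powr \<delta>\<close>. After
  the exchange the \<open>s\<close>-integral is that of a pure power.\<close>

lemma nn_integral_powr_exp_powr:
  fixes \<delta> \<eta> :: real
  assumes "\<delta> > 0" "\<eta> > 0" "m > 0"
  shows "(\<integral>\<^sup>+s\<in>{0<..}. ennreal (s powr (real m * \<delta> - 1) * exp (- (\<eta> * s powr \<delta>))) \<partial>lborel)
    = ennreal (fact m / (real m * \<delta> * \<eta> ^ m))"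
proof -
  have md: "real m * \<delta> > 0" using assms by simp
  have e: "ennreal (exp (- (\<eta> * a))) = (\<integral>\<^sup>+w. ennreal (\<eta> * exp (- (\<eta> * w))) * indicator {a..} w \<partial>lborel)" for a
  proof -
    have "((\<lambda>w. - exp (- (\<eta> * w))) \<longlongrightarrow> - 0) at_top"
      using \<open>\<eta> > 0\<close> by real_asymp
    then have "(\<integral>\<^sup>+w. ennreal (\<eta> * exp (- (\<eta> * w))) * indicator {a..} w \<partial>lborel) = 0 - (- exp (- (\<eta> * a)))"
      using \<open>\<eta> > 0\<close> by (intro nn_integral_FTC_atLeast) (auto intro!: derivative_eq_intros)
    then show ?thesis by simp
  qed
  have inner: "(\<integral>\<^sup>+s. ennreal (s powr (real m * \<delta> - 1)) * indicator {0..c} s \<partial>lborel) = ennreal (c powr (real m * \<delta>) / (real m * \<delta>))"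
    if "c \<ge> 0" for c
    using nn_integral_has_integral_lebesgue'[OF _ has_integral_powr_from_0[of "real m * \<delta> - 1" c]] md that by simp
  have "(\<integral>\<^sup>+s\<in>{0<..}. ennreal (s powr (real m * \<delta> - 1) * exp (- (\<eta> * s powr \<delta>))) \<partial>lborel)
     = (\<integral>\<^sup>+s. (\<integral>\<^sup>+w. ennreal (s powr (real m * \<delta> - 1)) * indicator {0<..} s * (ennreal (\<eta> * exp (- (\<eta> * w))) * indicator {s powr \<delta>..} w) \<partial>lborel) \<partial>lborel)"
  proof (intro nn_integral_cong)
    fix s :: real
    show "ennreal (s powr (real m * \<delta> - 1) * exp (- (\<eta> * s powr \<delta>))) * indicator {0<..} s
      = (\<integral>\<^sup>+w. ennreal (s powr (real m * \<delta> - 1)) * indicator {0<..} s * (ennreal (\<eta> * exp (- (\<eta> * w))) * indicator {s powr \<delta>..} w) \<partial>lborel)"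
      by (subst nn_integral_cmult, measurable, subst e[symmetric]) (auto simp: ennreal_mult split: split_indicator)
  qed
  also have "\<dots> = (\<integral>\<^sup>+w. (\<integral>\<^sup>+s. ennreal (s powr (real m * \<delta> - 1)) * indicator {0<..} s * (ennreal (\<eta> * exp (- (\<eta> * w))) * indicator {s powr \<delta>..} w) \<partial>lborel) \<partial>lborel)"
  proof (rule lborel_pair.Fubini')
    have "(\<lambda>(w, s). ennreal (s powr (real m * \<delta> - 1)) * indicator {0<..} s * (ennreal (\<eta> * exp (- (\<eta> * w))) * indicator {x. fst x powr \<delta> \<le> snd x} (s, w)))
        \<in> borel_measurable (lborel \<Otimes>\<^sub>M lborel)"
      by measurable
    also have "(\<lambda>(w, s). ennreal (s powr (real m * \<delta> - 1)) * indicator {0<..} s * (ennreal (\<eta> * exp (- (\<eta> * w))) * indicator {x. fst x powr \<delta> \<le> snd x} (s, w)))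
       = (\<lambda>(w, s). ennreal (s powr (real m * \<delta> - 1)) * indicator {0<..} s * (ennreal (\<eta> * exp (- (\<eta> * w))) * indicator {s powr \<delta>..} w))"
      by (auto simp: fun_eq_iff split: split_indicator)
    finally show "(\<lambda>(w, s). ennreal (s powr (real m * \<delta> - 1)) * indicator {0<..} s * (ennreal (\<eta> * exp (- (\<eta> * w))) * indicator {s powr \<delta>..} w))
        \<in> borel_measurable (lborel \<Otimes>\<^sub>M lborel)" .
  qed
  \<comment> \<open>The \<open>s\<close>-integral up to \<open>w powr (1/\<delta>)\<close>
    contributes \<open>w ^ m\<close>, so the Gamma argument is \<open>m + 1\<close> and the
    factorial appears.\<close>
  also have "\<dots> = (\<integral>\<^sup>+w\<in>{0<..}. ennreal (\<eta> / (real m * \<delta>)) * ennreal (w powr (real (m + 1) - 1) * exp (- (w * \<eta>))) \<partial>lborel)"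
  proof (rule nn_integral_cong_AE, rule AE_mp[OF AE_lborel_singleton[of 0]], rule AE_I2, rule impI)
    fix w :: real assume "w \<noteq> 0"
    show "(\<integral>\<^sup>+s. ennreal (s powr (real m * \<delta> - 1)) * indicator {0<..} s * (ennreal (\<eta> * exp (- (\<eta> * w))) * indicator {s powr \<delta>..} w) \<partial>lborel)
      = ennreal (\<eta> / (real m * \<delta>)) * ennreal (w powr (real (m + 1) - 1) * exp (- (w * \<eta>))) * indicator {0<..} w"
    proof (cases "w > 0")
      case False
      have "indicator {s powr \<delta>..} w = (0 :: ennreal)" for s
        using False \<open>w \<noteq> 0\<close> powr_ge_zero[of s \<delta>] by (auto simp del: powr_ge_zero split: split_indicator)
      then show ?thesis using False by simp
    next
      case True
      have "(\<integral>\<^sup>+s. ennreal (s powr (real m * \<delta> - 1)) * indicator {0<..} s * (ennreal (\<eta> * exp (- (\<eta> * w))) * indicator {s powr \<delta>..} w) \<partial>lborel)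
        = (\<integral>\<^sup>+s. ennreal (\<eta> * exp (- (\<eta> * w))) * (ennreal (s powr (real m * \<delta> - 1)) * indicator {0..w powr (1/\<delta>)} s) \<partial>lborel)"
      proof (rule nn_integral_cong)
        fix s :: real
        have "s powr \<delta> \<le> w \<longleftrightarrow> s \<le> w powr (1/\<delta>)" if "s > 0"
        proof
          assume "s powr \<delta> \<le> w"
          then have "(s powr \<delta>) powr (1/\<delta>) \<le> w powr (1/\<delta>)"
            using assms by (intro powr_mono2) auto
          then show "s \<le> w powr (1/\<delta>)" using that assms by (simp add: powr_powr)
        next
          assume "s \<le> w powr (1/\<delta>)"
          then have "s powr \<delta> \<le> (w powr (1/\<delta>)) powr \<delta>"
            using assms that by (intro powr_mono2) auto
          then show "s powr \<delta> \<le> w" using True assms by (simp add: powr_powr)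
        qed
        then show "ennreal (s powr (real m * \<delta> - 1)) * indicator {0<..} s * (ennreal (\<eta> * exp (- (\<eta> * w))) * indicator {s powr \<delta>..} w)
          = ennreal (\<eta> * exp (- (\<eta> * w))) * (ennreal (s powr (real m * \<delta> - 1)) * indicator {0..w powr (1/\<delta>)} s)"
          by (cases "s = 0") (auto simp: mult_ac split: split_indicator)
      qed
      also have "\<dots> = ennreal (\<eta> * exp (- (\<eta> * w))) * ennreal ((w powr (1/\<delta>)) powr (real m * \<delta>) / (real m * \<delta>))"
        by (subst nn_integral_cmult) (auto simp: inner)
      also have "(w powr (1/\<delta>)) powr (real m * \<delta>) = w powr real m"
        using assms by (simp add: powr_powr)
      finally show ?thesis
        using True assms by (simp add: mult_ac flip: ennreal_mult)
    qed
  qed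
  also have "\<dots> = ennreal (\<eta> / (real m * \<delta>)) * ennreal (Gamma (real (m + 1)) * \<eta> powr (- real (m + 1)))"
    using assms by (subst mult.assoc, subst nn_integral_cmult, measurable, subst nn_integral_powr_exp) auto
  also have "\<eta> powr (- real (m + 1)) = 1 / \<eta> ^ Suc m"
    by (simp only: powr_minus powr_realpow[OF \<open>\<eta> > 0\<close>] Suc_eq_plus1 inverse_eq_divide)
  also have "Gamma (real (m + 1)) = fact m"
    using Gamma_fact[of m, where 'a = real] by (simp add: add.commute)
  finally show ?thesis
    using assms by (simp add: field_simps flip: ennreal_mult)
qed

text \<open>Only the part \<open>t \<ge> L\<close> of the Gamma integral is kept, where
  \<open>t powr x \<ge> L powr x\<close>. Since \<open>L\<close> is free, Gamma outgrows every
  geometric sequence, which is all that the convergence proofs need.\<close>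

lemma Gamma_lower_bound:
  fixes x L :: real
  assumes "x \<ge> 0" "L \<ge> 0"
  shows "L powr x * exp (- L) \<le> Gamma (1 + x)"
proof -
  have "((\<lambda>t::real. - exp (- t)) \<longlongrightarrow> - 0) at_top"
    by real_asymp
  then have "(\<integral>\<^sup>+t. ennreal (exp (- t)) * indicator {L..} t \<partial>lborel) = 0 - (- exp (- L))"
    by (intro nn_integral_FTC_atLeast) (auto intro!: derivative_eq_intros)
  then have "ennreal (L powr x * exp (- L)) = (\<integral>\<^sup>+t. ennreal (L powr x) * (ennreal (exp (- t)) * indicator {L..} t) \<partial>lborel)"
    by (subst nn_integral_cmult) (auto simp: ennreal_mult)
  also have "\<dots> \<le> (\<integral>\<^sup>+t. ennreal (indicat_real {0..} t * t powr ((1 + x) - 1) / exp t) \<partial>lborel)"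
    using assms by (intro nn_integral_mono)
      (auto simp: exp_minus field_simps powr_mono2 simp flip: ennreal_mult split: split_indicator intro!: ennreal_leI mult_right_mono divide_right_mono)
  also have "\<dots> = ennreal (Gamma (1 + x))"
    using assms by (subst Gamma_conv_nn_integral_real) auto
  finally show ?thesis
    using assms by (simp add: Gamma_real_nonneg)
qed

text \<open>The shift \<open>k\<close> and the factor \<open>Suc m\<close> serve the moments of
  order \<open>m\<close> and \<open>m + 1\<close> alike: dividing the latter by
  \<open>fact m\<close> leaves a factor \<open>m + 1\<close>.\<close>

lemma summable_Mittag_Leffler:
  fixes \<delta> a :: real
  assumes "\<delta> > 0" "a \<ge> 0"
  shows "summable (\<lambda>m. real (Suc m) * a ^ m / Gamma (1 + real (m + k) * \<delta>))"
proof -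
  \<comment> \<open>One factor \<open>2\<close> of the \<open>4\<close> pays for
    \<open>Suc m \<le> 2 ^ m\<close>, the other gives the geometric majorant. The summand
    \<open>1\<close> keeps the base at least \<open>1\<close>, so that passing from exponent
    \<open>m\<close> to \<open>m + k\<close> enlarges the power.\<close>
  define L where "L = (4 * a + 1) powr (1 / \<delta>)"
  have L: "L > 0" "L powr \<delta> = 4 * a + 1"
    using assms by (auto simp: L_def powr_powr)
  have bound: "real (Suc m) * a ^ m / Gamma (1 + real (m + k) * \<delta>) \<le> exp L * (1 / 2) ^ m" for m
  proof -
    have pos: "Gamma (1 + real (m + k) * \<delta>) > 0"
      using assms by (intro Gamma_real_pos) (auto intro: add_pos_nonneg)
    have "real (Suc m) \<le> 2 ^ m"
      by (induction m) auto
    then have "real (Suc m) * a ^ m \<le> 2 ^ m * a ^ m"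
      using assms by (intro mult_right_mono) auto
    also have "\<dots> = (4 * a) ^ m * (1 / 2) ^ m"
      by (simp only: power_mult_distrib[symmetric]) simp
    also have "\<dots> \<le> (4 * a + 1) ^ (m + k) * (1 / 2) ^ m"
    proof (rule mult_right_mono)
      have "(4 * a) ^ m \<le> (4 * a + 1) ^ m"
        using assms by (intro power_mono) auto
      also have "\<dots> \<le> (4 * a + 1) ^ (m + k)"
        using assms by (intro power_increasing) auto
      finally show "(4 * a) ^ m \<le> (4 * a + 1) ^ (m + k)" .
    qed simp
    also have "(4 * a + 1) ^ (m + k) = L powr (real (m + k) * \<delta>)"
      using L assms by (simp add: mult.commute powr_powr[symmetric] powr_realpow del: of_nat_add)
    also have "L powr (real (m + k) * \<delta>) \<le> exp L * Gamma (1 + real (m + k) * \<delta>)"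
      using Gamma_lower_bound[of "real (m + k) * \<delta>" L] L assms by (simp add: exp_minus field_simps del: of_nat_add)
    finally show ?thesis
      using pos by (simp add: field_simps mult_right_mono)
  qed
  show ?thesis
  proof (rule summable_comparison_test')
    show "summable (\<lambda>m. exp L * (1 / 2) ^ m :: real)"
      by (intro summable_mult summable_geometric) simp
    show "norm (real (Suc m) * a ^ m / Gamma (1 + real (m + k) * \<delta>)) \<le> exp L * (1 / 2) ^ m" if "m \<ge> 0" for m
    proof -
      have "Gamma (1 + real (m + k) * \<delta>) > 0"
        using assms by (intro Gamma_real_pos) (auto intro: add_pos_nonneg)
      then have "real (Suc m) * a ^ m / Gamma (1 + real (m + k) * \<delta>) \<ge> 0"
        using assms by (intro divide_nonneg_pos) auto
      then show ?thesis using bound[of m] by simp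
    qed
  qed
qed

section \<open>Uniqueness of Laplace transforms\<close>

text \<open>Lower orthants are closed under intersection and generate the Borel sets. The measures
  need be finite only on each orthant, which matters for the Campbell measure; the result is used in
  dimensions one, two and three.\<close>

lemma finite_measure_eqI_atMost:
  fixes \<mu> \<nu> :: "'a::ordered_euclidean_space measure"
  assumes "sets \<mu> = sets borel" "sets \<nu> = sets borel"
    and eq: "\<And>a. emeasure \<mu> {..a} = emeasure \<nu> {..a}"
    and fin: "\<And>a. emeasure \<mu> {..a} \<noteq> \<infinity>"
  shows "\<mu> = \<nu>"
proof -
  have sets_borel: "sets (borel :: 'a measure) = sigma_sets UNIV (range atMost)"
    unfolding borel_eq_atMost by (rule sets_measure_of) simp
  show ?thesis
  proof (rule measure_eqI_generator_eq[where E = "range atMost" and A = "\<lambda>n. {..real n *\<^sub>R One}" and \<Omega> = UNIV])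
    show "Int_stable (range (atMost :: 'a \<Rightarrow> _))"
    proof (rule Int_stableI)
      fix a b :: "'a set" assume "a \<in> range atMost" "b \<in> range atMost"
      then obtain x y where "a = {..x}" "b = {..y}" by auto
      then have "a \<inter> b = {..inf x y}" by auto
      then show "a \<inter> b \<in> range atMost" by blast
    qed
    show "emeasure \<mu> X = emeasure \<nu> X" if "X \<in> range atMost" for X
      using that eq by auto
    show "sets \<mu> = sigma_sets UNIV (range atMost)" "sets \<nu> = sigma_sets UNIV (range atMost)"
      by (simp_all only: assms(1,2) sets_borel)
    show "(\<Union>i::nat. {..real i *\<^sub>R One :: 'a}) = UNIV"
    proof (intro set_eqI iffI UNIV_I)
      fix x :: 'a
      obtain n :: nat where "norm x \<le> real n" using real_arch_simple by blast
      then have "x \<bullet> i \<le> real n" if "i \<in> Basis" for i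
        using that Basis_le_norm[of i x] by (auto simp: abs_le_iff)
      then have "x \<le> real n *\<^sub>R One"
        by (auto simp: eucl_le[where 'a='a])
      then show "x \<in> (\<Union>i::nat. {..real i *\<^sub>R One :: 'a})" by auto
    qed
  qed (use fin in auto)
qed

text \<open>In the variable \<open>exp (- x)\<close> the transform at the naturals is a moment sequence, and
  polynomials are dense among the continuous functions on the unit interval.\<close>

lemma laplace_transform_unique:
  fixes \<mu> \<nu> :: "real measure"
  assumes "finite_measure \<mu>" "finite_measure \<nu>"
    and [measurable_cong]: "sets \<mu> = sets borel" "sets \<nu> = sets borel"
    and nn: "AE x in \<mu>. x \<ge> 0" "AE x in \<nu>. x \<ge> 0"
    and L: "\<And>s. s > 0 \<Longrightarrow> (\<integral>\<^sup>+x. ennreal (exp (- (s * x))) \<partial>\<mu>) = (\<integral>\<^sup>+x. ennreal (exp (- (s * x))) \<partial>\<nu>)"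
  shows "\<mu> = \<nu>"
proof -
  have fin: "finite_measure \<rho>" if "\<rho> = \<mu> \<or> \<rho> = \<nu>" for \<rho> using that assms by auto
  have meas: "f \<in> borel_measurable \<rho>" if "\<rho> = \<mu> \<or> \<rho> = \<nu>" "f \<in> borel_measurable borel" for \<rho> and f :: "real \<Rightarrow> real"
    using that by (auto simp: measurable_def assms sets_eq_imp_space_eq[OF assms(3)] sets_eq_imp_space_eq[OF assms(4)])
  have nn': "AE x in \<rho>. x \<ge> 0" if "\<rho> = \<mu> \<or> \<rho> = \<nu>" for \<rho> using that nn by auto
  have int: "integrable \<rho> f" if \<rho>: "\<rho> = \<mu> \<or> \<rho> = \<nu>" and "f \<in> borel_measurable borel" "\<And>x. x \<ge> 0 \<Longrightarrow> \<bar>f x\<bar> \<le> B" for \<rho> f and B :: real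
  proof (rule finite_measure.integrable_const_bound[OF fin[OF \<rho>], where B = B])
    show "AE x in \<rho>. norm (f x) \<le> B"
      using nn'[OF \<rho>] by eventually_elim (use that(3) in auto)
    show "f \<in> borel_measurable \<rho>"
      using that(2) by (rule meas[OF \<rho>])
  qed
  have exp_pos: "(\<integral>x. exp (- (s * x)) \<partial>\<mu>) = (\<integral>x. exp (- (s * x)) \<partial>\<nu>)" if "s > 0" for s
    using L[OF that] by (simp add: integral_eq_nn_integral)
  have exp_eq: "(\<integral>x. exp (- (real n * x)) \<partial>\<mu>) = (\<integral>x. exp (- (real n * x)) \<partial>\<nu>)" for n
  proof (cases n)
    case (Suc k)
    then show ?thesis using exp_pos[of "real n"] by simp
  next
    \<comment> \<open>Equality is assumed only for \<open>s > 0\<close>; the total mass is recovered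
      as the limit along \<open>s = 1 / Suc k\<close>.\<close>
    case 0
    have lim0: "(\<lambda>k. \<integral>x. exp (- (1 / Suc k * x)) \<partial>\<rho>) \<longlonglongrightarrow> (\<integral>x. 1 \<partial>\<rho>)" if \<rho>: "\<rho> = \<mu> \<or> \<rho> = \<nu>" for \<rho>
    proof (rule integral_dominated_convergence[where w = "\<lambda>_. 1"])
      show "AE x in \<rho>. (\<lambda>k. exp (- (1 / Suc k * x))) \<longlonglongrightarrow> 1"
      proof (rule AE_I2)
        fix x :: real
        have "(\<lambda>k. exp (- (1 / Suc k * x))) \<longlonglongrightarrow> exp (- (0 * x))"
          by (intro tendsto_intros LIMSEQ_inverse_real_of_nat[unfolded inverse_eq_divide])
        then show "(\<lambda>k. exp (- (1 / Suc k * x))) \<longlonglongrightarrow> 1" by simp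
      qed
      show "AE x in \<rho>. norm (exp (- (1 / Suc k * x))) \<le> 1" for k
        using nn'[OF \<rho>] by eventually_elim auto
      show "integrable \<rho> (\<lambda>_. 1 :: real)" by (rule int[OF \<rho>, of _ 1]) auto
      show "(\<lambda>x. exp (- (1 / Suc k * x))) \<in> borel_measurable \<rho>" for k
        by (rule meas[OF \<rho>]) measurable
    qed simp
    have "(\<lambda>k. \<integral>x. exp (- (1 / Suc k * x)) \<partial>\<mu>) = (\<lambda>k. \<integral>x. exp (- (1 / Suc k * x)) \<partial>\<nu>)"
      by (intro ext exp_pos) simp
    with lim0[of \<mu>] have "(\<lambda>k. \<integral>x. exp (- (1 / Suc k * x)) \<partial>\<nu>) \<longlonglongrightarrow> (\<integral>x. 1 \<partial>\<mu>)"
      by simp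
    from LIMSEQ_unique[OF this lim0[of \<nu>]] have "(\<integral>x. (1::real) \<partial>\<mu>) = (\<integral>x. 1 \<partial>\<nu>)"
      by simp
    then show ?thesis using 0 by simp
  qed
  have poly_eq: "(\<integral>x. p (exp (- x)) \<partial>\<mu>) = (\<integral>x. p (exp (- x)) \<partial>\<nu>)" if rp: "real_polynomial_function p" for p
  proof -
    obtain a n where p: "p = (\<lambda>x. \<Sum>i\<le>n. a i * x ^ i)"
      using real_polynomial_function_imp_sum[OF rp] by blast
    have "(\<integral>x. p (exp (- x)) \<partial>\<rho>) = (\<Sum>i\<le>n. a i * (\<integral>x. exp (- (real i * x)) \<partial>\<rho>))" if \<rho>: "\<rho> = \<mu> \<or> \<rho> = \<nu>" for \<rho>
      unfolding p using int[OF \<rho>, of "\<lambda>x. exp (- (real i * x))" 1 for i]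
      by (subst Bochner_Integration.integral_sum) (auto simp: exp_of_nat_mult[symmetric])
    then show ?thesis by (simp add: exp_eq)
  qed
  have cont_eq: "(\<integral>x. f (exp (- x)) \<partial>\<mu>) = (\<integral>x. f (exp (- x)) \<partial>\<nu>)"
    if f: "continuous_on UNIV f" for f :: "real \<Rightarrow> real"
  proof -
    have f_meas: "f \<in> borel_measurable borel" using f by (rule borel_measurable_continuous_onI)
    have "compact (f ` {0..1})" by (intro compact_continuous_image continuous_on_subset[OF f]) auto
    then obtain Bf where "\<forall>y\<in>f ` {0..1}. norm y \<le> Bf"
      using compact_imp_bounded bounded_iff by metis
    then have Bf: "\<bar>f (exp (- x))\<bar> \<le> Bf" if "x \<ge> 0" for x
      using that by auto
    let ?m = "measure \<mu> (space \<mu>) + measure \<nu> (space \<nu>)"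
    have bd: "\<bar>(\<integral>x. f (exp (- x)) \<partial>\<mu>) - (\<integral>x. f (exp (- x)) \<partial>\<nu>)\<bar> \<le> e * ?m" if "e > 0" for e
    proof -
      obtain p where p: "real_polynomial_function p" "\<And>x. x \<in> {0..1} \<Longrightarrow> \<bar>f x - p x\<bar> < e"
        using Stone_Weierstrass_real_polynomial_function[of "{0..1}" f e] f \<open>e > 0\<close> continuous_on_subset by blast
      have p_meas: "p \<in> borel_measurable borel"
        using real_polynomial_function_imp_sum[OF p(1)] by auto
      have d: "\<bar>(\<integral>x. f (exp (- x)) \<partial>\<rho>) - (\<integral>x. p (exp (- x)) \<partial>\<rho>)\<bar> \<le> e * measure \<rho> (space \<rho>)" if \<rho>: "\<rho> = \<mu> \<or> \<rho> = \<nu>" for \<rho>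
      proof -
        have i1: "integrable \<rho> (\<lambda>x. f (exp (- x)))"
          using f_meas Bf by (intro int[OF \<rho>]) auto
        have i2: "integrable \<rho> (\<lambda>x. p (exp (- x)))"
        proof (rule int[OF \<rho>])
          show "\<bar>p (exp (- x))\<bar> \<le> Bf + e" if "x \<ge> 0" for x
            using Bf[OF that] p(2)[of "exp (- x)"] that by auto
        qed (use p_meas in auto)
        have "\<bar>(\<integral>x. f (exp (- x)) \<partial>\<rho>) - (\<integral>x. p (exp (- x)) \<partial>\<rho>)\<bar> = \<bar>\<integral>x. f (exp (- x)) - p (exp (- x)) \<partial>\<rho>\<bar>"
          using i1 i2 by simp
        also have "\<dots> \<le> (\<integral>x. \<bar>f (exp (- x)) - p (exp (- x))\<bar> \<partial>\<rho>)"
          by (rule integral_abs_bound)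
        also have "\<dots> \<le> (\<integral>x. e \<partial>\<rho>)"
        proof (rule integral_mono_AE)
          show "integrable \<rho> (\<lambda>x. e)" using int[OF \<rho>, of "\<lambda>_. e" "\<bar>e\<bar>"] by auto
          show "AE x in \<rho>. \<bar>f (exp (- x)) - p (exp (- x))\<bar> \<le> e"
            using nn'[OF \<rho>] by eventually_elim (use p(2) in \<open>auto intro: less_imp_le\<close>)
        qed (use i1 i2 in auto)
        finally show ?thesis by (simp add: mult.commute)
      qed
      show ?thesis
        using d[of \<mu>] d[of \<nu>] poly_eq[OF p(1)] by (simp add: algebra_simps abs_le_iff)
    qed
    have "\<bar>(\<integral>x. f (exp (- x)) \<partial>\<mu>) - (\<integral>x. f (exp (- x)) \<partial>\<nu>)\<bar> \<le> 0"
    proof (rule field_le_epsilon)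
      fix e :: real assume "e > 0"
      have "?m \<ge> 0" by simp
      \<comment> \<open>Dividing by \<open>?m + 1\<close> also covers the case of total mass
        \<open>0\<close>.\<close>
      have "e / (?m + 1) * ?m \<le> e / (?m + 1) * (?m + 1)"
        using \<open>e > 0\<close> \<open>?m \<ge> 0\<close> by (intro mult_left_mono divide_nonneg_nonneg) auto
      also have "\<dots> = e"
      proof (rule nonzero_eq_divide_eq[THEN iffD1, OF _ refl])
        show "?m + 1 \<noteq> 0" using \<open>?m \<ge> 0\<close> by linarith
      qed
      finally have "e / (?m + 1) * ?m \<le> e" .
      moreover have "e / (?m + 1) > 0"
      proof (rule divide_pos_pos[OF \<open>e > 0\<close>])
        show "?m + 1 > 0" using \<open>?m \<ge> 0\<close> by linarith
      qed
      ultimately show "\<bar>(\<integral>x. f (exp (- x)) \<partial>\<mu>) - (\<integral>x. f (exp (- x)) \<partial>\<nu>)\<bar> \<le> 0 + e"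
        using bd[of "e / (?m + 1)"] by linarith
    qed
    then show ?thesis by simp
  qed
  have ind_eq: "measure \<mu> {..a} = measure \<nu> {..a}" for a
  proof -
    \<comment> \<open>Continuous ramps in \<open>exp (- x)\<close> that tend to the indicator of
      \<open>exp (- x) \<ge> exp (- a)\<close>, that is, of \<open>x \<le> a\<close>.\<close>
    let ?f = "\<lambda>k y. min 1 (max 0 (1 + real k * (y - exp (- a))))"
    have lim: "(\<lambda>k. \<integral>x. ?f k (exp (- x)) \<partial>\<rho>) \<longlonglongrightarrow> (\<integral>x. indicator {..a} x \<partial>\<rho>)" if \<rho>: "\<rho> = \<mu> \<or> \<rho> = \<nu>" for \<rho>
    proof (rule integral_dominated_convergence[where w = "\<lambda>_. 1"])
      show "AE x in \<rho>. (\<lambda>k. ?f k (exp (- x))) \<longlonglongrightarrow> indicator {..a} x"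
      proof (rule AE_I2)
        fix x
        show "(\<lambda>k. ?f k (exp (- x))) \<longlonglongrightarrow> indicator {..a} x"
        proof (cases "x \<le> a")
          case True
          then have "?f k (exp (- x)) = 1" for k by auto
          then show ?thesis using True by simp
        next
          case False
          then have "exp (- x) - exp (- a) < 0" by simp
          then have "filterlim (\<lambda>k. 1 + real k * (exp (- x) - exp (- a))) at_bot sequentially"
            by real_asymp
          then have "\<forall>\<^sub>F k in sequentially. 1 + real k * (exp (- x) - exp (- a)) \<le> 0"
            by (simp add: filterlim_at_bot)
          then have "\<forall>\<^sub>F k in sequentially. ?f k (exp (- x)) = 0"
            by eventually_elim simp
          then show ?thesis using False by (simp add: tendsto_eventually)
        qed
      qed
      show "integrable \<rho> (\<lambda>_. 1 :: real)" by (rule int[OF \<rho>, of _ 1]) auto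
      show "(\<lambda>x. ?f k (exp (- x))) \<in> borel_measurable \<rho>" for k
        by (rule meas[OF \<rho>]) measurable
      show "(\<lambda>x. indicator {..a} x :: real) \<in> borel_measurable \<rho>"
        by (rule meas[OF \<rho>]) measurable
    qed auto
    have "(\<integral>x. ?f k (exp (- x)) \<partial>\<mu>) = (\<integral>x. ?f k (exp (- x)) \<partial>\<nu>)" for k
      by (intro cont_eq continuous_intros)
    with lim[of \<mu>] lim[of \<nu>] have "(\<integral>x. indicator {..a} x \<partial>\<mu>) = (\<integral>x. indicator {..a} x \<partial>\<nu> :: real)"
      by (auto intro: LIMSEQ_unique)
    then show ?thesis by (simp add: sets_eq_imp_space_eq[OF assms(3)] sets_eq_imp_space_eq[OF assms(4)])
  qed
  show ?thesis
    using assms(1,2) by (intro finite_measure_eqI_atMost assms)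
      (auto simp: finite_measure.emeasure_eq_measure ind_eq)
qed

section \<open>The hypergeometric integral\<close>

text \<open>Gauss series of \<open>\<^sub>2F\<^sub>1(1, b; 1 + a; z)\<close>.\<close>

definition gauss_series :: "real \<Rightarrow> real \<Rightarrow> real \<Rightarrow> real" where
  "gauss_series a b z = (\<Sum>k. pochhammer b k / pochhammer (1 + a) k * z ^ k)"

context
  fixes a b :: real
  assumes b: "0 < b" and ba: "b < 1 + a"
begin

lemma gauss_coeff_bounds: "0 \<le> pochhammer b k / pochhammer (1 + a) k" "pochhammer b k / pochhammer (1 + a) k \<le> 1"
proof -
  have *: "0 < pochhammer b k \<and> pochhammer b k \<le> pochhammer (1 + a) k" for k
  proof (induction k)
    case (Suc k)
    then show ?case
      using b ba by (auto simp: pochhammer_Suc intro!: mult_mono mult_pos_pos add_pos_nonneg)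
  qed simp
  have "0 < pochhammer (1 + a) k" using *[of k] by linarith
  then show "0 \<le> pochhammer b k / pochhammer (1 + a) k" "pochhammer b k / pochhammer (1 + a) k \<le> 1"
    using *[of k] by auto
qed

lemma gauss_series_summable: "\<bar>z\<bar> < 1 \<Longrightarrow> summable (\<lambda>k. pochhammer b k / pochhammer (1 + a) k * z ^ k)"
proof (rule summable_comparison_test')
  assume "\<bar>z\<bar> < 1"
  then show "summable (\<lambda>k. \<bar>z\<bar> ^ k)" by simp
  show "norm (pochhammer b k / pochhammer (1 + a) k * z ^ k) \<le> \<bar>z\<bar> ^ k" for k
  proof -
    have "norm (pochhammer b k / pochhammer (1 + a) k * z ^ k) = pochhammer b k / pochhammer (1 + a) k * \<bar>z\<bar> ^ k"
      by (simp only: real_norm_def abs_mult power_abs abs_of_nonneg[OF gauss_coeff_bounds(1)[of k]])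
    then show ?thesis
      using mult_right_mono[OF gauss_coeff_bounds(2)[of k], of "\<bar>z\<bar> ^ k"] by simp
  qed
qed

text \<open>Because the first hypergeometric parameter is \<open>1\<close>, the ratio of successive
  coefficients is \<open>(k + b) / (k + 1 + a)\<close>, so the recurrence has degree one in
  \<open>k\<close> and the differential equation has order one instead of two. The right-hand side
  \<open>a\<close> comes from the constant coefficient, which the shifted series misses.\<close>

lemma gauss_series_has_derivative:
  assumes "\<bar>z\<bar> < 1"
  shows "\<exists>D. (gauss_series a b has_real_derivative D) (at z) \<and>
    z * (1 - z) * D + (a - b * z) * gauss_series a b z = a"
proof -
  define f where "f k = pochhammer b k / pochhammer (1 + a) k" for k
  define D where "D = (\<Sum>k. diffs f k * z ^ k)"
  have sum: "summable (\<lambda>k. f k * x ^ k)" if "\<bar>x\<bar> < 1" for x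
    using gauss_series_summable[OF that] by (simp add: f_def)
  have "gauss_series a b = (\<lambda>z. \<Sum>k. f k * z ^ k)"
    by (simp add: gauss_series_def f_def fun_eq_iff)
  then have der: "(gauss_series a b has_real_derivative D) (at z)"
    unfolding D_def using assms by (auto intro!: termdiffs_strong'[where K = 1] sum)
  have sD: "summable (\<lambda>k. diffs f k * z ^ k)"
    using assms by (intro termdiff_converges[where K = 1]) (auto intro: sum)
  have rec: "(real (Suc k) + a) * f (Suc k) = (real k + b) * f k" for k
  proof -
    have "pochhammer (1 + a) k > 0" "1 + a + real k > 0"
      using b ba by (auto intro!: pochhammer_pos)
    then have "f (Suc k) = f k * ((b + real k) / (1 + a + real k))"
      by (simp add: f_def pochhammer_Suc add.commute)
    with \<open>1 + a + real k > 0\<close> show ?thesis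
      by (simp add: add_ac)
  qed
  have s1: "(\<lambda>k. real (Suc k) * f (Suc k) * z ^ Suc k) sums (z * D)"
    using sums_mult[OF summable_sums[OF sD], of z] unfolding D_def by (simp add: diffs_def mult_ac)
  have s1': "(\<lambda>k. real k * f k * z ^ k) sums (z * D)"
    using s1 sums_Suc_iff[of "\<lambda>k. real k * f k * z ^ k" "z * D"] by simp
  have F: "(\<lambda>k. f k * z ^ k) sums gauss_series a b z"
    using summable_sums[OF sum[OF assms]] by (simp add: gauss_series_def f_def)
  have F': "(\<lambda>k. f (Suc k) * z ^ Suc k) sums (gauss_series a b z - 1)"
    using F sums_Suc_iff[of "\<lambda>k. f k * z ^ k"] by (simp add: f_def)
  have "(\<lambda>k. real (Suc k) * f (Suc k) * z ^ Suc k + a * (f (Suc k) * z ^ Suc k)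
        - z * (real k * f k * z ^ k + b * (f k * z ^ k)))
      sums (z * D + a * (gauss_series a b z - 1) - z * (z * D + b * gauss_series a b z))"
    by (intro sums_add sums_diff sums_mult s1 s1' F F')
  also have "(\<lambda>k. real (Suc k) * f (Suc k) * z ^ Suc k + a * (f (Suc k) * z ^ Suc k)
        - z * (real k * f k * z ^ k + b * (f k * z ^ k))) = (\<lambda>k. 0)"
  proof
    fix k
    have "real (Suc k) * f (Suc k) * z ^ Suc k + a * (f (Suc k) * z ^ Suc k) - z * (real k * f k * z ^ k + b * (f k * z ^ k))
      = ((real (Suc k) + a) * f (Suc k) - (real k + b) * f k) * z ^ Suc k"
      by (simp add: algebra_simps)
    also have "\<dots> = 0" by (simp only: rec) simp
    finally show "real (Suc k) * f (Suc k) * z ^ Suc k + a * (f (Suc k) * z ^ Suc k) - z * (real k * f k * z ^ k + b * (f k * z ^ k)) = 0" .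
  qed
  finally have "z * D + a * (gauss_series a b z - 1) - z * (z * D + b * gauss_series a b z) = 0"
    using sums_unique2 sums_zero by blast
  then have "z * (1 - z) * D + (a - b * z) * gauss_series a b z = a"
    by (simp add: algebra_simps)
  with der show ?thesis by blast
qed

lemma gauss_series_bounds:
  assumes "0 \<le> z" "z < 1"
  shows "0 \<le> gauss_series a b z" "gauss_series a b z \<le> 1 / (1 - z)"
proof -
  show "0 \<le> gauss_series a b z"
    unfolding gauss_series_def using assms
    by (intro suminf_nonneg gauss_series_summable mult_nonneg_nonneg gauss_coeff_bounds) auto
  have "gauss_series a b z \<le> (\<Sum>k. z ^ k)"
    unfolding gauss_series_def using assms
    by (intro suminf_le gauss_series_summable mult_left_le_one_le gauss_coeff_bounds summable_geometric) auto
  then show "gauss_series a b z \<le> 1 / (1 - z)"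
    using assms by (simp add: suminf_geometric)
qed

text \<open>\<open>1 / (1 - t * z)\<close> is expanded as a geometric series and integrated
  termwise; all terms are nonnegative, so monotone convergence suffices, and each one is a Beta
  integral. The nonnegative integral is converted at the end to the gauge integral in which
  \<open>hyp2F1\<close> is defined.\<close>

lemma hyp2F1_eq_gauss_series:
  assumes "0 \<le> z" "z < 1"
  shows "hyp2F1 1 b (1 + a) z = gauss_series a b z"
proof -
  define c where "c = 1 + a"
  have c: "c > b" "c > 0" using b ba by (auto simp: c_def)
  define f where "f k = pochhammer b k / pochhammer c k" for k
  define G where "G = Gamma b * Gamma (c - b) / Gamma c"
  have Gpos: "G > 0"
    unfolding G_def using b c by (intro divide_pos_pos mult_pos_pos Gamma_real_pos) auto
  have beta: "Beta (b + real k) (c - b) = G * f k" for k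
  proof -
    have "b \<notin> \<int>\<^sub>\<le>\<^sub>0" "c \<notin> \<int>\<^sub>\<le>\<^sub>0" using b c by (auto elim!: nonpos_Ints_cases)
    moreover have "Gamma b > 0" "Gamma c > 0" "Gamma (c + real k) > 0" using b c by (auto intro!: Gamma_real_pos)
    ultimately show ?thesis
      by (simp add: f_def Beta_def pochhammer_Gamma G_def field_simps)
  qed
  let ?h = "\<lambda>t::real. t powr (b - 1) * (1 - t) powr (c - b - 1) / (1 - t * z) powr 1"
  let ?h' = "\<lambda>t::real. indicator {0..1} t * ?h t"
  have nn: "(\<integral>\<^sup>+t. ennreal (?h' t) \<partial>lborel) = ennreal (G * gauss_series a b z)"
  proof -
    have "(\<integral>\<^sup>+t. ennreal (?h' t) \<partial>lborel)
       = (\<integral>\<^sup>+t. (\<Sum>k. ennreal (z ^ k) * (ennreal (t powr (b + real k - 1) * (1 - t) powr (c - b - 1)) * indicator {0..1} t)) \<partial>lborel)"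
    proof (rule nn_integral_cong_AE, rule AE_mp[OF AE_lborel_singleton[of 0]], rule AE_I2, rule impI)
      fix t :: real assume "t \<noteq> 0"
      show "ennreal (?h' t) = (\<Sum>k. ennreal (z ^ k) * (ennreal (t powr (b + real k - 1) * (1 - t) powr (c - b - 1)) * indicator {0..1} t))"
      proof (cases "t \<in> {0..1}")
        case True
        then have t: "0 < t" "t \<le> 1" using \<open>t \<noteq> 0\<close> by auto
        have tz: "0 \<le> t * z" "t * z < 1"
          using t assms mult_left_le_one_le[of z t] by auto
        have "(\<lambda>k. t powr (b - 1) * (1 - t) powr (c - b - 1) * (t * z) ^ k) sums
            (t powr (b - 1) * (1 - t) powr (c - b - 1) * (1 / (1 - t * z)))"
          using tz by (intro sums_mult geometric_sums) auto
        also have "(\<lambda>k. t powr (b - 1) * (1 - t) powr (c - b - 1) * (t * z) ^ k)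
            = (\<lambda>k. z ^ k * (t powr (b + real k - 1) * (1 - t) powr (c - b - 1)))"
          using t by (auto simp: fun_eq_iff power_mult_distrib powr_add powr_diff powr_realpow)
        finally have "(\<Sum>k. ennreal (z ^ k * (t powr (b + real k - 1) * (1 - t) powr (c - b - 1)))) = ennreal (?h t)"
          using tz assms by (intro suminf_ennreal_eq) auto
        then show ?thesis using True assms by (simp add: ennreal_mult')
      qed simp
    qed
    also have "\<dots> = (\<Sum>k. \<integral>\<^sup>+t. ennreal (z ^ k) * (ennreal (t powr (b + real k - 1) * (1 - t) powr (c - b - 1)) * indicator {0..1} t) \<partial>lborel)"
      by (rule nn_integral_suminf) measurable
    also have "\<dots> = (\<Sum>k. ennreal (z ^ k) * ennreal (Beta (b + real k) (c - b)))"
    proof (intro suminf_cong)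
      fix k
      have "(\<integral>\<^sup>+t. ennreal (t powr (b + real k - 1) * (1 - t) powr (c - b - 1)) * indicator {0..1} t \<partial>lborel) = ennreal (Beta (b + real k) (c - b))"
        using b c by (intro nn_integral_has_integral_lebesgue' has_integral_Beta_real) auto
      then show "(\<integral>\<^sup>+t. ennreal (z ^ k) * (ennreal (t powr (b + real k - 1) * (1 - t) powr (c - b - 1)) * indicator {0..1} t) \<partial>lborel)
        = ennreal (z ^ k) * ennreal (Beta (b + real k) (c - b))"
        by (subst nn_integral_cmult) auto
    qed
    also have "\<dots> = (\<Sum>k. ennreal (G * (f k * z ^ k)))"
      using assms by (intro suminf_cong) (simp add: beta mult_ac flip: ennreal_mult')
    also have "\<dots> = ennreal (G * gauss_series a b z)"
    proof (rule suminf_ennreal_eq)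
      show "(\<lambda>k. G * (f k * z ^ k)) sums (G * gauss_series a b z)"
        unfolding gauss_series_def f_def c_def using assms by (intro sums_mult summable_sums gauss_series_summable) auto
      show "0 \<le> G * (f k * z ^ k)" for k
        using Gpos gauss_coeff_bounds(1)[of k] assms unfolding f_def c_def
        by (intro mult_nonneg_nonneg) auto
    qed
    finally show ?thesis .
  qed
  have "(?h' has_integral (G * gauss_series a b z)) UNIV"
  proof (rule nn_integral_has_integral[OF _ _ nn])
    show "?h' \<in> borel_measurable borel" by measurable
    show "0 \<le> G * gauss_series a b z" using Gpos gauss_series_bounds assms by auto
  qed auto
  also have "?h' = (\<lambda>t. if t \<in> {0..1} then ?h t else 0)"
    by (auto simp: fun_eq_iff split: split_indicator)
  finally have "(?h has_integral (G * gauss_series a b z)) {0..1}"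
    by (simp only: has_integral_restrict_UNIV)
  then have "integral {0..1} ?h = G * gauss_series a b z"
    by (rule integral_unique)
  moreover have "Gamma c / (Gamma b * Gamma (c - b)) * G = 1"
  proof -
    have "Gamma b > 0" "Gamma (c - b) > 0" "Gamma c > 0" using b c by (auto intro!: Gamma_real_pos)
    then show ?thesis by (simp add: G_def)
  qed
  ultimately have "hyp2F1 1 b c z = 1 * gauss_series a b z"
    unfolding hyp2F1_def by (metis mult.assoc)
  then show ?thesis by (simp add: c_def)
qed

end

text \<open>The substitution \<open>z = 1 / (1 + w powr (-1/\<delta>))\<close> turns the integral into an incomplete beta
  function; the antiderivative is its hypergeometric form, as the differential equation of the
  Gauss series shows.\<close>

lemma nn_integral_interference_hyp2F1:
  fixes \<delta> \<beta> :: real and m :: nat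
  assumes "\<delta> > 0" "\<beta> > 0" "m > 0"
  shows "(\<integral>\<^sup>+w\<in>{0<..\<beta> powr (-\<delta>)}. ennreal ((1 + w powr (-1/\<delta>)) powr (- (real m * \<delta>))) \<partial>lborel)
    = ennreal (\<beta> powr (-\<delta>) * hyp2F1 1 (real m * \<delta>) (1 + real (m + 1) * \<delta>) (1 / (1 + \<beta>)) /
        (1 + \<beta>) powr (real m * \<delta>) / real (m + 1))"
proof -
  define a b where "a = real (m + 1) * \<delta>" and "b = real m * \<delta>"
  have b: "0 < b" "b < 1 + a" and ab: "a = b + \<delta>" using assms by (auto simp: a_def b_def algebra_simps)
  define z where "z w = 1 / (1 + w powr (-1/\<delta>))" for w :: real
  \<comment> \<open>With \<open>a = (m + 1) * \<delta>\<close> and \<open>b = m * \<delta>\<close>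
    the candidate antiderivative is \<open>w\<close> times a power of \<open>z\<close> times the
    Gauss series; \<open>1 / (m + 1)\<close> is the normalisation that the differential equation
    dictates.\<close>
  define W where "W w = w * z w powr b * gauss_series a b (z w) / real (m + 1)" for w
  define w1 where "w1 = \<beta> powr (-\<delta>)"
  have w1: "w1 > 0" "w1 powr (-1/\<delta>) = \<beta>" using assms by (auto simp: w1_def powr_powr)
  have z01: "0 < z w" "z w < 1" if "w > 0" for w
    using that by (auto simp: z_def add_pos_pos)
  have zmono: "z w \<le> z w1" if "0 < w" "w \<le> w1" for w
  proof -
    have "w1 powr (-1/\<delta>) \<le> w powr (-1/\<delta>)"
      using that assms by (intro powr_mono2') auto
    then show ?thesis using w1 by (auto simp: z_def intro!: divide_left_mono mult_pos_pos add_pos_nonneg)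
  qed
  have derW: "(W has_real_derivative z w powr b) (at w)" if "w > 0" for w
  proof -
    obtain D where D: "(gauss_series a b has_real_derivative D) (at (z w))"
      "z w * (1 - z w) * D + (a - b * z w) * gauss_series a b (z w) = a"
      using gauss_series_has_derivative[OF b, of "z w"] z01[OF \<open>w > 0\<close>] by (auto simp: abs_of_pos)
    have u: "z w * w powr (-1/\<delta>) = 1 - z w"
    proof -
      have "1 - 1 / (1 + p) = 1 / (1 + p) * p" if "p \<ge> 0" for p :: real
        using that by (simp add: field_simps)
      from this[of "w powr (-1/\<delta>)"] show ?thesis by (simp add: z_def)
    qed
    have "1 + w powr (-1/\<delta>) > 0" by (simp add: add_pos_nonneg)
    then have "(z has_real_derivative - ((-1/\<delta>) * w powr (-1/\<delta> - 1)) / (1 + w powr (-1/\<delta>))\<^sup>2) (at w)"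
      unfolding z_def[abs_def] using that
      by (auto intro!: derivative_eq_intros simp: power2_eq_square)
    also have "- ((-1/\<delta>) * w powr (-1/\<delta> - 1)) / (1 + w powr (-1/\<delta>))\<^sup>2 = z w * (z w * w powr (-1/\<delta>)) / (\<delta> * w)"
      using that by (simp add: z_def powr_diff power2_eq_square)
    \<comment> \<open>By \<open>u\<close> the power of \<open>w\<close> is eliminated, and the
      derivative of \<open>z\<close> is rational in \<open>z\<close> and \<open>w\<close>; this
      brings in the factor \<open>z * (1 - z)\<close> of the differential equation.\<close>
    finally have dz: "(z has_real_derivative z w * (1 - z w) / (\<delta> * w)) (at w)"
      by (simp only: u)
    have dF: "((\<lambda>w. gauss_series a b (z w)) has_real_derivative D * (z w * (1 - z w) / (\<delta> * w))) (at w)"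
      using DERIV_chain2[OF D(1) dz] .
    have dp: "((\<lambda>w. z w powr b) has_real_derivative b * z w powr (b - 1) * (z w * (1 - z w) / (\<delta> * w))) (at w)"
      using DERIV_chain2[OF has_real_derivative_powr[of "z w" b] dz] z01[OF \<open>w > 0\<close>] by simp
    have zb: "z w powr (b - 1) = z w powr b / z w"
      using z01[OF \<open>w > 0\<close>] by (simp add: powr_diff)
    have "(W has_real_derivative ((1 * z w powr b + b * z w powr (b - 1) * (z w * (1 - z w) / (\<delta> * w)) * w) * gauss_series a b (z w)
        + D * (z w * (1 - z w) / (\<delta> * w)) * (w * z w powr b)) / real (m + 1)) (at w)"
      unfolding W_def[abs_def] by (intro DERIV_cdivide DERIV_mult DERIV_ident dp dF)
    also have "((1 * z w powr b + b * z w powr (b - 1) * (z w * (1 - z w) / (\<delta> * w)) * w) * gauss_series a b (z w)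
        + D * (z w * (1 - z w) / (\<delta> * w)) * (w * z w powr b)) / real (m + 1)
      = z w powr b * (((\<delta> + b) - b * z w) * gauss_series a b (z w) + z w * (1 - z w) * D) / (\<delta> * real (m + 1))"
      using that z01[OF \<open>w > 0\<close>] assms by (simp add: zb divide_simps) (simp add: algebra_simps)
    \<comment> \<open>Since \<open>\<delta> + b = a\<close>, this is the left-hand side of the
      differential equation; its value \<open>a = (m + 1) * \<delta>\<close> cancels the
      denominator.\<close>
    also have "((\<delta> + b) - b * z w) * gauss_series a b (z w) + z w * (1 - z w) * D = a"
      using D(2) by (simp add: ab algebra_simps)
    also have "z w powr b * a / (\<delta> * real (m + 1)) = z w powr b"
      using assms by (simp add: a_def)
    finally show ?thesis .
  qed
  \<comment> \<open>\<open>0 powr p\<close> is \<open>0\<close> in HOL, so \<open>z 0 = 1\<close>,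
    although \<open>z w\<close> tends to \<open>0\<close> as \<open>w\<close> decreases to
    \<open>0\<close>. Continuity of \<open>W\<close> at \<open>0\<close> is therefore not visible
    from the formula and is obtained by squeezing with this linear bound; \<open>W 0 = 0\<close> by
    its factor \<open>w\<close>.\<close>
  have bound: "norm (W w) \<le> w * (1 / (1 - z w1))" if "0 < w" "w \<le> w1" for w
  proof -
    have zz: "0 < z w" "z w < 1" "z w \<le> z w1" "z w1 < 1" using z01[of w] z01[of w1] zmono that w1 by auto
    have "gauss_series a b (z w) \<le> 1 / (1 - z w)" "0 \<le> gauss_series a b (z w)"
      using gauss_series_bounds[OF b, of "z w"] zz by auto
    moreover have "1 / (1 - z w) \<le> 1 / (1 - z w1)"
      using zz by (intro divide_left_mono) auto
    ultimately have g: "0 \<le> gauss_series a b (z w)" "gauss_series a b (z w) \<le> 1 / (1 - z w1)" by auto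
    have p: "z w powr b \<le> 1" using powr_mono2[of b "z w" 1] zz b by auto
    have "z w powr b * gauss_series a b (z w) \<le> 1 * (1 / (1 - z w1))"
      using g p zz by (intro mult_mono) auto
    then have "w * (z w powr b * gauss_series a b (z w)) \<le> w * (1 / (1 - z w1))"
      using that by (intro mult_left_mono) auto
    moreover have "norm (W w) \<le> w * (z w powr b * gauss_series a b (z w))"
    proof -
      define Y where "Y = w * (z w powr b * gauss_series a b (z w))"
      have "Y \<ge> 0" unfolding Y_def using g that by (intro mult_nonneg_nonneg) auto
      moreover have "W w = Y / real (m + 1)" by (simp add: W_def Y_def mult.assoc)
      moreover have "Y / real (m + 1) \<le> Y / 1"
        using \<open>Y \<ge> 0\<close> by (intro divide_left_mono) auto
      ultimately show ?thesis by (simp add: Y_def[symmetric] del: of_nat_add)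
    qed
    ultimately show ?thesis by linarith
  qed
  have "((\<lambda>w. z w powr b) has_integral (W w1 - W 0)) {0..w1}"
  proof (rule fundamental_theorem_of_calculus_interior)
    show "continuous_on {0..w1} W"
    proof (rule continuous_on_eq_continuous_within[THEN iffD2], rule ballI)
      fix w assume w: "w \<in> {0..w1}"
      show "continuous (at w within {0..w1}) W"
      proof (cases "w = 0")
        case False
        then have "isCont W w" using w by (intro DERIV_isCont[OF derW]) auto
        then show ?thesis by (rule continuous_at_imp_continuous_at_within)
      next
        case True
        have "(W \<longlongrightarrow> 0) (at 0 within {0..w1})"
        proof (rule Lim_null_comparison)
          show "\<forall>\<^sub>F w in at 0 within {0..w1}. norm (W w) \<le> w * (1 / (1 - z w1))"
            using bound by (auto simp: eventually_at_filter intro!: always_eventually)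
          show "((\<lambda>w. w * (1 / (1 - z w1))) \<longlongrightarrow> 0) (at 0 within {0..w1})"
            by (rule tendsto_mult_left_zero[OF tendsto_ident_at])
        qed
        then show ?thesis using True by (simp add: continuous_within W_def)
      qed
    qed
    show "(W has_vector_derivative z w powr b) (at w)" if "w \<in> {0<..<w1}" for w
      using derW[of w] that by (simp add: has_real_derivative_iff_has_vector_derivative)
  qed (use w1 in auto)
  then have "(\<integral>\<^sup>+w. ennreal (z w powr b) * indicator {0..w1} w \<partial>lborel) = ennreal (W w1)"
    by (subst nn_integral_has_integral_lebesgue') (auto simp: W_def)
  also have "(\<integral>\<^sup>+w. ennreal (z w powr b) * indicator {0..w1} w \<partial>lborel)
      = (\<integral>\<^sup>+w\<in>{0<..w1}. ennreal ((1 + w powr (-1/\<delta>)) powr (- b)) \<partial>lborel)"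
  proof (rule nn_integral_cong_AE, rule AE_mp[OF AE_lborel_singleton[of 0]], rule AE_I2, rule impI)
    fix w :: real assume "w \<noteq> 0"
    have "z w powr b = (1 + w powr (-1/\<delta>)) powr (- b)"
    proof -
      have "1 + w powr (-1/\<delta>) \<ge> 0" by (intro add_nonneg_nonneg) auto
      then show ?thesis
        by (simp only: z_def powr_divide zero_le_one powr_one_eq_one powr_minus_divide)
    qed
    then show "ennreal (z w powr b) * indicator {0..w1} w = ennreal ((1 + w powr (-1/\<delta>)) powr (- b)) * indicator {0<..w1} w"
      using \<open>w \<noteq> 0\<close> by (auto split: split_indicator)
  qed
  also have "W w1 = w1 * hyp2F1 1 b (1 + a) (1 / (1 + \<beta>)) / (1 + \<beta>) powr b / real (m + 1)"
    using assms w1 by (simp add: W_def z_def hyp2F1_eq_gauss_series[OF b] powr_divide)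
  finally show ?thesis
    unfolding w1_def a_def b_def .
qed

section \<open>Laplace functional of a Poisson process\<close>

lemma space_point_configs: "space point_configs = {S :: 'a::euclidean_space set. locally_finite_set S}"
  unfolding point_configs_def by (rule space_measure_of) auto

lemma measurable_card_points [measurable]:
  fixes A :: "'a::euclidean_space set"
  assumes "A \<in> sets borel" "bounded A"
  shows "(\<lambda>S. card (S \<inter> A)) \<in> measurable point_configs (count_space UNIV)"
proof (rule measurable_count_space_eq2_countable[THEN iffD2])
  show "(\<lambda>S. card (S \<inter> A)) \<in> space point_configs \<rightarrow> UNIV \<and>
    (\<forall>n\<in>UNIV. (\<lambda>S. card (S \<inter> A)) -` {n} \<inter> space point_configs \<in> sets point_configs)"
  proof (intro conjI ballI)
    fix n
    have "(\<lambda>S. card (S \<inter> A)) -` {n} \<inter> space point_configs = {S. locally_finite_set S \<and> card (S \<inter> A) = n}"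
      by (auto simp: space_point_configs)
    also have "\<dots> \<in> sets point_configs"
      unfolding point_configs_def using assms by (intro in_measure_of) auto
    finally show "(\<lambda>S. card (S \<inter> A)) -` {n} \<inter> space point_configs \<in> sets point_configs" .
  qed auto
qed

lemma locally_finite_finite_Int: "locally_finite_set S \<Longrightarrow> bounded A \<Longrightarrow> finite (S \<inter> A)"
  by (simp add: locally_finite_set_def)

text \<open>A locally finite set is closed, so \<open>x\<close> belongs to it as soon as it has
  points arbitrarily close to \<open>x\<close>. For countable dense \<open>D\<close> the right-hand
  side involves countably many counts, and counts are what the \<sigma>-algebra of
  \<open>point_configs\<close> makes measurable.\<close>

lemma mem_locally_finite_iff:
  fixes x :: "'a::euclidean_space"
  assumes "locally_finite_set S"
    and D: "\<And>X :: 'a set. open X \<Longrightarrow> X \<noteq> {} \<Longrightarrow> \<exists>d\<in>D. d \<in> X"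
  shows "x \<in> S \<longleftrightarrow> (\<forall>k::nat. \<exists>q\<in>D. x \<in> ball q (1 / Suc k) \<and> card (S \<inter> ball q (1 / Suc k)) \<noteq> 0)"
proof
  assume "x \<in> S"
  show "\<forall>k::nat. \<exists>q\<in>D. x \<in> ball q (1 / Suc k) \<and> card (S \<inter> ball q (1 / Suc k)) \<noteq> 0"
  proof
    fix k :: nat
    obtain q where q: "q \<in> D" "q \<in> ball x (1 / Suc k)"
      using D[of "ball x (1 / Suc k)"] by auto
    then have "x \<in> S \<inter> ball q (1 / Suc k)"
      using \<open>x \<in> S\<close> by (simp add: dist_commute)
    \<comment> \<open>\<open>card\<close> of an infinite set is \<open>0\<close>, so local
      finiteness is what makes the count nonzero.\<close>
    moreover have "finite (S \<inter> ball q (1 / Suc k))"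
      using assms(1) by (simp add: locally_finite_finite_Int)
    ultimately show "\<exists>q\<in>D. x \<in> ball q (1 / Suc k) \<and> card (S \<inter> ball q (1 / Suc k)) \<noteq> 0"
      using q(1) by (intro bexI[of _ q]) auto
  qed
next
  assume *: "\<forall>k::nat. \<exists>q\<in>D. x \<in> ball q (1 / Suc k) \<and> card (S \<inter> ball q (1 / Suc k)) \<noteq> 0"
  have fin: "finite (S \<inter> ball x 2)"
    using assms(1) by (simp add: locally_finite_finite_Int)
  have near: "\<exists>s\<in>S \<inter> ball x 2. dist x s < 2 / Suc k" for k
  proof -
    obtain q s where "x \<in> ball q (1 / Suc k)" "s \<in> S" "s \<in> ball q (1 / Suc k)"
      using *[rule_format, of k] by (metis Int_iff card.empty ex_in_conv)
    moreover have "dist x s \<le> dist q x + dist q s"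
      using dist_triangle[of x s q] by (simp add: dist_commute)
    ultimately have "dist x s < 1 / Suc k + 1 / Suc k" by (simp add: dist_commute)
    then have "dist x s < 2 / Suc k" by simp
    moreover have "2 / Suc k \<le> (2::real)" by (simp add: divide_le_eq)
    ultimately show ?thesis using \<open>s \<in> S\<close> by (intro bexI[of _ s]) auto
  qed
  show "x \<in> S"
  proof (rule ccontr)
    assume "x \<notin> S"
    then have pos: "\<forall>s\<in>S \<inter> ball x 2. 0 < dist x s" by (metis Int_iff zero_less_dist_iff)
    \<comment> \<open>The inserted \<open>1\<close> keeps the minimum meaningful without knowing
      that the set of distances is nonempty.\<close>
    define e where "e = Min (insert 1 (dist x ` (S \<inter> ball x 2)))"
    have e: "e > 0" "\<forall>s\<in>S \<inter> ball x 2. e \<le> dist x s"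
      using fin pos by (auto simp: e_def)
    obtain k where "2 / e < real (Suc k)"
      using reals_Archimedean2 by (metis less_SucI less_trans of_nat_less_iff lessI)
    then have "2 / Suc k < e" using e(1) by (simp add: field_simps)
    moreover obtain s where "s \<in> S \<inter> ball x 2" "dist x s < 2 / Suc k" using near[of k] by blast
    ultimately show False using e(2) by force
  qed
qed

lemma measurable_mem_points [measurable (raw)]:
  fixes X :: "'w \<Rightarrow> 'a::euclidean_space"
  assumes [measurable]: "X \<in> borel_measurable M" and [measurable]: "\<Phi> \<in> measurable M point_configs"
  shows "Measurable.pred M (\<lambda>\<omega>. X \<omega> \<in> \<Phi> \<omega>)"
proof -
  obtain D :: "'a set" where D: "countable D" "\<And>X. open X \<Longrightarrow> X \<noteq> {} \<Longrightarrow> \<exists>d\<in>D. d \<in> X"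
    using countable_dense_setE by blast
  have [measurable]: "Measurable.pred M (\<lambda>\<omega>. card (\<Phi> \<omega> \<inter> ball q r) \<noteq> 0)" for q r
  proof -
    have "(\<lambda>S. card (S \<inter> ball q r)) \<in> measurable point_configs (count_space UNIV)"
      by (rule measurable_card_points[OF borel_open[OF open_ball] bounded_ball])
    from measurable_compose[OF assms(2) this] show ?thesis by measurable
  qed
  define e where "e = from_nat_into D"
  have "D \<noteq> {}" using D(2)[of UNIV] by auto
  then have De: "D = range e" using D(1) by (simp add: e_def range_from_nat_into)
  have "Measurable.pred M (\<lambda>\<omega>. \<forall>k::nat. \<exists>n::nat. X \<omega> \<in> ball (e n) (1 / Suc k) \<and> card (\<Phi> \<omega> \<inter> ball (e n) (1 / Suc k)) \<noteq> 0)"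
    unfolding mem_ball by measurable
  then have "Measurable.pred M (\<lambda>\<omega>. \<forall>k::nat. \<exists>q\<in>D. X \<omega> \<in> ball q (1 / Suc k) \<and> card (\<Phi> \<omega> \<inter> ball q (1 / Suc k)) \<noteq> 0)"
    by (simp add: De)
  moreover have "X \<omega> \<in> \<Phi> \<omega> \<longleftrightarrow> (\<forall>k::nat. \<exists>q\<in>D. X \<omega> \<in> ball q (1 / Suc k) \<and> card (\<Phi> \<omega> \<inter> ball q (1 / Suc k)) \<noteq> 0)"
    if "\<omega> \<in> space M" for \<omega>
    using measurable_space[OF assms(2) that] D(2) by (intro mem_locally_finite_iff) (auto simp: space_point_configs)
  ultimately show ?thesis
    by (simp cong: measurable_cong)
qed

text \<open>Integration against counting measure rather than an infinite sum, so that monotone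
  convergence and finite additivity are those of \<open>nn_integral\<close>.\<close>

definition points_sum :: "('a \<Rightarrow> ennreal) \<Rightarrow> 'a set \<Rightarrow> ennreal" where
  "points_sum f S = (\<integral>\<^sup>+x. f x \<partial>count_space S)"

lemma points_sum_indicator:
  assumes "locally_finite_set S" "bounded A"
  shows "points_sum (\<lambda>x. c * indicator A x) S = c * of_nat (card (S \<inter> A))"
proof -
  have "(\<integral>\<^sup>+x. c * indicator A x \<partial>count_space S) = (\<integral>\<^sup>+x. c * indicator (A \<inter> S) x \<partial>count_space S)"
    by (intro nn_integral_cong) (auto split: split_indicator)
  then show ?thesis
    using locally_finite_finite_Int[OF assms]
    by (simp add: points_sum_def nn_integral_cmult_indicator emeasure_count_space Int_commute)
qed

lemma points_sum_sum:
  "points_sum (\<lambda>x. \<Sum>i\<in>I. f i x) S = (\<Sum>i\<in>I. points_sum (f i) S)"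
  unfolding points_sum_def by (rule nn_integral_sum) simp

lemma points_sum_SUP:
  assumes "incseq f"
  shows "points_sum (\<lambda>x. SUP k. f k x) S = (SUP k. points_sum (f k) S)"
  unfolding points_sum_def by (rule nn_integral_monotone_convergence_SUP[OF assms]) simp

lemma incseq_points_sum: "incseq f \<Longrightarrow> incseq (\<lambda>k. points_sum (f k) S)"
  unfolding points_sum_def by (auto simp: incseq_def le_fun_def intro!: nn_integral_mono)

text \<open>A Poisson process is specified by its counts in bounded sets and by independence over
  disjoint ones. The approximating simple functions are therefore cut off outside growing balls and
  written over disjoint level sets.\<close>

lemma simple_approximation:
  fixes f :: "'a::euclidean_space \<Rightarrow> ennreal"
  assumes [measurable]: "f \<in> borel_measurable borel"
  obtains g where "incseq g" "\<And>x. (SUP k. g k x) = f x"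
    "\<And>k. \<exists>(c :: nat \<Rightarrow> ennreal) A n. disjoint_family A \<and> (\<forall>j. A j \<in> sets borel \<and> bounded (A j)) \<and>
       (\<forall>m<n. c m < \<top>) \<and> g k = (\<lambda>x. \<Sum>m<n. c m * indicator (A m) x)"
proof -
  obtain s where s: "incseq s" "\<And>i x. s i x < \<top>" "\<And>i. simple_function borel (s i)" "f = (\<lambda>x. SUP i. s i x)"
    using borel_measurable_implies_simple_function_sequence'[OF assms]
    by (metis (no_types, lifting) ext SUP_apply image_cong)
  define g where "g k x = s k x * indicator (ball 0 (real k)) x" for k x
  show ?thesis
  proof (rule that[of g])
    show "incseq g"
      using s(1) unfolding incseq_def le_fun_def g_def
      by (auto intro!: mult_mono split: split_indicator)
    show "(SUP k. g k x) = f x" for x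
    proof (rule antisym)
      show "(SUP k. g k x) \<le> f x"
        unfolding s(4) g_def by (intro SUP_mono) (auto split: split_indicator)
      obtain k0 :: nat where k0: "norm x < real k0" using reals_Archimedean2 by blast
      have "s k x \<le> g (max k k0) x" for k
        using s(1) k0 by (auto simp: g_def incseq_def le_fun_def split: split_indicator)
      then show "f x \<le> (SUP k. g k x)"
        unfolding s(4) by (intro SUP_mono) auto
    qed
    fix k
    let ?V = "range (s k)"
    have fin: "finite ?V" using s(3)[of k] by (simp add: simple_function_def)
    obtain e where e: "bij_betw e {..<card ?V} ?V"
      using ex_bij_betw_nat_finite[OF fin] by (auto simp: atLeast0LessThan)
    \<comment> \<open>Padding with empty sets yields an infinite disjoint sequence, the form in
      which \<open>homogeneous_ppp\<close> states independence.\<close>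
    define A where "A m = (if m < card ?V then s k -` {e m} \<inter> ball 0 (real k) else {})" for m
    have "disjoint_family A"
      using e by (auto simp: disjoint_family_on_def A_def bij_betw_def inj_on_def)
    moreover have "A j \<in> sets borel \<and> bounded (A j)" for j
    proof -
      have "s k \<in> borel_measurable borel" using s(3) by (rule borel_measurable_simple_function)
      then have "s k -` {e j} \<inter> space borel \<in> sets borel" by (rule measurable_sets) simp
      then show ?thesis by (auto simp: A_def intro: bounded_subset[OF bounded_ball])
    qed
    moreover have "\<forall>m<card ?V. e m < \<top>"
      using e s(2) by (auto simp: bij_betw_def) (metis image_eqI lessThan_iff rangeE)
    moreover have "g k = (\<lambda>x. \<Sum>m<card ?V. e m * indicator (A m) x)"
    proof
      fix x
      have "s k x \<in> e ` {..<card ?V}"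
        using bij_betw_imp_surj_on[OF e] by auto
      then obtain m where m: "m < card ?V" "e m = s k x" by fastforce
      have "(\<Sum>m'<card ?V. e m' * indicator (A m') x) = (\<Sum>m'<card ?V. if m' = m then e m * indicator (ball 0 (real k)) x else 0)"
      proof (intro sum.cong refl)
        fix m' assume m': "m' \<in> {..<card ?V}"
        then have "e m' = e m \<longleftrightarrow> m' = m"
          using e m by (auto simp: bij_betw_def inj_on_def)
        then show "e m' * indicator (A m') x = (if m' = m then e m * indicator (ball 0 (real k)) x else 0)"
        proof -
          have "x \<in> A m' \<longleftrightarrow> s k x = e m' \<and> x \<in> ball 0 (real k)"
            using m' by (simp add: A_def)
          also have "s k x = e m' \<longleftrightarrow> m' = m"
            using \<open>e m' = e m \<longleftrightarrow> m' = m\<close> m(2) by metis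
          finally show ?thesis by (simp add: indicator_def)
        qed
      qed
      also have "\<dots> = g k x" using m by (simp add: g_def)
      finally show "g k x = (\<Sum>m<card ?V. e m * indicator (A m) x)" by simp
    qed
    ultimately show "\<exists>(c :: nat \<Rightarrow> ennreal) A n. disjoint_family A \<and> (\<forall>j. A j \<in> sets borel \<and> bounded (A j)) \<and>
       (\<forall>m<n. c m < \<top>) \<and> g k = (\<lambda>x. \<Sum>m<n. c m * indicator (A m) x)"
      by blast
  qed
qed

lemma measurable_points_sum [measurable]:
  fixes f :: "'a::euclidean_space \<Rightarrow> ennreal"
  assumes "f \<in> borel_measurable borel"
  shows "points_sum f \<in> borel_measurable point_configs"
proof -
  obtain g where g: "incseq g" "\<And>x. (SUP k. g k x) = f x"
    "\<And>k. \<exists>(c :: nat \<Rightarrow> ennreal) A n. disjoint_family A \<and> (\<forall>j. A j \<in> sets borel \<and> bounded (A j)) \<and>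
       (\<forall>m<n. c m < \<top>) \<and> g k = (\<lambda>x. \<Sum>m<n. c m * indicator (A m) x)"
    using simple_approximation[OF assms] by blast
  have "points_sum (g k) \<in> borel_measurable point_configs" for k
  proof -
    obtain c A and n :: nat where A: "\<And>j. A j \<in> sets borel" "\<And>j. bounded (A j)"
      and gk: "g k = (\<lambda>x. \<Sum>m<n. c m * indicator (A m) x)"
      using g(3)[of k] by blast
    have "(\<lambda>S. \<Sum>m<n. c m * of_nat (card (S \<inter> A m))) \<in> borel_measurable point_configs"
    proof (rule borel_measurable_sum)
      fix m
      have "(\<lambda>S. of_nat (card (S \<inter> A m)) :: ennreal) \<in> borel_measurable point_configs"
        by (rule measurable_compose[OF measurable_card_points[OF A]]) simp
      then show "(\<lambda>S. c m * of_nat (card (S \<inter> A m))) \<in> borel_measurable point_configs"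
        by measurable
    qed
    then show ?thesis
    proof (rule measurable_cong[THEN iffD1, rotated])
      fix S :: "'a set" assume "S \<in> space point_configs"
      then have "locally_finite_set S" by (simp add: space_point_configs)
      then show "(\<Sum>m<n. c m * of_nat (card (S \<inter> A m))) = points_sum (g k) S"
        by (simp only: gk points_sum_sum points_sum_indicator A)
    qed
  qed
  then have "(\<lambda>S. SUP k. points_sum (g k) S) \<in> borel_measurable point_configs"
    by (intro borel_measurable_SUP) auto
  moreover have "(\<lambda>S. SUP k. points_sum (g k) S) = points_sum f"
    using points_sum_SUP[OF g(1)] by (simp add: g(2) fun_eq_iff)
  ultimately show ?thesis by simp
qed

context prob_space
begin

text \<open>The probability generating function of a Poisson variable, evaluated at
  \<open>exp (- v)\<close>.\<close>

lemma ppp_count_laplace: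
  fixes \<Phi> :: "'a \<Rightarrow> 'b::euclidean_space set"
  assumes ppp: "homogeneous_ppp M d \<Phi>" and "d \<ge> 0"
    and A: "A \<in> sets borel" "bounded A" and c: "c < \<top>"
  shows "(\<integral>\<^sup>+\<omega>. eneg (c * of_nat (card (\<Phi> \<omega> \<inter> A))) \<partial>M) = eneg (ennreal d * ((1 - eneg c) * emeasure lborel A))"
proof -
  obtain v where v: "v \<ge> 0" "c = ennreal v" using c by (cases c) auto
  define r where "r = d * measure lborel A"
  have r: "r \<ge> 0" using \<open>d \<ge> 0\<close> by (simp add: r_def)
  have [measurable]: "(\<lambda>\<omega>. card (\<Phi> \<omega> \<inter> A)) \<in> measurable M (count_space UNIV)"
    using ppp A by (intro measurable_compose[OF _ measurable_card_points]) (auto simp: homogeneous_ppp_def)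
  have P: "emeasure M {\<omega>\<in>space M. card (\<Phi> \<omega> \<inter> A) = n} = ennreal (r ^ n / fact n * exp (- r))" for n
    using ppp A by (simp add: emeasure_eq_measure homogeneous_ppp_def r_def)
  have "(\<integral>\<^sup>+\<omega>. eneg (c * of_nat (card (\<Phi> \<omega> \<inter> A))) \<partial>M)
     = (\<integral>\<^sup>+\<omega>. (\<Sum>n. ennreal (exp (- v) ^ n) * indicator {\<omega>\<in>space M. card (\<Phi> \<omega> \<inter> A) = n} \<omega>) \<partial>M)"
  proof (intro nn_integral_cong)
    fix \<omega> assume "\<omega> \<in> space M"
    have "(\<Sum>n. ennreal (exp (- v) ^ n) * indicator {\<omega>\<in>space M. card (\<Phi> \<omega> \<inter> A) = n} \<omega>)
       = (\<Sum>n\<in>{card (\<Phi> \<omega> \<inter> A)}. ennreal (exp (- v) ^ n) * indicator {\<omega>\<in>space M. card (\<Phi> \<omega> \<inter> A) = n} \<omega>)"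
      by (rule suminf_finite) auto
    then show "eneg (c * of_nat (card (\<Phi> \<omega> \<inter> A))) = (\<Sum>n. ennreal (exp (- v) ^ n) * indicator {\<omega>\<in>space M. card (\<Phi> \<omega> \<inter> A) = n} \<omega>)"
      using \<open>\<omega> \<in> space M\<close> v by (simp add: eneg_mult_of_nat eneg_ennreal ennreal_power)
  qed
  also have "\<dots> = (\<Sum>n. ennreal (exp (- v) ^ n) * ennreal (r ^ n / fact n * exp (- r)))"
    by (subst nn_integral_suminf) (auto simp: nn_integral_cmult_indicator P)
  also have "\<dots> = (\<Sum>n. ennreal (exp (- r) * (inverse (fact n) *\<^sub>R (exp (- v) * r) ^ n)))"
    using r by (intro suminf_cong) (simp add: field_simps power_mult_distrib flip: ennreal_mult)
  also have "\<dots> = ennreal (exp (- r) * exp (exp (- v) * r))"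
  proof (rule suminf_ennreal_eq)
    show "(\<lambda>n. exp (- r) * (inverse (fact n) *\<^sub>R (exp (- v) * r) ^ n)) sums (exp (- r) * exp (exp (- v) * r))"
      by (intro sums_mult exp_converges)
  qed (use r in auto)
  also have "exp (- r) * exp (exp (- v) * r) = exp (- (d * ((1 - exp (- v)) * measure lborel A)))"
    by (simp add: r_def algebra_simps flip: exp_add)
  also have "ennreal \<dots> = eneg (ennreal (d * ((1 - exp (- v)) * measure lborel A)))"
    using \<open>d \<ge> 0\<close> v by (subst eneg_ennreal) auto
  also have "ennreal (d * ((1 - exp (- v)) * measure lborel A)) = ennreal d * ((1 - eneg c) * emeasure lborel A)"
  proof -
    have "emeasure lborel A = ennreal (measure lborel A)"
      using emeasure_bounded_finite[OF A(2)] by (intro emeasure_eq_ennreal_measure) simp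
    moreover have "1 - eneg c = ennreal (1 - exp (- v))"
      using v by (simp add: eneg_ennreal ennreal_minus flip: ennreal_1)
    ultimately show ?thesis
      using \<open>d \<ge> 0\<close> v by (simp add: ennreal_mult)
  qed
  finally show ?thesis .
qed

text \<open>For simple \<open>f\<close> the counts in disjoint sets are independent and the
  exponents add. Both sides are continuous along increasing sequences, so the formula passes to all
  measurable \<open>f\<close>; the value \<open>\<top>\<close> is included, which yields void
  probabilities.\<close>

lemma ppp_laplace_functional:
  fixes \<Phi> :: "'a \<Rightarrow> 'b::euclidean_space set"
  assumes ppp: "homogeneous_ppp M d \<Phi>" and "d \<ge> 0" and f: "f \<in> borel_measurable borel"
  shows "(\<integral>\<^sup>+\<omega>. eneg (points_sum f (\<Phi> \<omega>)) \<partial>M) = eneg (ennreal d * (\<integral>\<^sup>+x. 1 - eneg (f x) \<partial>lborel))"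
proof -
  have \<Phi> [measurable]: "\<Phi> \<in> measurable M point_configs"
    using ppp by (simp add: homogeneous_ppp_def)
  have lf: "locally_finite_set (\<Phi> \<omega>)" if "\<omega> \<in> space M" for \<omega>
    using measurable_space[OF \<Phi> that] by (simp add: space_point_configs)
  obtain g where g: "incseq g" "\<And>x. (SUP k. g k x) = f x"
    "\<And>k. \<exists>(c :: nat \<Rightarrow> ennreal) A n. disjoint_family A \<and> (\<forall>j. A j \<in> sets borel \<and> bounded (A j)) \<and>
       (\<forall>m<n. c m < \<top>) \<and> g k = (\<lambda>x. \<Sum>m<n. c m * indicator (A m) x)"
    using simple_approximation[OF f] by blast
  have g_meas [measurable]: "g k \<in> borel_measurable borel" for k
  proof -
    obtain c A and n :: nat where [measurable]: "\<And>j. A j \<in> sets borel"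
      and gk: "g k = (\<lambda>x. \<Sum>m<n. c m * indicator (A m) x)"
      using g(3)[of k] by blast
    show ?thesis unfolding gk by measurable
  qed
  have simple: "(\<integral>\<^sup>+\<omega>. eneg (points_sum (g k) (\<Phi> \<omega>)) \<partial>M) = eneg (ennreal d * (\<integral>\<^sup>+x. 1 - eneg (g k x) \<partial>lborel))" for k
  proof -
    obtain c A and n :: nat where dA: "disjoint_family A" and A: "\<And>j. A j \<in> sets borel" "\<And>j. bounded (A j)"
      and c: "\<And>m. m < n \<Longrightarrow> c m < \<top>"
      and gk: "g k = (\<lambda>x. \<Sum>m<n. c m * indicator (A m) x)"
      using g(3)[of k] by blast
    have ind: "indep_vars (\<lambda>_. count_space UNIV) (\<lambda>j \<omega>. card (\<Phi> \<omega> \<inter> A j)) UNIV"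
      using ppp dA A by (auto simp: homogeneous_ppp_def)
    have ind': "indep_vars (\<lambda>_. borel) (\<lambda>m \<omega>. eneg (c m * of_nat (card (\<Phi> \<omega> \<inter> A m)))) {..<n}"
      by (rule indep_vars_compose2[OF indep_vars_subset[OF ind]]) auto
    have "(\<integral>\<^sup>+\<omega>. eneg (points_sum (g k) (\<Phi> \<omega>)) \<partial>M) = (\<integral>\<^sup>+\<omega>. (\<Prod>m<n. eneg (c m * of_nat (card (\<Phi> \<omega> \<inter> A m)))) \<partial>M)"
      by (intro nn_integral_cong) (simp only: gk points_sum_sum eneg_sum points_sum_indicator[OF lf A(2)])
    also have "\<dots> = (\<Prod>m<n. \<integral>\<^sup>+\<omega>. eneg (c m * of_nat (card (\<Phi> \<omega> \<inter> A m))) \<partial>M)"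
      by (rule indep_vars_nn_integral[OF _ ind']) auto
    also have "\<dots> = (\<Prod>m<n. eneg (ennreal d * ((1 - eneg (c m)) * emeasure lborel (A m))))"
      using ppp_count_laplace[OF ppp \<open>d \<ge> 0\<close>] A c by (intro prod.cong) auto
    also have "\<dots> = eneg (ennreal d * (\<Sum>m<n. (1 - eneg (c m)) * emeasure lborel (A m)))"
      by (simp only: eneg_sum sum_distrib_left)
    also have "(\<Sum>m<n. (1 - eneg (c m)) * emeasure lborel (A m)) = (\<integral>\<^sup>+x. (\<Sum>m<n. (1 - eneg (c m)) * indicator (A m) x) \<partial>lborel)"
      using A by (subst nn_integral_sum) (auto simp: nn_integral_cmult_indicator)
    also have "\<dots> = (\<integral>\<^sup>+x. 1 - eneg (g k x) \<partial>lborel)"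
    proof (intro nn_integral_cong)
      fix x
      show "(\<Sum>m<n. (1 - eneg (c m)) * indicator (A m) x) = 1 - eneg (g k x)"
      proof (cases "\<exists>m0<n. x \<in> A m0")
        case True
        then obtain m0 where m0: "m0 < n" "x \<in> A m0" by blast
        then have ind: "indicator (A m) x = (if m = m0 then 1 else 0 :: ennreal)" for m
          using dA by (auto simp: disjoint_family_on_def split: split_indicator)
        have "g k x = (\<Sum>m<n. if m = m0 then c m0 else 0)"
          unfolding gk by (intro sum.cong) (simp_all add: ind)
        moreover have "(\<Sum>m<n. (1 - eneg (c m)) * indicator (A m) x) = (\<Sum>m<n. if m = m0 then 1 - eneg (c m0) else 0)"
          by (intro sum.cong) (simp_all add: ind)
        ultimately show ?thesis using m0 by simp
      next
        case False
        then have ind: "indicator (A m) x = (0::ennreal)" if "m < n" for m using that by auto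
        have "g k x = (\<Sum>m<n. 0)" "(\<Sum>m<n. (1 - eneg (c m)) * indicator (A m) x) = (\<Sum>m<n. 0)"
          unfolding gk by (intro sum.cong; simp add: ind)+
        then show ?thesis by simp
      qed
    qed
    finally show ?thesis .
  qed
  have "(\<lambda>k. \<integral>\<^sup>+\<omega>. eneg (points_sum (g k) (\<Phi> \<omega>)) \<partial>M) \<longlonglongrightarrow> (\<integral>\<^sup>+\<omega>. eneg (SUP k. points_sum (g k) (\<Phi> \<omega>)) \<partial>M)"
    by (rule tendsto_eneg_SUP_nn_integral) (auto intro: incseq_points_sum g(1) finite_measure_axioms)
  also have "(\<integral>\<^sup>+\<omega>. eneg (SUP k. points_sum (g k) (\<Phi> \<omega>)) \<partial>M) = (\<integral>\<^sup>+\<omega>. eneg (points_sum f (\<Phi> \<omega>)) \<partial>M)"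
    by (simp add: points_sum_SUP[OF g(1), symmetric] g(2))
  finally have lhs: "(\<lambda>k. eneg (ennreal d * (\<integral>\<^sup>+x. 1 - eneg (g k x) \<partial>lborel))) \<longlonglongrightarrow> (\<integral>\<^sup>+\<omega>. eneg (points_sum f (\<Phi> \<omega>)) \<partial>M)"
    by (simp only: simple)
  have inc: "incseq (\<lambda>k x. 1 - eneg (g k x))"
    using g(1) by (auto simp: incseq_def le_fun_def intro!: ennreal_minus_mono eneg_antimono)
  have lim: "(\<lambda>k. 1 - eneg (g k x)) \<longlonglongrightarrow> 1 - eneg (f x)" for x
  proof -
    have "incseq (\<lambda>k. g k x)" using g(1) by (auto simp: incseq_def le_fun_def)
    from tendsto_eneg_incseq[OF this] show ?thesis
      using eneg_less_top[of "f x"] by (intro tendsto_diff_ennreal) (auto simp: g(2))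
  qed
  have sup: "(SUP k. 1 - eneg (g k x)) = 1 - eneg (f x)" for x
    using inc by (intro LIMSEQ_unique[OF LIMSEQ_SUP lim]) (auto simp: incseq_def le_fun_def)
  have "(\<integral>\<^sup>+x. (SUP k. 1 - eneg (g k x)) \<partial>lborel) = (SUP k. \<integral>\<^sup>+x. 1 - eneg (g k x) \<partial>lborel)"
    using inc by (intro nn_integral_monotone_convergence_SUP) auto
  then have "ennreal d * (\<integral>\<^sup>+x. 1 - eneg (f x) \<partial>lborel) = (SUP k. ennreal d * (\<integral>\<^sup>+x. 1 - eneg (g k x) \<partial>lborel))"
    by (simp add: sup SUP_mult_left_ennreal)
  moreover have "incseq (\<lambda>k. ennreal d * (\<integral>\<^sup>+x. 1 - eneg (g k x) \<partial>lborel))"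
    using inc by (auto simp: incseq_def le_fun_def intro!: mult_left_mono nn_integral_mono)
  ultimately have "(\<lambda>k. eneg (ennreal d * (\<integral>\<^sup>+x. 1 - eneg (g k x) \<partial>lborel))) \<longlonglongrightarrow> eneg (ennreal d * (\<integral>\<^sup>+x. 1 - eneg (f x) \<partial>lborel))"
    using tendsto_eneg_incseq by metis
  from LIMSEQ_unique[OF lhs this] show ?thesis .
qed

end

section \<open>Independent marks\<close>

lemma points_sum_enumeration:
  assumes "inj x" "S \<subseteq> range x"
  shows "points_sum f S = (\<Sum>n. f (x n) * indicator S (x n))"
proof -
  have "points_sum f S = (\<integral>\<^sup>+y. f y * indicator S y \<partial>count_space (range x))"
    unfolding points_sum_def using assms(2) by (subst nn_integral_count_space_indicator) 
      (auto simp: nn_integral_count_space_indicator intro!: nn_integral_cong split: split_indicator)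
  also have "\<dots> = (\<integral>\<^sup>+n. f (x n) * indicator S (x n) \<partial>count_space UNIV)"
    using assms(1) by (intro nn_integral_bij_count_space[symmetric]) (simp add: inj_on_imp_bij_betw)
  finally show ?thesis by (simp add: nn_integral_count_space_nat)
qed

lemma emeasure_annulus:
  assumes "0 \<le> a" "a \<le> b"
  shows "emeasure lborel {x::real^2. a \<le> (norm x)\<^sup>2 \<and> (norm x)\<^sup>2 < b} = ennreal (pi * (b - a))"
proof -
  have "emeasure lborel {x::real^2. a \<le> (norm x)\<^sup>2 \<and> (norm x)\<^sup>2 < b} = (\<integral>\<^sup>+(x::real^2). indicator {a..<b} ((norm x)\<^sup>2) \<partial>lborel)"
  proof -
    have "{x::real^2. a \<le> (norm x)\<^sup>2 \<and> (norm x)\<^sup>2 < b} \<in> sets lborel" by measurable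
    from nn_integral_indicator[OF this] show ?thesis
      by (subst nn_integral_cong[where v = "indicator {x::real^2. a \<le> (norm x)\<^sup>2 \<and> (norm x)\<^sup>2 < b}"])
         (auto split: split_indicator)
  qed
  also have "\<dots> = ennreal pi * (\<integral>\<^sup>+v\<in>{0<..}. indicator {a..<b} v \<partial>lborel)"
    by (rule nn_integral_radial) simp
  also have "(\<integral>\<^sup>+v\<in>{0<..}. indicator {a..<b} v \<partial>lborel) = (\<integral>\<^sup>+v. indicator {a..<b} v \<partial>lborel)"
  proof (rule nn_integral_cong_AE, rule AE_mp[OF AE_lborel_singleton[of 0]], rule AE_I2, rule impI)
    fix v :: real assume "v \<noteq> 0"
    then show "indicator {a..<b} v * indicator {0<..} v = (indicator {a..<b} v :: ennreal)"
      using assms by (auto split: split_indicator)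
  qed
  also have "\<dots> = ennreal (b - a)" using assms by simp
  finally show ?thesis by (simp add: ennreal_mult')
qed

lemma (in prob_space) ppp_hit_prob_le:
  fixes \<Phi> :: "'a \<Rightarrow> 'b::euclidean_space set"
  assumes ppp: "homogeneous_ppp M d \<Phi>" and A: "A \<in> sets borel" "bounded A"
  shows "prob {\<omega>\<in>space M. card (\<Phi> \<omega> \<inter> A) \<noteq> 0} \<le> d * measure lborel A"
proof -
  have [measurable]: "(\<lambda>\<omega>. card (\<Phi> \<omega> \<inter> A)) \<in> measurable M (count_space UNIV)"
    using ppp A by (intro measurable_compose[OF _ measurable_card_points]) (auto simp: homogeneous_ppp_def)
  have "prob {\<omega>\<in>space M. card (\<Phi> \<omega> \<inter> A) \<noteq> 0} = 1 - prob {\<omega>\<in>space M. card (\<Phi> \<omega> \<inter> A) = 0}"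
    by (rule prob_neg[of "\<lambda>\<omega>. card (\<Phi> \<omega> \<inter> A) = 0"]) measurable
  also have "prob {\<omega>\<in>space M. card (\<Phi> \<omega> \<inter> A) = 0} = exp (- (d * measure lborel A))"
    using ppp[unfolded homogeneous_ppp_def, THEN conjunct2, THEN conjunct1, rule_format, of A 0] A by simp
  finally show ?thesis using exp_ge_add_one_self[of "- (d * measure lborel A)"] by simp
qed

text \<open>A disc is cut into \<open>N\<close> annuli of equal area. A common point forces both
  processes to hit the same annulus, which for each annulus has probability of order
  \<open>1 / N\<^sup>2\<close> by independence; the sum is of order \<open>1 / N\<close>.\<close>

lemma (in prob_space) indep_ppp_disjoint:
  fixes \<Phi> :: "'j \<Rightarrow> 'a \<Rightarrow> (real^2) set" and X :: "nat \<Rightarrow> 'a \<Rightarrow> real^2"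
  assumes ppp: "\<And>j. j \<in> J \<Longrightarrow> homogeneous_ppp M (d j) (\<Phi> j)" and d: "\<And>j. j \<in> J \<Longrightarrow> d j \<ge> 0"
    and ind: "indep_vars (\<lambda>_. point_configs) \<Phi> J"
    and X [measurable]: "\<And>n. X n \<in> borel_measurable M"
    and j: "i \<in> J" "j \<in> J" "i \<noteq> j"
  shows "AE \<omega> in M. \<forall>n. \<not> (X n \<omega> \<in> \<Phi> i \<omega> \<and> X n \<omega> \<in> \<Phi> j \<omega>)"
proof -
  have [measurable]: "\<Phi> i \<in> measurable M point_configs" "\<Phi> j \<in> measurable M point_configs"
    using ppp j by (auto simp: homogeneous_ppp_def)
  have lf: "locally_finite_set (\<Phi> l \<omega>)" if "\<omega> \<in> space M" "l \<in> J" for \<omega> l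
    using measurable_space[of "\<Phi> l" M point_configs \<omega>] ppp[OF that(2)] that by (auto simp: space_point_configs homogeneous_ppp_def)
  define E where "E R = {\<omega>\<in>space M. \<exists>n. X n \<omega> \<in> \<Phi> i \<omega> \<and> X n \<omega> \<in> \<Phi> j \<omega> \<and> (norm (X n \<omega>))\<^sup>2 < R}" for R :: real
  have E_meas [measurable]: "E R \<in> events" for R unfolding E_def by measurable
  have bound: "prob (E R) \<le> d i * d j * (pi * R)\<^sup>2 / real N" if "R > 0" "N > 0" for R and N :: nat
  proof -
    \<comment> \<open>Equal steps of the squared radius give annuli of equal area
      \<open>pi * R / N\<close>; \<open>R\<close> is the squared radius of the disc.\<close>
    define A :: "nat \<Rightarrow> (real^2) set" where "A k = {x. R * (real k / real N) \<le> (norm x)\<^sup>2 \<and> (norm x)\<^sup>2 < R * (real (Suc k) / real N)}" for k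
    have A: "A k \<in> sets borel" for k unfolding A_def by measurable
    have bA: "bounded (A k)" for k
    proof (rule bounded_subset[OF bounded_cball])
      show "A k \<subseteq> cball 0 (sqrt (R * (real (Suc k) / real N)))"
        by (auto simp: A_def real_le_rsqrt simp del: of_nat_Suc)
    qed
    have mA: "measure lborel (A k) = pi * R / real N" for k
    proof -
      have "emeasure lborel (A k) = ennreal (pi * (R * (real (Suc k) / real N) - R * (real k / real N)))"
        unfolding A_def using that by (intro emeasure_annulus) (auto simp: divide_right_mono)
      also have "pi * (R * (real (Suc k) / real N) - R * (real k / real N)) = pi * R / real N"
        by (simp add: add_divide_distrib algebra_simps)
      finally show ?thesis using that by (simp add: measure_def)
    qed
    define Z where "Z l k = {\<omega>\<in>space M. card (\<Phi> l \<omega> \<inter> A k) \<noteq> 0}" for l k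
    have Z_eq: "Z l k = \<Phi> l -` {S \<in> space point_configs. card (S \<inter> A k) \<noteq> 0} \<inter> space M" if "l \<in> J" for l k
      using lf that by (auto simp: Z_def space_point_configs)
    have card_meas: "{S \<in> space point_configs. card (S \<inter> A k) \<noteq> 0} \<in> sets point_configs" for k
      using measurable_sets[OF measurable_card_points[OF A bA], of "- {0}" k]
      by (simp add: vimage_def Int_def conj_commute)
    have Z_meas: "Z l k \<in> events" if "l \<in> J" for l k
      unfolding Z_eq[OF that] using ppp[OF that] by (intro measurable_sets[OF _ card_meas]) (simp add: homogeneous_ppp_def)
    have Z_le: "prob (Z l k) \<le> d l * (pi * R / real N)" if "l \<in> J" for l k
      using ppp_hit_prob_le[OF ppp[OF that] A bA, of k] by (simp add: Z_def mA)
    have Z_ind: "prob (Z i k \<inter> Z j k) = prob (Z i k) * prob (Z j k)" for k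
    proof -
      have "prob (\<Inter>l\<in>{i, j}. \<Phi> l -` {S \<in> space point_configs. card (S \<inter> A k) \<noteq> 0} \<inter> space M)
         = (\<Prod>l\<in>{i, j}. prob (\<Phi> l -` {S \<in> space point_configs. card (S \<inter> A k) \<noteq> 0} \<inter> space M))"
        using j card_meas by (intro indep_varsD[OF ind]) auto
      then show ?thesis using j by (simp add: Z_eq)
    qed
    have sub: "E R \<subseteq> (\<Union>k<N. Z i k \<inter> Z j k)"
    proof
      fix \<omega> assume "\<omega> \<in> E R"
      then obtain n where \<omega>: "\<omega> \<in> space M" and n: "X n \<omega> \<in> \<Phi> i \<omega>" "X n \<omega> \<in> \<Phi> j \<omega>" "(norm (X n \<omega>))\<^sup>2 < R"
        by (auto simp: E_def)
      define v where "v = (norm (X n \<omega>))\<^sup>2 * real N / R"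
      have v: "0 \<le> v" "v < real N" using n(3) that by (auto simp: v_def field_simps)
      define k where "k = nat \<lfloor>v\<rfloor>"
      have k: "real k \<le> v" "v < real (Suc k)" using v by (auto simp: k_def) linarith
      then have "k < N" using v by linarith
      have "(norm (X n \<omega>))\<^sup>2 = R * (v / real N)" using that by (simp add: v_def)
      then have "X n \<omega> \<in> A k"
        using k that by (auto simp: A_def divide_right_mono divide_strict_right_mono simp del: of_nat_Suc)
      moreover have "finite (\<Phi> l \<omega> \<inter> A k)" if "l \<in> J" for l
        using lf[OF \<omega> that] bA by (rule locally_finite_finite_Int)
      ultimately have "\<omega> \<in> Z i k \<inter> Z j k"
        using n \<omega> j by (auto simp: Z_def card_gt_0_iff)
      then show "\<omega> \<in> (\<Union>k<N. Z i k \<inter> Z j k)" using \<open>k < N\<close> by auto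
    qed
    have "prob (E R) \<le> prob (\<Union>k<N. Z i k \<inter> Z j k)"
      using sub j by (intro finite_measure_mono) (auto intro!: Z_meas)
    also have "\<dots> \<le> (\<Sum>k<N. prob (Z i k \<inter> Z j k))"
      using j by (intro finite_measure_subadditive_finite) (auto intro!: Z_meas)
    also have "\<dots> \<le> (\<Sum>k<N. d i * (pi * R / real N) * (d j * (pi * R / real N)))"
      unfolding Z_ind using j d that by (intro sum_mono mult_mono Z_le) auto
    also have "\<dots> = d i * d j * (pi * R)\<^sup>2 / real N"
      using that by (simp add: power2_eq_square field_simps)
    finally show ?thesis .
  qed
  have zero: "prob (E R) = 0" if "R > 0" for R
  proof (rule antisym)
    have "(\<lambda>N. d i * d j * (pi * R)\<^sup>2 / real N) \<longlonglongrightarrow> 0"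
      by (rule lim_const_over_n)
    then show "prob (E R) \<le> 0"
      by (rule LIMSEQ_le_const) (use bound[OF that] in \<open>auto intro!: exI[of _ 1]\<close>)
  qed simp
  have "AE \<omega> in M. \<omega> \<notin> E (real (Suc R))" for R :: nat
    using zero[of "real (Suc R)"] by (intro AE_not_in) (simp add: null_sets_def emeasure_eq_measure del: of_nat_Suc)
  then have "AE \<omega> in M. \<forall>R::nat. \<omega> \<notin> E (real (Suc R))"
    by (simp add: AE_all_countable)
  then show ?thesis
  proof (rule AE_mp, intro AE_I2 impI allI notI)
    fix \<omega> n assume \<omega>: "\<omega> \<in> space M" "\<forall>R::nat. \<omega> \<notin> E (real (Suc R))" "X n \<omega> \<in> \<Phi> i \<omega> \<and> X n \<omega> \<in> \<Phi> j \<omega>"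
    obtain R :: nat where "(norm (X n \<omega>))\<^sup>2 < real R" using reals_Archimedean2 by blast
    then have "\<omega> \<in> E (real (Suc R))" using \<omega> by (auto simp: E_def intro!: exI[of _ n])
    then show False using \<omega>(2) by blast
  qed
qed

text \<open>The enumeration \<open>X\<close> and the marks \<open>H\<close> along it are parameters
  here, no longer hidden behind an existential quantifier, and \<open>J\<close> stands for any
  finite family of independent processes.\<close>

locale marked_network = prob_space M
  for M :: "'w measure" +
  fixes J :: "'j set" and d :: "'j \<Rightarrow> real" and \<Phi> :: "'j \<Rightarrow> 'w \<Rightarrow> (real^2) set"
    and X :: "nat \<Rightarrow> 'w \<Rightarrow> real^2" and H :: "nat \<Rightarrow> 'w \<Rightarrow> real"
  assumes finite_J: "finite J"
    and d_nonneg: "\<And>j. j \<in> J \<Longrightarrow> d j \<ge> 0"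
    and ppp: "\<And>j. j \<in> J \<Longrightarrow> homogeneous_ppp M (d j) (\<Phi> j)"
    and processes_indep: "indep_vars (\<lambda>_. point_configs) \<Phi> J"
    and X_measurable [measurable]: "\<And>n. X n \<in> borel_measurable M"
    and X_inj: "\<And>\<omega>. \<omega> \<in> space M \<Longrightarrow> inj (\<lambda>n. X n \<omega>)"
    and X_cover: "\<And>j \<omega>. \<omega> \<in> space M \<Longrightarrow> j \<in> J \<Longrightarrow> \<Phi> j \<omega> \<subseteq> range (\<lambda>n. X n \<omega>)"
    and H_distributed: "\<And>n. distributed M lborel (H n) (exponential_density 1)"
    and H_indep: "indep_vars (\<lambda>_. borel) H UNIV"
    and H_indep_processes: "indep_set
       (sets (vimage_algebra (space M) (\<lambda>\<omega> n. H n \<omega>) (\<Pi>\<^sub>M n\<in>UNIV. (borel :: real measure))))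
       (sets (vimage_algebra (space M) (\<lambda>\<omega>. (\<lambda>n. X n \<omega>, \<lambda>j\<in>J. \<Phi> j \<omega>))
          ((\<Pi>\<^sub>M n\<in>UNIV. borel) \<Otimes>\<^sub>M (\<Pi>\<^sub>M j\<in>J. point_configs))))"
begin

lemma H_measurable [measurable]: "H n \<in> borel_measurable M"
  using distributed_measurable[OF H_distributed[of n]] by simp

lemma \<Phi>_measurable [measurable]: "j \<in> J \<Longrightarrow> \<Phi> j \<in> measurable M point_configs"
  using ppp by (simp add: homogeneous_ppp_def)

text \<open>By \<open>H_indep_processes\<close> the joint law of the marks and the rest is a product
  measure. The second outcome \<open>\<omega>'\<close> resamples the marks only, while locations and
  configurations stay frozen.\<close>

lemma nn_integral_decouple_marks:
  fixes f :: "(nat \<Rightarrow> real) \<times> ((nat \<Rightarrow> real^2) \<times> ('j \<Rightarrow> (real^2) set)) \<Rightarrow> ennreal"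
  assumes [measurable]: "f \<in> borel_measurable ((\<Pi>\<^sub>M n\<in>UNIV. borel) \<Otimes>\<^sub>M ((\<Pi>\<^sub>M n\<in>UNIV. borel) \<Otimes>\<^sub>M (\<Pi>\<^sub>M j\<in>J. point_configs)))"
  shows "(\<integral>\<^sup>+\<omega>. f (\<lambda>n. H n \<omega>, \<lambda>n. X n \<omega>, \<lambda>j\<in>J. \<Phi> j \<omega>) \<partial>M)
    = (\<integral>\<^sup>+\<omega>. (\<integral>\<^sup>+\<omega>'. f (\<lambda>n. H n \<omega>', \<lambda>n. X n \<omega>, \<lambda>j\<in>J. \<Phi> j \<omega>) \<partial>M) \<partial>M)"
proof -
  let ?PH = "\<Pi>\<^sub>M n\<in>(UNIV::nat set). (borel :: real measure)"
  let ?Q = "(\<Pi>\<^sub>M n\<in>(UNIV::nat set). (borel :: (real^2) measure)) \<Otimes>\<^sub>M (\<Pi>\<^sub>M j\<in>J. (point_configs :: (real^2) set measure))"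
  let ?h = "\<lambda>\<omega> n. H n \<omega>" and ?y = "\<lambda>\<omega>. (\<lambda>n. X n \<omega>, \<lambda>j\<in>J. \<Phi> j \<omega>)"
  have h [measurable]: "?h \<in> measurable M ?PH" by (rule measurable_PiM_single') auto
  have y [measurable]: "?y \<in> measurable M ?Q"
    by (intro measurable_Pair measurable_PiM_single' measurable_restrict) (auto)
  interpret DH: prob_space "distr M ?PH ?h" by (rule prob_space_distr) simp
  interpret DY: prob_space "distr M ?Q ?y" by (rule prob_space_distr) simp
  interpret pair_sigma_finite "distr M ?PH ?h" "distr M ?Q ?y" ..
  have "distr M ?PH ?h \<Otimes>\<^sub>M distr M ?Q ?y = distr M (?PH \<Otimes>\<^sub>M ?Q) (\<lambda>\<omega>. (?h \<omega>, ?y \<omega>))"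
  proof (rule pair_measure_eqI)
    fix A B assume "A \<in> sets (distr M ?PH ?h)" and "B \<in> sets (distr M ?Q ?y)"
    then have A: "A \<in> sets ?PH" and B: "B \<in> sets ?Q" by auto
    have "prob ((?h -` A \<inter> space M) \<inter> (?y -` B \<inter> space M)) = prob (?h -` A \<inter> space M) * prob (?y -` B \<inter> space M)"
      by (rule indep_setD[OF H_indep_processes]) (intro in_vimage_algebra A B)+
    moreover have "(\<lambda>\<omega>. (?h \<omega>, ?y \<omega>)) -` (A \<times> B) \<inter> space M = (?h -` A \<inter> space M) \<inter> (?y -` B \<inter> space M)"
      by auto
    ultimately show "emeasure (distr M ?PH ?h) A * emeasure (distr M ?Q ?y) B
        = emeasure (distr M (?PH \<Otimes>\<^sub>M ?Q) (\<lambda>\<omega>. (?h \<omega>, ?y \<omega>))) (A \<times> B)"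
      using A B by (simp add: emeasure_distr emeasure_eq_measure ennreal_mult)
  qed (auto intro: DH.sigma_finite_measure_axioms DY.sigma_finite_measure_axioms)
  then have "(\<integral>\<^sup>+\<omega>. f (?h \<omega>, ?y \<omega>) \<partial>M) = (\<integral>\<^sup>+z. f z \<partial>(distr M ?PH ?h \<Otimes>\<^sub>M distr M ?Q ?y))"
    by (simp add: nn_integral_distr)
  also have "\<dots> = (\<integral>\<^sup>+y. (\<integral>\<^sup>+h. f (h, y) \<partial>distr M ?PH ?h) \<partial>distr M ?Q ?y)"
    by (subst nn_integral_snd) (auto simp: case_prod_beta')
  also have "\<dots> = (\<integral>\<^sup>+\<omega>. (\<integral>\<^sup>+h. f (h, ?y \<omega>) \<partial>distr M ?PH ?h) \<partial>M)"
    by (rule nn_integral_distr) measurable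
  also have "\<dots> = (\<integral>\<^sup>+\<omega>. (\<integral>\<^sup>+\<omega>'. f (?h \<omega>', ?y \<omega>) \<partial>M) \<partial>M)"
  proof (rule nn_integral_cong)
    fix \<omega> assume "\<omega> \<in> space M"
    then have "?y \<omega> \<in> space ?Q" using measurable_space[OF y] by blast
    then show "(\<integral>\<^sup>+h. f (h, ?y \<omega>) \<partial>distr M ?PH ?h) = (\<integral>\<^sup>+\<omega>'. f (?h \<omega>', ?y \<omega>) \<partial>M)"
      by (intro nn_integral_distr) measurable
  qed
  finally show ?thesis .
qed

text \<open>Summation runs over the enumeration, not over the point sets, because independence of
  the marks is available only along \<open>X\<close>.\<close>

definition marked_sum :: "('j \<Rightarrow> (real^2) \<times> real \<Rightarrow> ennreal) \<Rightarrow> 'w \<Rightarrow> ennreal" where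
  "marked_sum F \<omega> = (\<Sum>n. \<Sum>j\<in>J. F j (X n \<omega>, H n \<omega>) * indicator (\<Phi> j \<omega>) (X n \<omega>))"

lemma processes_disjoint:
  "AE \<omega> in M. \<forall>i\<in>J. \<forall>j\<in>J. i \<noteq> j \<longrightarrow> (\<forall>n. \<not> (X n \<omega> \<in> \<Phi> i \<omega> \<and> X n \<omega> \<in> \<Phi> j \<omega>))"
proof -
  have "AE \<omega> in M. i \<noteq> j \<longrightarrow> (\<forall>n. \<not> (X n \<omega> \<in> \<Phi> i \<omega> \<and> X n \<omega> \<in> \<Phi> j \<omega>))" if "i \<in> J" "j \<in> J" for i j
    using indep_ppp_disjoint[OF ppp d_nonneg processes_indep X_measurable that] by (cases "i = j") auto
  then show ?thesis using finite_J by (simp add: AE_ball_countable' countable_finite)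
qed

text \<open>The marking theorem. Averaging the marks first replaces the factor of a point
  \<open>x\<close> by its mean \<open>\<phi> j x\<close>; what is left is the Laplace functional of
  the unmarked process with exponent \<open>lneg (\<phi> j x)\<close>.\<close>

theorem marked_laplace_functional:
  assumes F [measurable]: "\<And>j. F j \<in> borel_measurable borel"
  shows "(\<integral>\<^sup>+\<omega>. eneg (marked_sum F \<omega>) \<partial>M) =
    (\<Prod>j\<in>J. eneg (ennreal (d j) * (\<integral>\<^sup>+x. (\<integral>\<^sup>+t. ennreal (exponential_density 1 t) * (1 - eneg (F j (x, t))) \<partial>lborel) \<partial>lborel)))"
proof -
  have F' [measurable]: "F j \<in> borel_measurable (borel \<Otimes>\<^sub>M borel)" for j
    using F[of j] by (simp add: borel_prod)
  define \<phi> where "\<phi> j x = (\<integral>\<^sup>+t. ennreal (exponential_density 1 t) * eneg (F j (x, t)) \<partial>lborel)" for j x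
  have \<phi>_meas [measurable]: "\<phi> j \<in> borel_measurable borel" for j
    unfolding \<phi>_def by measurable
  have exp1: "(\<integral>\<^sup>+t. ennreal (exponential_density 1 t) \<partial>lborel) = 1"
    using prob_space.emeasure_space_1[OF prob_space_exponential_density[of 1]] by (simp add: emeasure_density)
  have \<phi>1: "\<phi> j x \<le> 1" for j x
  proof -
    have "\<phi> j x \<le> (\<integral>\<^sup>+t. ennreal (exponential_density 1 t) \<partial>lborel)"
      unfolding \<phi>_def using mult_left_mono[OF eneg_le_1] by (intro nn_integral_mono) (metis mult.right_neutral zero_le)
    then show ?thesis by (simp add: exp1)
  qed
  \<comment> \<open>The subtraction is legitimate because the mean factor is at most
    \<open>1\<close>, hence finite.\<close>
  have \<phi>_diff: "(\<integral>\<^sup>+t. ennreal (exponential_density 1 t) * (1 - eneg (F j (x, t))) \<partial>lborel) = 1 - \<phi> j x" for j x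
  proof -
    have "(\<integral>\<^sup>+t. ennreal (exponential_density 1 t) - ennreal (exponential_density 1 t) * eneg (F j (x, t)) \<partial>lborel)
       = (\<integral>\<^sup>+t. ennreal (exponential_density 1 t) \<partial>lborel) - \<phi> j x"
      unfolding \<phi>_def
    proof (rule nn_integral_diff)
      show "(\<integral>\<^sup>+t. ennreal (exponential_density 1 t) * eneg (F j (x, t)) \<partial>lborel) \<noteq> \<infinity>"
        using \<phi>1[of j x] unfolding \<phi>_def by (auto simp: top_unique)
      show "AE t in lborel. ennreal (exponential_density 1 t) * eneg (F j (x, t)) \<le> ennreal (exponential_density 1 t)"
        using mult_left_mono[OF eneg_le_1] by (intro AE_I2) (metis mult.right_neutral zero_le)
    qed measurable
    moreover have "ennreal (exponential_density 1 t) * (1 - eneg (F j (x, t)))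
        = ennreal (exponential_density 1 t) - ennreal (exponential_density 1 t) * eneg (F j (x, t))" for t
      using eneg_le_1 by (simp add: ennreal_right_diff_distrib)
    ultimately show ?thesis by (simp add: exp1)
  qed
  define c where "c n \<omega> = (\<Sum>j\<in>J. F j (X n \<omega>, H n \<omega>) * indicator (\<Phi> j \<omega>) (X n \<omega>))" for n \<omega>
  define c' where "c' n \<omega> = (\<Sum>j\<in>J. lneg (\<phi> j (X n \<omega>)) * indicator (\<Phi> j \<omega>) (X n \<omega>))" for n \<omega>
  have [measurable]: "c n \<in> borel_measurable M" "c' n \<in> borel_measurable M" for n
    unfolding c_def c'_def by (auto intro!: borel_measurable_sum)
  \<comment> \<open>Independence of the marks is applied to finitely many locations; the limit is
    taken afterwards, on both sides by bounded convergence.\<close>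
  have finite_terms: "(\<integral>\<^sup>+\<omega>. eneg (\<Sum>n<N. c n \<omega>) \<partial>M) = (\<integral>\<^sup>+\<omega>. eneg (\<Sum>n<N. c' n \<omega>) \<partial>M)" for N
  proof -
    let ?g = "\<lambda>n x S t. eneg (\<Sum>j\<in>J. F j (x n, t) * indicator (S j) (x n))"
    have "(\<integral>\<^sup>+\<omega>. eneg (\<Sum>n<N. c n \<omega>) \<partial>M)
       = (\<integral>\<^sup>+\<omega>. (\<lambda>(t, x, S). \<Prod>n<N. ?g n x S (t n)) (\<lambda>n. H n \<omega>, \<lambda>n. X n \<omega>, \<lambda>j\<in>J. \<Phi> j \<omega>) \<partial>M)"
      by (simp add: eneg_sum c_def)
    also have "\<dots> = (\<integral>\<^sup>+\<omega>. (\<integral>\<^sup>+\<omega>'. (\<lambda>(t, x, S). \<Prod>n<N. ?g n x S (t n)) (\<lambda>n. H n \<omega>', \<lambda>n. X n \<omega>, \<lambda>j\<in>J. \<Phi> j \<omega>) \<partial>M) \<partial>M)"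
      by (rule nn_integral_decouple_marks) measurable
    also have "\<dots> = (\<integral>\<^sup>+\<omega>. (\<Prod>n<N. \<integral>\<^sup>+\<omega>'. ?g n (\<lambda>n. X n \<omega>) (\<lambda>j. \<Phi> j \<omega>) (H n \<omega>') \<partial>M) \<partial>M)"
    proof (intro nn_integral_cong)
      fix \<omega> assume "\<omega> \<in> space M"
      have "indep_vars (\<lambda>_. borel) (\<lambda>n \<omega>'. ?g n (\<lambda>n. X n \<omega>) (\<lambda>j. \<Phi> j \<omega>) (H n \<omega>')) {..<N}"
        by (rule indep_vars_compose2[OF indep_vars_subset[OF H_indep]]) measurable
      then have "(\<integral>\<^sup>+\<omega>'. (\<Prod>n<N. ?g n (\<lambda>n. X n \<omega>) (\<lambda>j. \<Phi> j \<omega>) (H n \<omega>')) \<partial>M)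
          = (\<Prod>n<N. \<integral>\<^sup>+\<omega>'. ?g n (\<lambda>n. X n \<omega>) (\<lambda>j. \<Phi> j \<omega>) (H n \<omega>') \<partial>M)"
        by (intro indep_vars_nn_integral) auto
      then show "(\<integral>\<^sup>+\<omega>'. (\<lambda>(t, x, S). \<Prod>n<N. ?g n x S (t n)) (\<lambda>n. H n \<omega>', \<lambda>n. X n \<omega>, \<lambda>j\<in>J. \<Phi> j \<omega>) \<partial>M)
          = (\<Prod>n<N. \<integral>\<^sup>+\<omega>'. ?g n (\<lambda>n. X n \<omega>) (\<lambda>j. \<Phi> j \<omega>) (H n \<omega>') \<partial>M)"
        by simp
    qed
    \<comment> \<open>Almost surely a location lies in at most one process. Otherwise the same mark
      would occur in several summands and the mean would not factor into the
      \<open>\<phi> j\<close>.\<close>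
    also have "\<dots> = (\<integral>\<^sup>+\<omega>. (\<Prod>n<N. eneg (c' n \<omega>)) \<partial>M)"
    proof (rule nn_integral_cong_AE, rule AE_mp[OF processes_disjoint], intro AE_I2 impI prod.cong refl)
      fix \<omega> n assume \<omega>: "\<omega> \<in> space M" "\<forall>i\<in>J. \<forall>j\<in>J. i \<noteq> j \<longrightarrow> (\<forall>n. \<not> (X n \<omega> \<in> \<Phi> i \<omega> \<and> X n \<omega> \<in> \<Phi> j \<omega>))"
      show "(\<integral>\<^sup>+\<omega>'. ?g n (\<lambda>n. X n \<omega>) (\<lambda>j. \<Phi> j \<omega>) (H n \<omega>') \<partial>M) = eneg (c' n \<omega>)"
      proof (cases "\<exists>j0\<in>J. X n \<omega> \<in> \<Phi> j0 \<omega>")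
        case True
        then obtain j0 where j0: "j0 \<in> J" "X n \<omega> \<in> \<Phi> j0 \<omega>" by blast
        have single: "(\<Sum>j\<in>J. G j * indicator (\<Phi> j \<omega>) (X n \<omega>)) = G j0" for G :: "'j \<Rightarrow> ennreal"
        proof -
          have "(\<Sum>j\<in>J. G j * indicator (\<Phi> j \<omega>) (X n \<omega>)) = (\<Sum>j\<in>J. if j = j0 then G j0 else 0)"
            using j0 \<omega>(2) by (intro sum.cong refl) (auto split: split_indicator)
          then show ?thesis using j0(1) finite_J by simp
        qed
        have "(\<integral>\<^sup>+\<omega>'. eneg (F j0 (X n \<omega>, H n \<omega>')) \<partial>M) = \<phi> j0 (X n \<omega>)"
          unfolding \<phi>_def by (rule distributed_nn_integral[OF H_distributed, symmetric]) measurable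
        then show ?thesis
          unfolding c'_def single by (simp add: eneg_lneg \<phi>1)
      next
        case False
        then have "(\<Sum>j\<in>J. G j * indicator (\<Phi> j \<omega>) (X n \<omega>)) = 0" for G :: "'j \<Rightarrow> ennreal"
          by (intro sum.neutral) auto
        then show ?thesis
          unfolding c'_def by (simp add: emeasure_space_1)
      qed
    qed
    also have "\<dots> = (\<integral>\<^sup>+\<omega>. eneg (\<Sum>n<N. c' n \<omega>) \<partial>M)"
      by (simp add: eneg_sum)
    finally show ?thesis .
  qed
  have lim: "(\<lambda>N. \<integral>\<^sup>+\<omega>. eneg (\<Sum>n<N. u n \<omega>) \<partial>M) \<longlonglongrightarrow> (\<integral>\<^sup>+\<omega>. eneg (\<Sum>n. u n \<omega>) \<partial>M)"
    if [measurable]: "\<And>n. u n \<in> borel_measurable M" for u :: "nat \<Rightarrow> 'w \<Rightarrow> ennreal"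
    unfolding suminf_eq_SUP
    by (rule tendsto_eneg_SUP_nn_integral) (auto intro!: incseq_SucI finite_measure_axioms)
  have "(\<integral>\<^sup>+\<omega>. eneg (marked_sum F \<omega>) \<partial>M) = (\<integral>\<^sup>+\<omega>. eneg (\<Sum>n. c n \<omega>) \<partial>M)"
    by (simp add: marked_sum_def c_def)
  also have "\<dots> = (\<integral>\<^sup>+\<omega>. eneg (\<Sum>n. c' n \<omega>) \<partial>M)"
    using lim[of c] lim[of c'] unfolding finite_terms by (auto intro: LIMSEQ_unique)
  also have "\<dots> = (\<integral>\<^sup>+\<omega>. (\<Prod>j\<in>J. eneg (points_sum (\<lambda>x. lneg (\<phi> j x)) (\<Phi> j \<omega>))) \<partial>M)"
  proof (intro nn_integral_cong)
    fix \<omega> assume \<omega>: "\<omega> \<in> space M"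
    have "(\<Sum>n. c' n \<omega>) = (\<Sum>j\<in>J. \<Sum>n. lneg (\<phi> j (X n \<omega>)) * indicator (\<Phi> j \<omega>) (X n \<omega>))"
      unfolding c'_def by (rule suminf_sum) simp
    also have "\<dots> = (\<Sum>j\<in>J. points_sum (\<lambda>x. lneg (\<phi> j x)) (\<Phi> j \<omega>))"
      by (intro sum.cong refl points_sum_enumeration[symmetric] X_inj X_cover \<omega>)
    finally show "eneg (\<Sum>n. c' n \<omega>) = (\<Prod>j\<in>J. eneg (points_sum (\<lambda>x. lneg (\<phi> j x)) (\<Phi> j \<omega>)))"
      by (simp add: eneg_sum)
  qed
  also have "\<dots> = (\<Prod>j\<in>J. \<integral>\<^sup>+\<omega>. eneg (points_sum (\<lambda>x. lneg (\<phi> j x)) (\<Phi> j \<omega>)) \<partial>M)"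
    by (intro indep_vars_nn_integral finite_J indep_vars_compose2[OF processes_indep]) auto
  also have "\<dots> = (\<Prod>j\<in>J. eneg (ennreal (d j) * (\<integral>\<^sup>+x. 1 - eneg (lneg (\<phi> j x)) \<partial>lborel)))"
    by (intro prod.cong refl ppp_laplace_functional ppp d_nonneg) auto
  finally show ?thesis
    by (simp add: eneg_lneg \<phi>1 \<phi>_diff)
qed

end

section \<open>Interference and Campbell formula\<close>

text \<open>The weights turn the transform of a law into that of a law restricted by an idle event
  or multiplied by a count of stations. The case \<open>s = 0\<close> of \<open>L\<close> makes the
  second total mass finite as well.\<close>

lemma laplace_determines_law:
  fixes Z :: "'a \<Rightarrow> real" and Z' :: "'b \<Rightarrow> real"
  assumes [measurable]: "W \<in> borel_measurable M" "Z \<in> borel_measurable M"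
    "W' \<in> borel_measurable N" "Z' \<in> borel_measurable N"
    and nn: "\<And>x. x \<in> space M \<Longrightarrow> Z x \<ge> 0" "\<And>x. x \<in> space N \<Longrightarrow> Z' x \<ge> 0"
    and fin: "(\<integral>\<^sup>+x. W x \<partial>M) < \<infinity>"
    and L: "\<And>s. s \<ge> 0 \<Longrightarrow> (\<integral>\<^sup>+x. W x * ennreal (exp (- (s * Z x))) \<partial>M) = (\<integral>\<^sup>+x. W' x * ennreal (exp (- (s * Z' x))) \<partial>N)"
  shows "(\<integral>\<^sup>+x. W x * indicator {..b} (Z x) \<partial>M) = (\<integral>\<^sup>+x. W' x * indicator {..b} (Z' x) \<partial>N)"
proof -
  define \<mu> where "\<mu> = distr (density M W) borel Z"
  define \<nu> where "\<nu> = distr (density N W') borel Z'"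
  have int_\<mu>: "(\<integral>\<^sup>+x. f x \<partial>\<mu>) = (\<integral>\<^sup>+x. W x * f (Z x) \<partial>M)" if [measurable]: "f \<in> borel_measurable borel" for f
    unfolding \<mu>_def by (simp add: nn_integral_distr nn_integral_density)
  have int_\<nu>: "(\<integral>\<^sup>+x. f x \<partial>\<nu>) = (\<integral>\<^sup>+x. W' x * f (Z' x) \<partial>N)" if [measurable]: "f \<in> borel_measurable borel" for f
    unfolding \<nu>_def by (simp add: nn_integral_distr nn_integral_density)
  have "emeasure \<mu> (space \<mu>) = (\<integral>\<^sup>+x. W x \<partial>M)" "emeasure \<nu> (space \<nu>) = (\<integral>\<^sup>+x. W' x \<partial>N)"
    using int_\<mu>[of "\<lambda>_. 1"] int_\<nu>[of "\<lambda>_. 1"] by auto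
  moreover have "(\<integral>\<^sup>+x. W' x \<partial>N) = (\<integral>\<^sup>+x. W x \<partial>M)"
    using L[of 0] by simp
  ultimately have "finite_measure \<mu>" "finite_measure \<nu>"
    using fin by (auto intro!: finite_measureI)
  moreover have "AE x in \<mu>. x \<ge> 0" "AE x in \<nu>. x \<ge> 0"
    unfolding \<mu>_def \<nu>_def using nn by (auto simp: AE_distr_iff AE_density)
  moreover have "(\<integral>\<^sup>+x. ennreal (exp (- (s * x))) \<partial>\<mu>) = (\<integral>\<^sup>+x. ennreal (exp (- (s * x))) \<partial>\<nu>)" if "s > 0" for s
    using L[of s] that by (simp add: int_\<mu> int_\<nu>)
  ultimately have "\<mu> = \<nu>"
    by (intro laplace_transform_unique) (simp_all add: \<mu>_def \<nu>_def)
  then show ?thesis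
    using int_\<mu>[of "indicator {..b}"] int_\<nu>[of "indicator {..b}"] by simp
qed

lemma one_minus_eneg: "z \<ge> 0 \<Longrightarrow> 1 - eneg (ennreal z) = ennreal (1 - exp (- z))"
  by (simp add: eneg_ennreal ennreal_minus flip: ennreal_1)

text \<open>A difference quotient at \<open>0\<close> along step sizes for which it is monotone, so that monotone
  convergence applies although the mean of the random variable in place of \<open>x\<close> is not yet known.\<close>

lemma dyadic_derivative:
  "incseq (\<lambda>k. ennreal (2 ^ k) * (1 - eneg (ennreal (1 / 2 ^ k) * x)))"
  "(SUP k. ennreal (2 ^ k) * (1 - eneg (ennreal (1 / 2 ^ k) * x))) = x"
proof -
  have form: "ennreal (2 ^ k) * (1 - eneg (ennreal (1 / 2 ^ k) * ennreal r)) = ennreal (2 ^ k * (1 - exp (- (r / 2 ^ k))))"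
    if "r \<ge> 0" for k :: nat and r
  proof -
    have "ennreal (1 / 2 ^ k) * ennreal r = ennreal (r / 2 ^ k)"
      using that by (simp flip: ennreal_mult)
    then show ?thesis
      using that by (simp add: eneg_ennreal ennreal_minus ennreal_mult flip: ennreal_1)
  qed
  have form_top: "ennreal (2 ^ k) * (1 - eneg (ennreal (1 / 2 ^ k) * \<top>)) = ennreal (2 ^ k)" for k :: nat
    by (simp add: ennreal_mult_top)
  show inc: "incseq (\<lambda>k. ennreal (2 ^ k) * (1 - eneg (ennreal (1 / 2 ^ k) * x)))"
  proof (cases x)
    case (real r)
    show ?thesis unfolding real(2)
    proof (rule incseq_SucI, unfold form[OF real(1)], rule ennreal_leI)
      fix k
      \<comment> \<open>Halving the step replaces \<open>y * y\<close> by \<open>y\<close>;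
        monotonicity is then \<open>(1 - y)\<^sup>2 \<ge> 0\<close>.\<close>
      define y where "y = exp (- (r / 2 ^ Suc k))"
      have "exp (- (r / 2 ^ k)) = y * y" by (simp add: y_def flip: exp_add)
      moreover have "y \<le> 1" using real(1) by (simp add: y_def)
      then have "1 - y * y \<le> 2 * (1 - y)"
        using zero_le_square[of "1 - y"] by (simp add: algebra_simps)
      ultimately have "2 ^ k * (1 - exp (- (r / 2 ^ k))) \<le> 2 ^ k * (2 * (1 - y))"
        by (intro mult_left_mono) auto
      then show "2 ^ k * (1 - exp (- (r / 2 ^ k))) \<le> 2 ^ Suc k * (1 - exp (- (r / 2 ^ Suc k)))"
        by (simp add: y_def)
    qed
  next
    case top
    show ?thesis unfolding top form_top by (rule incseq_SucI) (simp add: ennreal_leI)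
  qed
  have lim: "(\<lambda>k. ennreal (2 ^ k) * (1 - eneg (ennreal (1 / 2 ^ k) * x))) \<longlonglongrightarrow> x"
  proof (cases x)
    case (real r)
    have "(\<lambda>k. 2 ^ k * (1 - exp (- (r / 2 ^ k)))) \<longlonglongrightarrow> r" by real_asymp
    then show ?thesis using real by (simp add: form tendsto_ennrealI del: ennreal_mult)
  next
    case top
    have "filterlim (\<lambda>k. (2::real) ^ k) at_top sequentially" by real_asymp
    then have "(\<lambda>k. ennreal (2 ^ k)) \<longlonglongrightarrow> \<top>"
      by (simp add: ennreal_tendsto_top_eq_at_top[unfolded infinity_ennreal_def])
    then show ?thesis unfolding top form_top .
  qed
  show "(SUP k. ennreal (2 ^ k) * (1 - eneg (ennreal (1 / 2 ^ k) * x))) = x"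
    by (rule LIMSEQ_unique[OF LIMSEQ_SUP[OF inc] lim])
qed

text \<open>\<open>Ac\<close> collects the active processes and \<open>Bd\<close> the idle ones of the permitted tiers, with thresholds
  \<open>b\<close>. With \<open>I\<close> the total active power and \<open>T\<close> the largest power of an idle station in units of its
  threshold, no idle station covers the mobile if and only if \<open>T < I\<close>.\<close>

locale power_network = marked_network M J d \<Phi> X H
  for M :: "'w measure" and J :: "'j set" and d \<Phi> X H +
  fixes \<alpha> :: real and P :: "'j \<Rightarrow> real" and Ac Bd :: "'j set" and b :: "'j \<Rightarrow> real"
  assumes \<alpha>: "\<alpha> > 2" and P_pos: "\<And>j. j \<in> J \<Longrightarrow> P j > 0"
    and Ac: "Ac \<subseteq> J" and Bd: "Bd \<subseteq> J" and AcBd: "Ac \<inter> Bd = {}"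
    and b_pos: "\<And>j. j \<in> Bd \<Longrightarrow> b j > 0"
    and Ac_pos: "\<exists>j\<in>Ac. d j > 0"
begin

definition Y :: "'j \<Rightarrow> nat \<Rightarrow> 'w \<Rightarrow> real" where
  "Y j n \<omega> = P j * H n \<omega> * norm (X n \<omega>) powr (- \<alpha>)"

text \<open>The constant intensity of the received powers of process \<open>j\<close> in the area
  coordinate.\<close>

definition c :: "'j \<Rightarrow> real" where
  "c j = d j * (pi * P j powr (2 / \<alpha>) * Gamma (1 + 2 / \<alpha>))"

text \<open>The factor \<open>Gamma (1 - 2 / \<alpha>)\<close> is that of
  \<open>nn_integral_stable_exponent\<close>: the Laplace exponent of \<open>I\<close> is
  \<open>\<eta> * s powr (2 / \<alpha>)\<close>.\<close>

definition \<eta> :: real where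
  "\<eta> = (\<Sum>j\<in>Ac. c j) * Gamma (1 - 2 / \<alpha>)"

lemma Y_measurable [measurable]: "Y j n \<in> borel_measurable M"
  unfolding Y_def by measurable

lemma Gamma_pos: "Gamma (1 + 2 / \<alpha>) > 0" "Gamma (1 - 2 / \<alpha>) > 0"
  using \<alpha> by (auto intro!: Gamma_real_pos add_pos_pos)

lemma c_nonneg: "j \<in> J \<Longrightarrow> c j \<ge> 0"
  using d_nonneg Gamma_pos by (auto simp: c_def intro!: mult_nonneg_nonneg)

lemma finite_Ac: "finite Ac" and finite_Bd: "finite Bd"
  using finite_J Ac Bd by (auto intro: finite_subset)

lemma \<eta>_pos: "\<eta> > 0"
proof -
  obtain j where j: "j \<in> Ac" "d j > 0" using Ac_pos by blast
  then have "c j > 0" using Gamma_pos P_pos[of j] Ac by (auto simp: c_def)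
  then have "(\<Sum>j\<in>Ac. c j) > 0"
    using j Ac c_nonneg by (intro sum_pos2[OF finite_Ac]) auto
  then show ?thesis using Gamma_pos by (simp add: \<eta>_def)
qed

definition \<Sigma> :: "('j \<Rightarrow> real \<Rightarrow> ennreal) \<Rightarrow> 'w \<Rightarrow> ennreal" where
  "\<Sigma> f \<omega> = (\<Sum>n. \<Sum>j\<in>J. f j (Y j n \<omega>) * indicator (\<Phi> j \<omega>) (X n \<omega>))"

text \<open>Fading and geometry are integrated out: process \<open>j\<close> behaves like a Poisson
  process of rate \<open>c j\<close> on the half-line, whose point \<open>u\<close> stands for a
  station of power \<open>u powr (- \<alpha> / 2)\<close>.\<close>

lemma power_laplace_functional:
  assumes f [measurable]: "\<And>j. f j \<in> borel_measurable borel" and f0: "\<And>j y. y \<le> 0 \<Longrightarrow> f j y = 0"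
  shows "(\<integral>\<^sup>+\<omega>. eneg (\<Sigma> f \<omega>) \<partial>M) =
    eneg (\<Sum>j\<in>J. ennreal (c j) * (\<integral>\<^sup>+u\<in>{0<..}. 1 - eneg (f j (u powr (- \<alpha> / 2))) \<partial>lborel))"
proof -
  let ?F = "\<lambda>j (x :: real^2, t). f j (P j * t * norm x powr (- \<alpha>))"
  have "(\<integral>\<^sup>+\<omega>. eneg (\<Sigma> f \<omega>) \<partial>M) = (\<integral>\<^sup>+\<omega>. eneg (marked_sum ?F \<omega>) \<partial>M)"
    by (simp add: \<Sigma>_def marked_sum_def Y_def)
  also have "\<dots> = (\<Prod>j\<in>J. eneg (ennreal (d j) * (\<integral>\<^sup>+x. (\<integral>\<^sup>+t. ennreal (exponential_density 1 t) * (1 - eneg (?F j (x, t))) \<partial>lborel) \<partial>lborel)))"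
  proof (rule marked_laplace_functional)
    show "?F j \<in> borel_measurable borel" for j
      unfolding borel_prod[symmetric] by measurable
  qed
  also have "\<dots> = (\<Prod>j\<in>J. eneg (ennreal (c j) * (\<integral>\<^sup>+u\<in>{0<..}. 1 - eneg (f j (u powr (- \<alpha> / 2))) \<partial>lborel)))"
  proof (intro prod.cong refl arg_cong[where f = eneg])
    fix j assume j: "j \<in> J"
    have "(\<integral>\<^sup>+(x::real^2). (\<integral>\<^sup>+t. ennreal (exponential_density 1 t) * (1 - eneg (?F j (x, t))) \<partial>lborel) \<partial>lborel)
      = ennreal (pi * P j powr (2 / \<alpha>) * Gamma (1 + 2 / \<alpha>)) * (\<integral>\<^sup>+u\<in>{0<..}. 1 - eneg (f j (u powr (- \<alpha> / 2))) \<partial>lborel)"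
      using received_power_intensity[of "\<lambda>y. 1 - eneg (f j y)" \<alpha> "P j"] \<alpha> P_pos[OF j] by (simp add: f0)
    then show "ennreal (d j) * (\<integral>\<^sup>+(x::real^2). (\<integral>\<^sup>+t. ennreal (exponential_density 1 t) * (1 - eneg (?F j (x, t))) \<partial>lborel) \<partial>lborel)
      = ennreal (c j) * (\<integral>\<^sup>+u\<in>{0<..}. 1 - eneg (f j (u powr (- \<alpha> / 2))) \<partial>lborel)"
      using d_nonneg[OF j] Gamma_pos by (simp add: c_def ennreal_mult mult.assoc)
  qed
  finally show ?thesis by (simp add: eneg_sum)
qed

definition I :: "'w \<Rightarrow> ennreal" where
  "I \<omega> = (\<Sum>n. \<Sum>j\<in>Ac. ennreal (Y j n \<omega>) * indicator (\<Phi> j \<omega>) (X n \<omega>))"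

definition T :: "'w \<Rightarrow> ennreal" where
  "T \<omega> = (SUP n. SUP j\<in>Bd. ennreal (Y j n \<omega> / b j) * indicator (\<Phi> j \<omega>) (X n \<omega>))"

text \<open>Counts the stations whose area coordinate is at most \<open>a\<close>, a number of
  finite mean. Positivity of \<open>y\<close> has to be required because \<open>0 powr\<close>
  anything is \<open>0\<close>.\<close>

definition count :: "'j \<Rightarrow> real \<Rightarrow> 'w \<Rightarrow> ennreal" where
  "count i a \<omega> = (\<Sum>n. indicator {y. 0 < y \<and> y powr (- 2 / \<alpha>) \<le> a} (Y i n \<omega>) * indicator (\<Phi> i \<omega>) (X n \<omega>))"

definition idle_below :: "real \<Rightarrow> 'w \<Rightarrow> bool" where
  "idle_below t \<omega> \<longleftrightarrow> (\<forall>n. \<forall>j\<in>Bd. X n \<omega> \<in> \<Phi> j \<omega> \<longrightarrow> Y j n \<omega> \<le> b j * t)"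

text \<open>A void probability: the exponent is the mean number of idle stations with power above
  the threshold \<open>b j * t\<close>.\<close>

definition idle_prob :: "real \<Rightarrow> ennreal" where
  "idle_prob t = eneg (\<Sum>j\<in>Bd. ennreal (c j) * (\<integral>\<^sup>+u\<in>{0<..}. indicator {b j * t<..} (u powr (- \<alpha> / 2)) \<partial>lborel))"

text \<open>The mean of the count, each station weighted with its own share
  \<open>exp (- (s * y))\<close> of \<open>exp (- (s * I))\<close>.\<close>

definition Q :: "'j \<Rightarrow> real \<Rightarrow> real \<Rightarrow> ennreal" where
  "Q i s a = ennreal (c i) * (\<integral>\<^sup>+u\<in>{0<..a}. ennreal (exp (- (s * u powr (- \<alpha> / 2)))) \<partial>lborel)"

lemma I_measurable [measurable]: "I \<in> borel_measurable M"
proof -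
  have [measurable]: "\<Phi> j \<in> measurable M point_configs" if "j \<in> Ac" for j using that Ac by auto
  show ?thesis unfolding I_def[abs_def] by measurable
qed

lemma T_measurable [measurable]: "T \<in> borel_measurable M"
proof -
  have [measurable]: "\<Phi> j \<in> measurable M point_configs" if "j \<in> Bd" for j using that Bd by auto
  have [measurable]: "countable Bd" using finite_Bd by (rule countable_finite)
  show ?thesis unfolding T_def[abs_def] by measurable
qed

lemma count_measurable [measurable]: "i \<in> J \<Longrightarrow> count i a \<in> borel_measurable M"
  unfolding count_def by measurable

lemma idle_below_measurable [measurable]: "Measurable.pred M (idle_below t)"
proof -
  have [measurable]: "Measurable.pred M (\<lambda>\<omega>. X n \<omega> \<in> \<Phi> j \<omega> \<longrightarrow> Y j n \<omega> \<le> b j * t)" if "j \<in> Bd" for n j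
    using that Bd by (intro pred_intros_logic measurable_mem_points) auto
  show ?thesis unfolding idle_below_def[abs_def] using finite_Bd
    by (intro pred_intros_countable(1) pred_intros_finite) auto
qed

lemma powr_area_le_iff:
  assumes "u > 0"
  shows "(u powr (- \<alpha> / 2)) powr (- 2 / \<alpha>) = u"
  using assms \<alpha> by (simp add: powr_powr)

text \<open>One test function does three jobs: \<open>s * y\<close> on the active processes, an
  extra \<open>e\<close> on the stations counted for \<open>i\<close>, and weight
  \<open>\<top>\<close> on idle stations above their threshold. The last makes \<open>eneg\<close>
  vanish off the idle event. The product on the right encodes the independence of the active powers
  and the idle event.\<close>

lemma joint_laplace:
  assumes i: "i \<in> Ac" and "s \<ge> 0" "e \<ge> 0" "t \<ge> 0"
  shows "(\<integral>\<^sup>+\<omega>. eneg (ennreal s * I \<omega> + ennreal e * count i a \<omega>) * indicator {\<omega>. idle_below t \<omega>} \<omega> \<partial>M)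
    = ennreal (exp (- (\<eta> * s powr (2 / \<alpha>)))) * idle_prob t * eneg ((1 - eneg (ennreal e)) * Q i s a)"
proof -
  let ?U = "{y. 0 < y \<and> y powr (- 2 / \<alpha>) \<le> a}"
  define f1 where "f1 j y = (if j \<in> Ac then ennreal s * ennreal y else 0)" for j y
  define f2 where "f2 j y = (if j = i then ennreal e * indicator ?U y else 0)" for j and y :: real
  define f3 where "f3 j y = (if j \<in> Bd then \<top> * indicator {b j * t<..} y else 0 :: ennreal)" for j y
  define f where "f j y = f1 j y + f2 j y + f3 j y" for j y
  have meas [measurable]: "f1 j \<in> borel_measurable borel" "f2 j \<in> borel_measurable borel" "f3 j \<in> borel_measurable borel" for j
    unfolding f1_def f2_def f3_def by measurable
  have f0: "f j y = 0" if "y \<le> 0" for j y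
  proof -
    have "y \<le> b j * t" if "j \<in> Bd"
    proof -
      have "0 \<le> b j * t" using b_pos[OF that] \<open>t \<ge> 0\<close> by auto
      then show ?thesis using \<open>y \<le> 0\<close> by linarith
    qed
    then show ?thesis using that by (auto simp: f_def f1_def f2_def f3_def ennreal_neg)
  qed
  have iJ: "i \<in> J" "i \<notin> Bd" using i Ac AcBd by auto
  have sigma_f: "\<Sigma> f \<omega> = ennreal s * I \<omega> + ennreal e * count i a \<omega> + \<Sigma> f3 \<omega>" for \<omega>
  proof -
    have "\<Sigma> f \<omega> = \<Sigma> f1 \<omega> + \<Sigma> f2 \<omega> + \<Sigma> f3 \<omega>"
      unfolding \<Sigma>_def f_def by (simp add: distrib_right sum.distrib suminf_add[symmetric])
    moreover have "\<Sigma> f1 \<omega> = ennreal s * I \<omega>"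
    proof -
      have "(\<Sum>j\<in>J. f1 j (Y j n \<omega>) * indicator (\<Phi> j \<omega>) (X n \<omega>)) = ennreal s * (\<Sum>j\<in>Ac. ennreal (Y j n \<omega>) * indicator (\<Phi> j \<omega>) (X n \<omega>))" for n
        unfolding sum_distrib_left using Ac finite_J by (intro sum.mono_neutral_cong_right) (auto simp: f1_def mult.assoc)
      then show ?thesis unfolding \<Sigma>_def I_def by simp
    qed
    moreover have "\<Sigma> f2 \<omega> = ennreal e * count i a \<omega>"
    proof -
      have "(\<Sum>j\<in>J. f2 j (Y j n \<omega>) * indicator (\<Phi> j \<omega>) (X n \<omega>))
         = (\<Sum>j\<in>J. if j = i then ennreal e * (indicator ?U (Y i n \<omega>) * indicator (\<Phi> i \<omega>) (X n \<omega>)) else 0)" for n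
        by (intro sum.cong refl) (auto simp: f2_def mult.assoc)
      then have "(\<Sum>j\<in>J. f2 j (Y j n \<omega>) * indicator (\<Phi> j \<omega>) (X n \<omega>)) = ennreal e * (indicator ?U (Y i n \<omega>) * indicator (\<Phi> i \<omega>) (X n \<omega>))" for n
        using iJ finite_J by simp
      then show ?thesis unfolding \<Sigma>_def count_def by simp
    qed
    ultimately show ?thesis by simp
  qed
  have idle: "eneg (\<Sigma> f3 \<omega>) = indicator {\<omega>. idle_below t \<omega>} \<omega>" for \<omega>
  proof (cases "idle_below t \<omega>")
    case True
    then have "f3 j (Y j n \<omega>) * indicator (\<Phi> j \<omega>) (X n \<omega>) = 0" for j n
      by (auto simp: f3_def idle_below_def not_less[symmetric] split: split_indicator)
    then have "(\<Sum>j\<in>J. f3 j (Y j n \<omega>) * indicator (\<Phi> j \<omega>) (X n \<omega>)) = 0" for n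
      by (intro sum.neutral ballI)
    then show ?thesis using True by (simp add: \<Sigma>_def)
  next
    case False
    then obtain n j where nj: "j \<in> Bd" "X n \<omega> \<in> \<Phi> j \<omega>" "b j * t < Y j n \<omega>"
      by (auto simp: idle_below_def not_le)
    then have "\<top> = f3 j (Y j n \<omega>) * indicator (\<Phi> j \<omega>) (X n \<omega>)" by (simp add: f3_def)
    also have "\<dots> \<le> (\<Sum>j\<in>J. f3 j (Y j n \<omega>) * indicator (\<Phi> j \<omega>) (X n \<omega>))"
      using nj(1) Bd finite_J by (intro member_le_sum) auto
    also have "\<dots> \<le> \<Sigma> f3 \<omega>"
      unfolding \<Sigma>_def using sum_le_suminf[of "\<lambda>n. \<Sum>j\<in>J. f3 j (Y j n \<omega>) * indicator (\<Phi> j \<omega>) (X n \<omega>)" "{n}"] by simp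
    finally have "\<Sigma> f3 \<omega> = \<top>" by (simp add: top_unique)
    then show ?thesis using False by simp
  qed
  let ?y = "\<lambda>u. u powr (- \<alpha> / 2)"
  have terms: "ennreal (c j) * (\<integral>\<^sup>+u\<in>{0<..}. 1 - eneg (f j (?y u)) \<partial>lborel)
    = (if j \<in> Ac then ennreal (c j * (s powr (2 / \<alpha>) * Gamma (1 - 2 / \<alpha>))) else 0)
    + (if j = i then (1 - eneg (ennreal e)) * Q i s a else 0)
    + (if j \<in> Bd then ennreal (c j) * (\<integral>\<^sup>+u\<in>{0<..}. indicator {b j * t<..} (?y u) \<partial>lborel) else 0)" if j: "j \<in> J" for j
  proof -
    have ptw: "(1 - eneg (f j (?y u))) * indicator {0<..} u
      = (if j \<in> Ac then ennreal (1 - exp (- (s * ?y u))) * indicator {0<..} u else 0)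
      + ((if j = i then (1 - eneg (ennreal e)) * (ennreal (exp (- (s * ?y u))) * indicator {0<..a} u) else 0)
      + (if j \<in> Bd then indicator {b j * t<..} (?y u) * indicator {0<..} u else 0))" for u
    proof (cases "u > 0")
      case True
      have e1: "eneg (ennreal s * ennreal (?y u)) = ennreal (exp (- (s * ?y u)))"
        using \<open>s \<ge> 0\<close> by (simp add: eneg_ennreal flip: ennreal_mult)
      have U: "indicator ?U (?y u) = (indicator {0<..a} u :: ennreal)"
        using True powr_area_le_iff[OF True] by (auto split: split_indicator)
      have m1: "1 - ennreal (exp (- (s * ?y u))) = ennreal (1 - exp (- (s * ?y u)))"
        by (simp add: ennreal_minus flip: ennreal_1)
      consider "j \<in> Ac" "j \<noteq> i" "j \<notin> Bd" | "j = i" | "j \<notin> Ac" "j \<in> Bd" "j \<noteq> i" | "j \<notin> Ac" "j \<notin> Bd" "j \<noteq> i"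
        using AcBd i by auto
      then show ?thesis
      proof cases
        case 1
        then have "f j (?y u) = ennreal s * ennreal (?y u)"
          by (simp add: f_def f1_def f2_def f3_def)
        then show ?thesis using 1 True by (simp only: e1 m1) simp
      next
        case 2
        have fe: "f j (?y u) = ennreal s * ennreal (?y u) + ennreal e * indicator ?U (?y u)"
          using 2 iJ i by (simp add: f_def f1_def f2_def f3_def)
        show ?thesis
        proof (cases "u \<le> a")
          case ua: True
          \<comment> \<open>For a counted station \<open>1 - p * q = (1 - p) + (1 - q) * p\<close>
            separates the exponent of \<open>I\<close> from the Campbell term
            \<open>Q\<close>.\<close>
          have "1 - ennreal (exp (- (s * ?y u))) * eneg (ennreal e)
             = ennreal (1 - exp (- (s * ?y u))) + (1 - eneg (ennreal e)) * ennreal (exp (- (s * ?y u)))"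
          proof -
            have "1 - ennreal (exp (- (s * ?y u))) * eneg (ennreal e) = ennreal (1 - exp (- (s * ?y u)) * exp (- e))"
              using \<open>e \<ge> 0\<close> by (simp add: eneg_ennreal ennreal_minus flip: ennreal_mult ennreal_1)
            also have "1 - exp (- (s * ?y u)) * exp (- e) = (1 - exp (- (s * ?y u))) + (1 - exp (- e)) * exp (- (s * ?y u))"
              by (simp add: algebra_simps)
            also have "ennreal \<dots> = ennreal (1 - exp (- (s * ?y u))) + ennreal ((1 - exp (- e)) * exp (- (s * ?y u)))"
              using \<open>e \<ge> 0\<close> \<open>s \<ge> 0\<close> by (intro ennreal_plus) auto
            also have "ennreal ((1 - exp (- e)) * exp (- (s * ?y u))) = (1 - eneg (ennreal e)) * ennreal (exp (- (s * ?y u)))"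
              using \<open>e \<ge> 0\<close> by (simp add: eneg_ennreal ennreal_minus ennreal_mult flip: ennreal_1)
            finally show ?thesis .
          qed
          then show ?thesis unfolding fe U eneg_add e1 using 2 True ua iJ i by simp
        next
          case False
          then show ?thesis unfolding fe U eneg_add e1 using 2 True iJ i m1 by simp
        qed
      next
        case 3
        then show ?thesis using True by (auto simp: f_def f1_def f2_def f3_def split: split_indicator)
      next
        case 4
        then show ?thesis by (simp add: f_def f1_def f2_def f3_def)
      qed
    qed simp
    \<comment> \<open>\<open>nn_integral_stable_exponent\<close> needs \<open>s > 0\<close>; at
      \<open>s = 0\<close> both sides vanish.\<close>
    have I1: "(\<integral>\<^sup>+u. (if j \<in> Ac then ennreal (1 - exp (- (s * ?y u))) * indicator {0<..} u else 0) \<partial>lborel)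
        = (if j \<in> Ac then ennreal (s powr (2 / \<alpha>) * Gamma (1 - 2 / \<alpha>)) else 0)"
      using nn_integral_stable_exponent[OF \<alpha>, of s] \<open>s \<ge> 0\<close> by (cases "s = 0") auto
    have I2: "(\<integral>\<^sup>+u. (if j = i then (1 - eneg (ennreal e)) * (ennreal (exp (- (s * ?y u))) * indicator {0<..a} u) else 0) \<partial>lborel)
        = (if j = i then (1 - eneg (ennreal e)) * (\<integral>\<^sup>+u\<in>{0<..a}. ennreal (exp (- (s * ?y u))) \<partial>lborel) else 0)"
      by (auto simp: nn_integral_cmult)
    have I3: "(\<integral>\<^sup>+u. (if j \<in> Bd then indicator {b j * t<..} (?y u) * indicator {0<..} u else 0) \<partial>lborel)
        = (if j \<in> Bd then (\<integral>\<^sup>+u\<in>{0<..}. indicator {b j * t<..} (?y u) \<partial>lborel) else 0)"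
      by auto
    have "(\<integral>\<^sup>+u\<in>{0<..}. 1 - eneg (f j (?y u)) \<partial>lborel)
       = (if j \<in> Ac then ennreal (s powr (2 / \<alpha>) * Gamma (1 - 2 / \<alpha>)) else 0)
       + ((if j = i then (1 - eneg (ennreal e)) * (\<integral>\<^sup>+u\<in>{0<..a}. ennreal (exp (- (s * ?y u))) \<partial>lborel) else 0)
       + (if j \<in> Bd then (\<integral>\<^sup>+u\<in>{0<..}. indicator {b j * t<..} (?y u) \<partial>lborel) else 0))"
      unfolding ptw I1[symmetric] I2[symmetric] I3[symmetric]
      by (subst nn_integral_add, measurable, subst nn_integral_add, measurable)
    then have "ennreal (c j) * (\<integral>\<^sup>+u\<in>{0<..}. 1 - eneg (f j (?y u)) \<partial>lborel)
       = ennreal (c j) * (if j \<in> Ac then ennreal (s powr (2 / \<alpha>) * Gamma (1 - 2 / \<alpha>)) else 0)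
       + (ennreal (c j) * (if j = i then (1 - eneg (ennreal e)) * (\<integral>\<^sup>+u\<in>{0<..a}. ennreal (exp (- (s * ?y u))) \<partial>lborel) else 0)
       + ennreal (c j) * (if j \<in> Bd then (\<integral>\<^sup>+u\<in>{0<..}. indicator {b j * t<..} (?y u) \<partial>lborel) else 0))"
      by (simp only: distrib_left)
    also have "ennreal (c j) * (if j \<in> Ac then ennreal (s powr (2 / \<alpha>) * Gamma (1 - 2 / \<alpha>)) else 0)
       = (if j \<in> Ac then ennreal (c j * (s powr (2 / \<alpha>) * Gamma (1 - 2 / \<alpha>))) else 0)"
      using ennreal_mult'[OF c_nonneg[OF j]] by simp
    also have "ennreal (c j) * (if j = i then (1 - eneg (ennreal e)) * (\<integral>\<^sup>+u\<in>{0<..a}. ennreal (exp (- (s * ?y u))) \<partial>lborel) else 0)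
       = (if j = i then (1 - eneg (ennreal e)) * Q i s a else 0)"
      by (simp add: Q_def mult.left_commute)
    also have "ennreal (c j) * (if j \<in> Bd then (\<integral>\<^sup>+u\<in>{0<..}. indicator {b j * t<..} (?y u) \<partial>lborel) else 0)
       = (if j \<in> Bd then ennreal (c j) * (\<integral>\<^sup>+u\<in>{0<..}. indicator {b j * t<..} (?y u) \<partial>lborel) else 0)"
      by simp
    finally show ?thesis by (simp only: add.assoc)
  qed
  have "(\<integral>\<^sup>+\<omega>. eneg (ennreal s * I \<omega> + ennreal e * count i a \<omega>) * indicator {\<omega>. idle_below t \<omega>} \<omega> \<partial>M)
    = (\<integral>\<^sup>+\<omega>. eneg (\<Sigma> f \<omega>) \<partial>M)"
    by (simp add: sigma_f eneg_add[of _ "\<Sigma> f3 _"] idle)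
  also have "\<dots> = eneg (\<Sum>j\<in>J. ennreal (c j) * (\<integral>\<^sup>+u\<in>{0<..}. 1 - eneg (f j (?y u)) \<partial>lborel))"
  proof (rule power_laplace_functional)
    show "f j \<in> borel_measurable borel" for j
      unfolding f_def[abs_def] by measurable
  qed (rule f0)
  also have "(\<Sum>j\<in>J. ennreal (c j) * (\<integral>\<^sup>+u\<in>{0<..}. 1 - eneg (f j (?y u)) \<partial>lborel))
     = (\<Sum>j\<in>J. if j \<in> Ac then ennreal (c j * (s powr (2 / \<alpha>) * Gamma (1 - 2 / \<alpha>))) else 0)
     + (1 - eneg (ennreal e)) * Q i s a
     + (\<Sum>j\<in>J. if j \<in> Bd then ennreal (c j) * (\<integral>\<^sup>+u\<in>{0<..}. indicator {b j * t<..} (?y u) \<partial>lborel) else 0)"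
    using terms iJ finite_J by (simp add: sum.distrib)
  also have "(\<Sum>j\<in>J. if j \<in> Ac then ennreal (c j * (s powr (2 / \<alpha>) * Gamma (1 - 2 / \<alpha>))) else 0) = ennreal (\<eta> * s powr (2 / \<alpha>))"
  proof -
    have "(\<Sum>j\<in>J. if j \<in> Ac then ennreal (c j * (s powr (2 / \<alpha>) * Gamma (1 - 2 / \<alpha>))) else 0)
       = (\<Sum>j\<in>Ac. ennreal (c j * (s powr (2 / \<alpha>) * Gamma (1 - 2 / \<alpha>))))"
      using Ac finite_J by (intro sum.mono_neutral_cong_right) auto
    also have "\<dots> = ennreal (\<Sum>j\<in>Ac. c j * (s powr (2 / \<alpha>) * Gamma (1 - 2 / \<alpha>)))"
      using Ac c_nonneg Gamma_pos by (intro sum_ennreal) (auto intro!: mult_nonneg_nonneg)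
    also have "(\<Sum>j\<in>Ac. c j * (s powr (2 / \<alpha>) * Gamma (1 - 2 / \<alpha>))) = \<eta> * s powr (2 / \<alpha>)"
      unfolding \<eta>_def sum_distrib_right by (intro sum.cong) auto
    finally show ?thesis .
  qed
  also have "(\<Sum>j\<in>J. if j \<in> Bd then ennreal (c j) * (\<integral>\<^sup>+u\<in>{0<..}. indicator {b j * t<..} (?y u) \<partial>lborel) else 0)
     = (\<Sum>j\<in>Bd. ennreal (c j) * (\<integral>\<^sup>+u\<in>{0<..}. indicator {b j * t<..} (?y u) \<partial>lborel))"
    using Bd finite_J by (intro sum.mono_neutral_cong_right) auto
  finally show ?thesis
    using \<eta>_pos by (simp add: eneg_add eneg_ennreal idle_prob_def mult_ac)
qed

lemma Q_finite: "Q i s a < \<top>" if "s \<ge> 0"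
proof -
  have "(\<integral>\<^sup>+u\<in>{0<..a}. ennreal (exp (- (s * u powr (- \<alpha> / 2)))) \<partial>lborel) \<le> (\<integral>\<^sup>+u. indicator {0<..a} u \<partial>lborel)"
    using that by (intro nn_integral_mono) (auto split: split_indicator)
  also have "\<dots> < \<top>" by (cases "0 \<le> a") auto
  finally show ?thesis by (simp add: Q_def ennreal_mult_less_top)
qed

lemma laplace_I: "s \<ge> 0 \<Longrightarrow> t \<ge> 0 \<Longrightarrow>
  (\<integral>\<^sup>+\<omega>. eneg (ennreal s * I \<omega>) * indicator {\<omega>. idle_below t \<omega>} \<omega> \<partial>M) = ennreal (exp (- (\<eta> * s powr (2 / \<alpha>)))) * idle_prob t"
  using Ac_pos joint_laplace[of _ s 0 t] by auto

text \<open>The right derivative at \<open>e = 0\<close> of \<open>joint_laplace\<close>: on the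
  left the factor \<open>eneg (e * count)\<close> contributes the count, on the right the exponent
  contributes \<open>Q\<close>.\<close>

lemma campbell_laplace:
  assumes i: "i \<in> Ac" and "s \<ge> 0" "t \<ge> 0"
  shows "(\<integral>\<^sup>+\<omega>. count i a \<omega> * eneg (ennreal s * I \<omega>) * indicator {\<omega>. idle_below t \<omega>} \<omega> \<partial>M)
    = ennreal (exp (- (\<eta> * s powr (2 / \<alpha>)))) * idle_prob t * Q i s a"
proof -
  have [measurable]: "count i a \<in> borel_measurable M" using i Ac by auto
  let ?W = "\<lambda>\<omega>. eneg (ennreal s * I \<omega>) * indicator {\<omega>. idle_below t \<omega>} \<omega>"
  let ?C = "ennreal (exp (- (\<eta> * s powr (2 / \<alpha>)))) * idle_prob t"
  let ?e = "\<lambda>k::nat. ennreal (1 / 2 ^ k)"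
  have ideal: "(\<integral>\<^sup>+\<omega>. ?W \<omega> * (ennreal (2 ^ k) * (1 - eneg (?e k * count i a \<omega>))) \<partial>M)
     = ?C * (ennreal (2 ^ k) * (1 - eneg ((1 - eneg (?e k)) * Q i s a)))" for k
  proof -
    have le: "?W \<omega> * eneg (?e k * count i a \<omega>) \<le> ?W \<omega>" for \<omega>
      using mult_left_mono[OF eneg_le_1] by (metis mult.right_neutral zero_le)
    have C_fin: "(\<integral>\<^sup>+\<omega>. ?W \<omega> * eneg (?e k * count i a \<omega>) \<partial>M) \<noteq> \<infinity>"
    proof -
      have "(\<integral>\<^sup>+\<omega>. ?W \<omega> * eneg (?e k * count i a \<omega>) \<partial>M) \<le> (\<integral>\<^sup>+\<omega>. 1 \<partial>M)"
        by (intro nn_integral_mono order.trans[OF le]) (auto split: split_indicator intro: eneg_le_1)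
      then show ?thesis by (auto simp: emeasure_space_1 top_unique)
    qed
    have "(\<integral>\<^sup>+\<omega>. ?W \<omega> * (ennreal (2 ^ k) * (1 - eneg (?e k * count i a \<omega>))) \<partial>M)
      = (\<integral>\<^sup>+\<omega>. ennreal (2 ^ k) * (?W \<omega> - ?W \<omega> * eneg (?e k * count i a \<omega>)) \<partial>M)"
    proof (intro nn_integral_cong)
      fix \<omega>
      have "?W \<omega> - ?W \<omega> * eneg (?e k * count i a \<omega>) = ?W \<omega> * (1 - eneg (?e k * count i a \<omega>))"
        using ennreal_right_diff_distrib[of "?W \<omega>" 1 "eneg (?e k * count i a \<omega>)"] eneg_less_top[of "ennreal s * I \<omega>"]
        by (auto split: split_indicator)
      then show "?W \<omega> * (ennreal (2 ^ k) * (1 - eneg (?e k * count i a \<omega>))) = ennreal (2 ^ k) * (?W \<omega> - ?W \<omega> * eneg (?e k * count i a \<omega>))"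
        by (simp add: mult.left_commute)
    qed
    also have "\<dots> = ennreal (2 ^ k) * (\<integral>\<^sup>+\<omega>. ?W \<omega> - ?W \<omega> * eneg (?e k * count i a \<omega>) \<partial>M)"
      by (rule nn_integral_cmult) measurable
    also have "(\<integral>\<^sup>+\<omega>. ?W \<omega> - ?W \<omega> * eneg (?e k * count i a \<omega>) \<partial>M) = (\<integral>\<^sup>+\<omega>. ?W \<omega> \<partial>M) - (\<integral>\<^sup>+\<omega>. ?W \<omega> * eneg (?e k * count i a \<omega>) \<partial>M)"
      using le by (intro nn_integral_diff C_fin) auto
    also have "(\<integral>\<^sup>+\<omega>. ?W \<omega> \<partial>M) = ?C" using assms by (intro laplace_I)
    also have "(\<integral>\<^sup>+\<omega>. ?W \<omega> * eneg (?e k * count i a \<omega>) \<partial>M) = ?C * eneg ((1 - eneg (?e k)) * Q i s a)"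
      using joint_laplace[OF i \<open>s \<ge> 0\<close> _ \<open>t \<ge> 0\<close>, of "1 / 2 ^ k" a] by (simp add: eneg_add mult_ac)
    also have "?C - ?C * eneg ((1 - eneg (?e k)) * Q i s a) = ?C * (1 - eneg ((1 - eneg (?e k)) * Q i s a))"
      using ennreal_right_diff_distrib[of ?C 1 "eneg ((1 - eneg (?e k)) * Q i s a)"]
      by (simp add: idle_prob_def ennreal_mult_eq_top_iff less_imp_neq[OF eneg_less_top])
    finally show ?thesis by (simp add: mult.left_commute)
  qed
  have "(\<integral>\<^sup>+\<omega>. count i a \<omega> * eneg (ennreal s * I \<omega>) * indicator {\<omega>. idle_below t \<omega>} \<omega> \<partial>M)
     = (\<integral>\<^sup>+\<omega>. (SUP k. ?W \<omega> * (ennreal (2 ^ k) * (1 - eneg (?e k * count i a \<omega>)))) \<partial>M)"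
    by (intro nn_integral_cong, subst SUP_mult_left_ennreal[symmetric], subst dyadic_derivative(2)) (simp add: mult_ac)
  also have "\<dots> = (SUP k. \<integral>\<^sup>+\<omega>. ?W \<omega> * (ennreal (2 ^ k) * (1 - eneg (?e k * count i a \<omega>))) \<partial>M)"
  proof (rule nn_integral_monotone_convergence_SUP)
    show "incseq (\<lambda>k \<omega>. ?W \<omega> * (ennreal (2 ^ k) * (1 - eneg (?e k * count i a \<omega>))))"
      unfolding incseq_def le_fun_def using dyadic_derivative(1)
      by (intro allI impI mult_left_mono) (auto simp: incseq_def)
  qed measurable
  also have "\<dots> = ?C * (SUP k. ennreal (2 ^ k) * (1 - eneg ((1 - eneg (?e k)) * Q i s a)))"
    by (simp add: ideal SUP_mult_left_ennreal)
  \<comment> \<open>Here the exponent depends on \<open>e\<close> through \<open>1 - eneg e\<close>,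
    so \<open>dyadic_derivative\<close> bounds the supremum only from above, by
    \<open>1 - exp (- e) \<le> e\<close>; the limit supplies the other direction.\<close>
  also have "(SUP k. ennreal (2 ^ k) * (1 - eneg ((1 - eneg (?e k)) * Q i s a))) = Q i s a"
  proof -
    obtain r where r: "r \<ge> 0" "Q i s a = ennreal r" using Q_finite[OF \<open>s \<ge> 0\<close>, of i a] by (cases "Q i s a") auto
    have form: "ennreal (2 ^ k) * (1 - eneg ((1 - eneg (?e k)) * Q i s a)) = ennreal (2 ^ k * (1 - exp (- ((1 - exp (- (1 / 2 ^ k))) * r))))" for k :: nat
    proof -
      have "(1 - eneg (?e k)) * ennreal r = ennreal ((1 - exp (- (1 / 2 ^ k))) * r)"
        using r by (simp add: eneg_ennreal ennreal_minus ennreal_mult flip: ennreal_1)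
      moreover have z: "(1 - exp (- (1 / 2 ^ k))) * r \<ge> 0" using r by (intro mult_nonneg_nonneg) auto
      ultimately have "1 - eneg ((1 - eneg (?e k)) * Q i s a) = ennreal (1 - exp (- ((1 - exp (- (1 / 2 ^ k))) * r)))"
        by (simp only: r(2) one_minus_eneg[OF z])
      moreover have "ennreal (2 ^ k) * ennreal (1 - exp (- ((1 - exp (- (1 / 2 ^ k))) * r))) = ennreal (2 ^ k * (1 - exp (- ((1 - exp (- (1 / 2 ^ k))) * r))))"
        using z by (intro ennreal_mult[symmetric]) auto
      ultimately show ?thesis by simp
    qed
    have "(\<lambda>k. 2 ^ k * (1 - exp (- ((1 - exp (- (1 / 2 ^ k))) * r)))) \<longlonglongrightarrow> r" by real_asymp
    then have lim: "(\<lambda>k. ennreal (2 ^ k) * (1 - eneg ((1 - eneg (?e k)) * Q i s a))) \<longlonglongrightarrow> Q i s a"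
      unfolding form unfolding r(2) by (rule tendsto_ennrealI)
    show ?thesis
    proof (rule antisym)
      show "(SUP k. ennreal (2 ^ k) * (1 - eneg ((1 - eneg (?e k)) * Q i s a))) \<le> Q i s a"
      proof (rule SUP_least)
        fix k :: nat
        have "(1 - eneg (?e k)) * Q i s a \<le> ?e k * Q i s a"
        proof (rule mult_right_mono)
          show "1 - eneg (?e k) \<le> ?e k"
            using exp_ge_add_one_self[of "- (1 / 2 ^ k)"] by (simp add: eneg_ennreal ennreal_minus ennreal_leI flip: ennreal_1)
        qed simp
        then have "1 - eneg ((1 - eneg (?e k)) * Q i s a) \<le> 1 - eneg (?e k * Q i s a)"
          by (intro ennreal_minus_mono eneg_antimono) auto
        then have "ennreal (2 ^ k) * (1 - eneg ((1 - eneg (?e k)) * Q i s a)) \<le> ennreal (2 ^ k) * (1 - eneg (?e k * Q i s a))"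
          by (rule mult_left_mono) simp
        also have "\<dots> \<le> (SUP k. ennreal (2 ^ k) * (1 - eneg (?e k * Q i s a)))" by (rule SUP_upper) simp
        finally show "ennreal (2 ^ k) * (1 - eneg ((1 - eneg (?e k)) * Q i s a)) \<le> Q i s a"
          by (simp only: dyadic_derivative(2))
      qed
      show "Q i s a \<le> (SUP k. ennreal (2 ^ k) * (1 - eneg ((1 - eneg (?e k)) * Q i s a)))"
        by (rule LIMSEQ_le_const2[OF lim]) (auto intro!: exI SUP_upper)
    qed
  qed
  finally show ?thesis .
qed

end

section \<open>Joint law of a received power and the total powers\<close>

lemma measurable_pair_measure_countable2:
  assumes "\<And>n::nat. (\<lambda>x. f (x, n)) \<in> measurable N K"
  shows "f \<in> measurable (N \<Otimes>\<^sub>M count_space UNIV) K"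
proof -
  have "(\<lambda>(n, x). f (x, n)) \<in> measurable (count_space UNIV \<Otimes>\<^sub>M N) K"
    by (rule measurable_pair_measure_countable1) (auto simp: assms)
  from measurable_pair_swap[OF this] show ?thesis by (simp add: case_prod_beta')
qed

context power_network
begin

definition A :: real where
  "A = (\<Sum>j\<in>Bd. c j * b j powr (- 2 / \<alpha>))"

definition Ir :: "'w \<Rightarrow> real" where "Ir \<omega> = enn2real (I \<omega>)"
definition Tr :: "'w \<Rightarrow> real" where "Tr \<omega> = enn2real (T \<omega>)"

lemma Ir_measurable [measurable]: "Ir \<in> borel_measurable M"
  and Tr_measurable [measurable]: "Tr \<in> borel_measurable M"
  unfolding Ir_def[abs_def] Tr_def[abs_def] by measurable

lemma A_nonneg: "A \<ge> 0"
  unfolding A_def using c_nonneg Bd by (intro sum_nonneg mult_nonneg_nonneg) auto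

lemma idle_below_iff: "t \<ge> 0 \<Longrightarrow> idle_below t \<omega> \<longleftrightarrow> T \<omega> \<le> ennreal t"
  using b_pos unfolding idle_below_def T_def SUP_le_iff
  by (auto simp: pos_divide_le_eq mult.commute split: split_indicator)

text \<open>Powers above \<open>r\<close> fill the interval of area coordinates below
  \<open>r powr (- 2 / \<alpha>)\<close>, and the thresholds combine into the single constant
  \<open>A\<close>. So \<open>T\<close> has a distribution function of Frechet type.\<close>

lemma idle_prob_eq:
  assumes "t > 0"
  shows "idle_prob t = ennreal (exp (- (A * t powr (- 2 / \<alpha>))))"
proof -
  have area: "(\<integral>\<^sup>+u\<in>{0<..}. indicator {r<..} (u powr (- \<alpha> / 2)) \<partial>lborel) = ennreal (r powr (- 2 / \<alpha>))" if "r > 0" for r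
  proof -
    have "(\<integral>\<^sup>+u\<in>{0<..}. indicator {r<..} (u powr (- \<alpha> / 2)) \<partial>lborel) = (\<integral>\<^sup>+u. indicator {0<..<r powr (- 2 / \<alpha>)} u \<partial>lborel)"
    proof (rule nn_integral_cong)
      fix u :: real
      have "r < u powr (- \<alpha> / 2) \<longleftrightarrow> u < r powr (- 2 / \<alpha>)" if "u > 0"
      proof
        assume "r < u powr (- \<alpha> / 2)"
        then have "(u powr (- \<alpha> / 2)) powr (- 2 / \<alpha>) < r powr (- 2 / \<alpha>)"
          using \<open>r > 0\<close> \<alpha> by (intro powr_less_mono2_neg) auto
        then show "u < r powr (- 2 / \<alpha>)" by (simp only: powr_area_le_iff[OF that])
      next
        assume "u < r powr (- 2 / \<alpha>)"
        then have "(r powr (- 2 / \<alpha>)) powr (- \<alpha> / 2) < u powr (- \<alpha> / 2)"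
          using that \<alpha> by (intro powr_less_mono2_neg) auto
        then show "r < u powr (- \<alpha> / 2)" using \<open>r > 0\<close> \<alpha> by (simp add: powr_powr)
      qed
      then show "indicator {r<..} (u powr (- \<alpha> / 2)) * indicator {0<..} u = (indicator {0<..<r powr (- 2 / \<alpha>)} u :: ennreal)"
        by (auto split: split_indicator)
    qed
    then show ?thesis by simp
  qed
  have "(\<Sum>j\<in>Bd. ennreal (c j) * (\<integral>\<^sup>+u\<in>{0<..}. indicator {b j * t<..} (u powr (- \<alpha> / 2)) \<partial>lborel))
     = (\<Sum>j\<in>Bd. ennreal (c j * b j powr (- 2 / \<alpha>) * t powr (- 2 / \<alpha>)))"
  proof (intro sum.cong refl)
    fix j assume j: "j \<in> Bd"
    then have "(b j * t) powr (- 2 / \<alpha>) = b j powr (- 2 / \<alpha>) * t powr (- 2 / \<alpha>)"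
      using b_pos[OF j] assms by (simp add: powr_mult)
    then show "ennreal (c j) * (\<integral>\<^sup>+u\<in>{0<..}. indicator {b j * t<..} (u powr (- \<alpha> / 2)) \<partial>lborel)
       = ennreal (c j * b j powr (- 2 / \<alpha>) * t powr (- 2 / \<alpha>))"
      using area[of "b j * t"] b_pos[OF j] assms j Bd c_nonneg[of j] by (simp add: ennreal_mult' mult.assoc subset_iff)
  qed
  also have "\<dots> = ennreal (A * t powr (- 2 / \<alpha>))"
    unfolding A_def sum_distrib_right using c_nonneg Bd by (intro sum_ennreal) (auto intro!: mult_nonneg_nonneg)
  finally show ?thesis
    using A_nonneg by (simp add: idle_prob_def eneg_ennreal)
qed

lemma idle_below_prob: "t \<ge> 0 \<Longrightarrow> (\<integral>\<^sup>+\<omega>. indicator {\<omega>. idle_below t \<omega>} \<omega> \<partial>M) = idle_prob t"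
  using laplace_I[of 0 t] by simp

lemma laplace_I_plain:
  assumes "s \<ge> 0"
  shows "(\<integral>\<^sup>+\<omega>. eneg (ennreal s * I \<omega>) \<partial>M) = ennreal (exp (- (\<eta> * s powr (2 / \<alpha>))))"
proof -
  \<comment> \<open>Without idle processes the idle event is the whole space, so the transform of
    \<open>I\<close> alone is an instance of the joint one.\<close>
  interpret E: power_network M J d \<Phi> X H \<alpha> P Ac "{}" b
    by unfold_locales (use \<alpha> P_pos Ac Ac_pos in auto)
  show ?thesis
    using E.laplace_I[OF assms order.refl] by (simp add: E.idle_below_def E.idle_prob_def)
qed

lemma AE_by_prob:
  assumes "Measurable.pred M R" "\<And>k::nat. f k \<le> emeasure M {\<omega>\<in>space M. R \<omega>}" "f \<longlonglongrightarrow> 1"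
  shows "AE \<omega> in M. R \<omega>"
proof -
  have "1 \<le> emeasure M {\<omega>\<in>space M. R \<omega>}"
    using assms(2,3) by (intro LIMSEQ_le_const2[OF assms(3)]) auto
  then have "emeasure M {\<omega>\<in>space M. R \<omega>} = 1"
    using emeasure_le_1 antisym by blast
  then have "prob {\<omega>\<in>space M. R \<omega>} = 1" by (simp add: measure_def)
  then show ?thesis
    using assms(1) by (subst (asm) prob_Collect_eq_1) auto
qed

text \<open>Where \<open>I = \<top>\<close> the variable \<open>eneg (s * I)\<close> is
  \<open>0\<close> for every \<open>s > 0\<close>. So its mean is a lower bound for the probability
  of \<open>I < \<top>\<close>, and it tends to \<open>1\<close> as \<open>s\<close> tends to
  \<open>0\<close>.\<close>

lemma AE_I_finite: "AE \<omega> in M. I \<omega> < \<top>"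
proof (rule AE_by_prob)
  fix k :: nat
  have "ennreal (exp (- (\<eta> * (1 / Suc k) powr (2 / \<alpha>)))) = (\<integral>\<^sup>+\<omega>. eneg (ennreal (1 / Suc k) * I \<omega>) \<partial>M)"
    by (rule laplace_I_plain[symmetric]) simp
  also have "\<dots> \<le> (\<integral>\<^sup>+\<omega>. indicator {\<omega>\<in>space M. I \<omega> < \<top>} \<omega> \<partial>M)"
    by (intro nn_integral_mono)
       (auto simp: less_top[symmetric] ennreal_mult_top eneg_le_1 split: split_indicator simp del: of_nat_Suc)
  also have "\<dots> = emeasure M {\<omega>\<in>space M. I \<omega> < \<top>}" by simp
  finally show "ennreal (exp (- (\<eta> * (1 / Suc k) powr (2 / \<alpha>)))) \<le> emeasure M {\<omega>\<in>space M. I \<omega> < \<top>}" .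
next
  have "(\<lambda>k. (1 / real (Suc k)) powr (2 / \<alpha>)) \<longlonglongrightarrow> 0 powr (2 / \<alpha>)"
    using \<alpha> LIMSEQ_inverse_real_of_nat[unfolded inverse_eq_divide] by (intro tendsto_powr') auto
  then have "(\<lambda>k. exp (- (\<eta> * (1 / real (Suc k)) powr (2 / \<alpha>)))) \<longlonglongrightarrow> exp (- (\<eta> * 0 powr (2 / \<alpha>)))"
    by (intro tendsto_exp tendsto_minus tendsto_mult_left)
  then show "(\<lambda>k. ennreal (exp (- (\<eta> * (1 / real (Suc k)) powr (2 / \<alpha>))))) \<longlonglongrightarrow> 1"
    by (simp add: tendsto_ennrealI flip: ennreal_1)
qed measurable

text \<open>Where \<open>I = 0\<close> the variable \<open>eneg (k * I)\<close> is \<open>1\<close>,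
  and its mean tends to \<open>0\<close> as \<open>k\<close> grows because
  \<open>\<eta> > 0\<close>.\<close>

lemma AE_I_pos: "AE \<omega> in M. I \<omega> > 0"
proof (rule AE_by_prob)
  fix k :: nat
  let ?E = "{\<omega>\<in>space M. I \<omega> > 0}"
  have "emeasure M (space M - ?E) = (\<integral>\<^sup>+\<omega>. indicator (space M - ?E) \<omega> \<partial>M)" by simp
  also have "\<dots> \<le> (\<integral>\<^sup>+\<omega>. eneg (ennreal (real k) * I \<omega>) \<partial>M)"
    by (intro nn_integral_mono) (auto simp: not_less split: split_indicator)
  also have "\<dots> = ennreal (exp (- (\<eta> * real k powr (2 / \<alpha>))))"
    by (rule laplace_I_plain) simp
  finally have le: "emeasure M (space M - ?E) \<le> ennreal (exp (- (\<eta> * real k powr (2 / \<alpha>))))" .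
  have "?E \<in> events" by measurable
  then have "prob ?E = 1 - prob (space M - ?E)" by (simp add: prob_compl)
  moreover have "prob (space M - ?E) \<le> exp (- (\<eta> * real k powr (2 / \<alpha>)))"
    using le by (simp add: emeasure_eq_measure)
  ultimately show "ennreal (1 - exp (- (\<eta> * real k powr (2 / \<alpha>)))) \<le> emeasure M ?E"
    by (simp add: emeasure_eq_measure ennreal_leI)
next
  have "(\<lambda>k. 1 - exp (- (e * real k powr p))) \<longlonglongrightarrow> 1" if "p > 0" "e > 0" for p e :: real
    using that by real_asymp
  then have "(\<lambda>k. 1 - exp (- (\<eta> * real k powr (2 / \<alpha>)))) \<longlonglongrightarrow> 1"
    using \<eta>_pos \<alpha> by simp
  then show "(\<lambda>k. ennreal (1 - exp (- (\<eta> * real k powr (2 / \<alpha>))))) \<longlonglongrightarrow> 1"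
    by (simp add: tendsto_ennrealI flip: ennreal_1)
qed measurable

lemma AE_T_finite: "AE \<omega> in M. T \<omega> < \<top>"
proof (rule AE_by_prob)
  fix k :: nat
  have "ennreal (exp (- (A * real (Suc k) powr (- 2 / \<alpha>)))) = (\<integral>\<^sup>+\<omega>. indicator {\<omega>. idle_below (Suc k) \<omega>} \<omega> \<partial>M)"
    using idle_prob_eq[of "real (Suc k)"] by (simp add: idle_below_prob)
  also have "\<dots> \<le> (\<integral>\<^sup>+\<omega>. indicator {\<omega>\<in>space M. T \<omega> < \<top>} \<omega> \<partial>M)"
    by (intro nn_integral_mono) (auto simp: idle_below_iff less_top[symmetric] top_unique split: split_indicator)
  also have "\<dots> = emeasure M {\<omega>\<in>space M. T \<omega> < \<top>}" by simp
  finally show "ennreal (exp (- (A * real (Suc k) powr (- 2 / \<alpha>)))) \<le> emeasure M {\<omega>\<in>space M. T \<omega> < \<top>}" .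
next
  have "- 2 / \<alpha> < 0" using \<alpha> by simp
  then have "(\<lambda>k. real (Suc k) powr (- 2 / \<alpha>)) \<longlonglongrightarrow> 0"
    by (rule tendsto_neg_powr) real_asymp
  then have "(\<lambda>k. exp (- (A * real (Suc k) powr (- 2 / \<alpha>)))) \<longlonglongrightarrow> exp (- (A * 0))"
    by (intro tendsto_exp tendsto_minus tendsto_mult_left)
  then have "(\<lambda>k. exp (- (A * real (Suc k) powr (- 2 / \<alpha>)))) \<longlonglongrightarrow> 1"
    by simp
  then show "(\<lambda>k. ennreal (exp (- (A * real (Suc k) powr (- 2 / \<alpha>))))) \<longlonglongrightarrow> 1"
    by (simp add: tendsto_ennrealI flip: ennreal_1)
qed measurable

lemma AE_eneg_I: "AE \<omega> in M. \<forall>s\<ge>0. eneg (ennreal s * I \<omega>) = ennreal (exp (- (s * Ir \<omega>)))"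
  using AE_I_finite
proof eventually_elim
  case (elim \<omega>)
  then obtain r where "I \<omega> = ennreal r" "r \<ge> 0" by (cases "I \<omega>") auto
  then show ?case by (auto simp: eneg_ennreal Ir_def simp flip: ennreal_mult)
qed

lemma AE_idle_Tr: "t \<ge> 0 \<Longrightarrow> AE \<omega> in M. indicator {\<omega>. idle_below t \<omega>} \<omega> = (indicator {..t} (Tr \<omega>) :: ennreal)"
  using AE_T_finite
proof eventually_elim
  case (elim \<omega>)
  then have "T \<omega> = ennreal (Tr \<omega>)" by (simp add: Tr_def)
  then show ?case using elim by (auto simp: idle_below_iff split: split_indicator)
qed

lemma Ir_nonneg: "Ir \<omega> \<ge> 0" and Tr_nonneg: "Tr \<omega> \<ge> 0"
  by (auto simp: Ir_def Tr_def)

lemma laplace_Ir: "s \<ge> 0 \<Longrightarrow> (\<integral>\<^sup>+\<omega>. ennreal (exp (- (s * Ir \<omega>))) \<partial>M) = ennreal (exp (- (\<eta> * s powr (2 / \<alpha>))))"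
  by (subst laplace_I_plain[symmetric], assumption, rule nn_integral_cong_AE, use AE_eneg_I in eventually_elim) auto

lemma Tr_le_prob:
  assumes "t \<ge> 0"
  shows "(\<integral>\<^sup>+\<omega>. indicator {..t} (Tr \<omega>) \<partial>M) = idle_prob t"
proof -
  have "(\<integral>\<^sup>+\<omega>. indicator {..t} (Tr \<omega>) \<partial>M) = (\<integral>\<^sup>+\<omega>. indicator {\<omega>. idle_below t \<omega>} \<omega> \<partial>M)"
    by (rule nn_integral_cong_AE, use AE_idle_Tr[OF assms] in eventually_elim) simp
  then show ?thesis using idle_below_prob[OF assms] by simp
qed

text \<open>The idle condition \<open>T < I\<close> is strict while \<open>idle_below\<close> is
  not; the distribution function is continuous at positive arguments, so both give the same
  probability.\<close>

lemma Tr_less_prob: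
  assumes "x > 0"
  shows "(\<integral>\<^sup>+\<omega>. indicator {..<x} (Tr \<omega>) \<partial>M) = ennreal (exp (- (A * x powr (- 2 / \<alpha>))))"
proof (rule antisym)
  have "(\<integral>\<^sup>+\<omega>. indicator {..<x} (Tr \<omega>) \<partial>M) \<le> (\<integral>\<^sup>+\<omega>. indicator {..x} (Tr \<omega>) \<partial>M)"
    by (intro nn_integral_mono) (auto split: split_indicator)
  then show "(\<integral>\<^sup>+\<omega>. indicator {..<x} (Tr \<omega>) \<partial>M) \<le> ennreal (exp (- (A * x powr (- 2 / \<alpha>))))"
    using assms Tr_le_prob[of x] idle_prob_eq[of x] by simp
  \<comment> \<open>With \<open>k + 2\<close> in the denominator the points \<open>?r k\<close> are
    positive for every \<open>k\<close> and approach \<open>x\<close> from below.\<close>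
  let ?r = "\<lambda>k::nat. x * (1 - 1 / real (k + 2))"
  have r: "0 < ?r k" "?r k < x" for k
  proof -
    have "0 < 1 / real (k + 2)" "1 / real (k + 2) < 1" by auto
    then show "0 < ?r k" "?r k < x"
      using assms mult_strict_left_mono[of "1 - 1 / real (k + 2)" 1 x] by (auto intro!: mult_pos_pos)
  qed
  have le: "ennreal (exp (- (A * ?r k powr (- 2 / \<alpha>)))) \<le> (\<integral>\<^sup>+\<omega>. indicator {..<x} (Tr \<omega>) \<partial>M)" for k
  proof -
    have "(\<integral>\<^sup>+\<omega>. indicator {..?r k} (Tr \<omega>) \<partial>M) \<le> (\<integral>\<^sup>+\<omega>. indicator {..<x} (Tr \<omega>) \<partial>M)"
      using r[of k] by (intro nn_integral_mono) (auto split: split_indicator)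
    then show ?thesis using r[of k] Tr_le_prob[of "?r k"] idle_prob_eq[of "?r k"] by simp
  qed
  have "?r \<longlonglongrightarrow> x" by real_asymp
  then have "(\<lambda>k. ennreal (exp (- (A * ?r k powr (- 2 / \<alpha>))))) \<longlonglongrightarrow> ennreal (exp (- (A * x powr (- 2 / \<alpha>))))"
    using assms by (intro tendsto_ennrealI tendsto_intros) auto
  then show "ennreal (exp (- (A * x powr (- 2 / \<alpha>)))) \<le> (\<integral>\<^sup>+\<omega>. indicator {..<x} (Tr \<omega>) \<partial>M)"
    by (rule LIMSEQ_le_const2) (use le in auto)
qed

text \<open>Independence of \<open>I\<close> and \<open>T\<close> in the form of an iterated
  integral. With the idle event as a weight, the product form of \<open>laplace_I\<close> identifies
  the law of \<open>I\<close> on that event for each \<open>t\<close>; lower orthants then determine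
  the joint law.\<close>

lemma joint_law_Ir_Tr:
  assumes [measurable]: "F \<in> borel_measurable borel"
  shows "(\<integral>\<^sup>+\<omega>. F (Ir \<omega>, Tr \<omega>) \<partial>M) = (\<integral>\<^sup>+\<omega>. (\<integral>\<^sup>+\<omega>'. F (Ir \<omega>, Tr \<omega>') \<partial>M) \<partial>M)"
proof -
  interpret MM: pair_sigma_finite M M ..
  have [measurable]: "F \<in> borel_measurable (borel \<Otimes>\<^sub>M borel)" using assms by (simp add: borel_prod)
  define \<mu> where "\<mu> = distr M (borel \<Otimes>\<^sub>M borel) (\<lambda>\<omega>. (Ir \<omega>, Tr \<omega>))"
  define \<nu> where "\<nu> = distr (M \<Otimes>\<^sub>M M) (borel \<Otimes>\<^sub>M borel) (\<lambda>(\<omega>, \<omega>'). (Ir \<omega>, Tr \<omega>'))"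
  have int_\<mu>: "(\<integral>\<^sup>+z. f z \<partial>\<mu>) = (\<integral>\<^sup>+\<omega>. f (Ir \<omega>, Tr \<omega>) \<partial>M)" if [measurable]: "f \<in> borel_measurable (borel \<Otimes>\<^sub>M borel)" for f
    unfolding \<mu>_def by (rule nn_integral_distr) measurable
  have int_\<nu>: "(\<integral>\<^sup>+z. f z \<partial>\<nu>) = (\<integral>\<^sup>+\<omega>. (\<integral>\<^sup>+\<omega>'. f (Ir \<omega>, Tr \<omega>') \<partial>M) \<partial>M)" if [measurable]: "f \<in> borel_measurable (borel \<Otimes>\<^sub>M borel)" for f
    unfolding \<nu>_def by (subst nn_integral_distr, measurable, subst nn_integral_fst[symmetric], measurable, simp?)
  have box: "(\<integral>\<^sup>+\<omega>. indicator {..x} (Ir \<omega>) * indicator {..t} (Tr \<omega>) \<partial>M)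
      = (\<integral>\<^sup>+\<omega>. (\<integral>\<^sup>+\<omega>'. indicator {..x} (Ir \<omega>) * indicator {..t} (Tr \<omega>') \<partial>M) \<partial>M)" for x t
  proof (cases "t \<ge> 0")
    case False
    then have "Tr \<omega> \<notin> {..t}" for \<omega> using Tr_nonneg[of \<omega>] by auto
    then show ?thesis by simp
  next
    case True
    have "(\<integral>\<^sup>+\<omega>. indicator {\<omega>. idle_below t \<omega>} \<omega> * indicator {..x} (Ir \<omega>) \<partial>M) = (\<integral>\<^sup>+\<omega>. idle_prob t * indicator {..x} (Ir \<omega>) \<partial>M)"
    proof (rule laplace_determines_law)
      show "(\<integral>\<^sup>+\<omega>. indicator {\<omega>. idle_below t \<omega>} \<omega> \<partial>M) < \<infinity>"
        using True by (simp add: idle_below_prob idle_prob_def eneg_less_top)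
      fix s :: real assume "s \<ge> 0"
      have "(\<integral>\<^sup>+\<omega>. indicator {\<omega>. idle_below t \<omega>} \<omega> * ennreal (exp (- (s * Ir \<omega>))) \<partial>M)
         = (\<integral>\<^sup>+\<omega>. eneg (ennreal s * I \<omega>) * indicator {\<omega>. idle_below t \<omega>} \<omega> \<partial>M)"
        using \<open>s \<ge> 0\<close> by (intro nn_integral_cong_AE, use AE_eneg_I in eventually_elim) (auto simp: mult.commute)
      also have "\<dots> = ennreal (exp (- (\<eta> * s powr (2 / \<alpha>)))) * idle_prob t"
        by (rule laplace_I[OF \<open>s \<ge> 0\<close> True])
      also have "\<dots> = (\<integral>\<^sup>+\<omega>. idle_prob t * ennreal (exp (- (s * Ir \<omega>))) \<partial>M)"
        using \<open>s \<ge> 0\<close> by (simp add: nn_integral_cmult laplace_Ir mult.commute)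
      finally show "(\<integral>\<^sup>+\<omega>. indicator {\<omega>. idle_below t \<omega>} \<omega> * ennreal (exp (- (s * Ir \<omega>))) \<partial>M)
         = (\<integral>\<^sup>+\<omega>. idle_prob t * ennreal (exp (- (s * Ir \<omega>))) \<partial>M)" .
    qed (auto simp: Ir_nonneg)
    also have "(\<integral>\<^sup>+\<omega>. indicator {\<omega>. idle_below t \<omega>} \<omega> * indicator {..x} (Ir \<omega>) \<partial>M)
        = (\<integral>\<^sup>+\<omega>. indicator {..x} (Ir \<omega>) * indicator {..t} (Tr \<omega>) \<partial>M)"
      by (intro nn_integral_cong_AE, use AE_idle_Tr[OF True] in eventually_elim) (simp add: mult.commute)
    also have "(\<integral>\<^sup>+\<omega>. idle_prob t * indicator {..x} (Ir \<omega>) \<partial>M) = (\<integral>\<^sup>+\<omega>. (\<integral>\<^sup>+\<omega>'. indicator {..x} (Ir \<omega>) * indicator {..t} (Tr \<omega>') \<partial>M) \<partial>M)"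
      by (subst nn_integral_cmult[of _ M "indicator {..x} (Ir _)"], measurable) (simp add: Tr_le_prob[OF True] mult.commute)
    finally show ?thesis .
  qed
  have "\<mu> = \<nu>"
  proof (rule finite_measure_eqI_atMost)
    fix p :: "real \<times> real"
    obtain x t where p: "p = (x, t)" by (cases p)
    have ind: "indicator {..(x, t)} (u, v) = (indicator {..x} u * indicator {..t} v :: ennreal)" for u v
      by (auto split: split_indicator)
    have meas: "{..p} \<in> sets (borel \<Otimes>\<^sub>M borel)" unfolding borel_prod by simp
    have e\<mu>: "emeasure \<mu> {..p} = (\<integral>\<^sup>+z. indicator {..p} z \<partial>\<mu>)"
      using meas by (simp add: \<mu>_def)
    have e\<nu>: "emeasure \<nu> {..p} = (\<integral>\<^sup>+z. indicator {..p} z \<partial>\<nu>)"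
      using meas by (simp add: \<nu>_def)
    show "emeasure \<mu> {..p} = emeasure \<nu> {..p}"
      unfolding e\<mu> e\<nu> by (subst int_\<mu>, use meas in simp, subst int_\<nu>, use meas in simp) (simp add: p ind box)
    have "emeasure \<mu> {..p} \<le> emeasure \<mu> (space \<mu>)" by (rule emeasure_space)
    also have "emeasure \<mu> (space \<mu>) = 1"
      unfolding \<mu>_def by (rule prob_space.emeasure_space_1[OF prob_space_distr]) measurable
    finally show "emeasure \<mu> {..p} \<noteq> \<infinity>" by (auto simp: top_unique)
  qed (simp_all add: \<mu>_def \<nu>_def borel_prod)
  then show ?thesis using int_\<mu>[of F] int_\<nu>[of F] by simp
qed

text \<open>A Campbell-Mecke formula: a station with area coordinate \<open>u\<close> adds its own
  power \<open>u powr (- \<alpha> / 2)\<close> to a total that is distributed as \<open>I\<close>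
  and independent of \<open>T\<close>. Both sides are integrals of \<open>F\<close> against measures
  that agree on lower orthants: \<open>count\<close> handles the first coordinate, Laplace
  uniqueness the second and the idle event the third.\<close>

lemma campbell_joint_law:
  assumes i: "i \<in> Ac" and F: "F \<in> borel_measurable borel"
  shows "(\<integral>\<^sup>+\<omega>. (\<Sum>n. indicator (\<Phi> i \<omega>) (X n \<omega>) * indicator {0<..} (Y i n \<omega>) * F (Y i n \<omega> powr (- 2 / \<alpha>), Ir \<omega>, Tr \<omega>)) \<partial>M)
    = ennreal (c i) * (\<integral>\<^sup>+u\<in>{0<..}. (\<integral>\<^sup>+\<omega>. (\<integral>\<^sup>+\<omega>'. F (u, u powr (- \<alpha> / 2) + Ir \<omega>, Tr \<omega>') \<partial>M) \<partial>M) \<partial>lborel)"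
proof -
  let ?B = "borel :: (real \<times> real \<times> real) measure"
  let ?C = "count_space (UNIV :: nat set)"
  have [measurable]: "F \<in> borel_measurable (borel \<Otimes>\<^sub>M (borel \<Otimes>\<^sub>M borel))" using F by (simp add: borel_prod)
  have [measurable]: "\<Phi> i \<in> measurable M point_configs" "count i a \<in> borel_measurable M" for a using i Ac by auto
  interpret MM: pair_sigma_finite M M ..
  interpret C: sigma_finite_measure ?C by (rule sigma_finite_measure_count_space_countable) simp
  interpret MC: pair_sigma_finite M ?C ..
  interpret LMM: pair_sigma_finite lborel "M \<Otimes>\<^sub>M M" ..
  interpret LM: pair_sigma_finite lborel M ..
  let ?y = "\<lambda>u. u powr (- \<alpha> / 2)"
  define w where "w = (\<lambda>(\<omega>, n). indicator (\<Phi> i \<omega>) (X n \<omega>) * indicator {0<..} (Y i n \<omega>) :: ennreal)"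
  \<comment> \<open>The Campbell measure, with the station index integrated against counting
    measure. Its total mass may be infinite; on a lower orthant it is bounded by the mean of
    \<open>count\<close>.\<close>
  define \<mu> where "\<mu> = distr (density (M \<Otimes>\<^sub>M ?C) w) ?B (\<lambda>(\<omega>, n). (Y i n \<omega> powr (- 2 / \<alpha>), Ir \<omega>, Tr \<omega>))"
  define \<nu> where "\<nu> = distr (density (lborel \<Otimes>\<^sub>M (M \<Otimes>\<^sub>M M)) (\<lambda>(u, _). ennreal (c i) * indicator {0<..} u)) ?B (\<lambda>(u, \<omega>, \<omega>'). (u, ?y u + Ir \<omega>, Tr \<omega>'))"
  have w_meas [measurable]: "w \<in> borel_measurable (M \<Otimes>\<^sub>M ?C)"
    unfolding w_def by (rule measurable_pair_measure_countable2) auto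
  have g_meas [measurable]: "(\<lambda>(\<omega>, n). (Y i n \<omega> powr (- 2 / \<alpha>), Ir \<omega>, Tr \<omega>)) \<in> measurable (M \<Otimes>\<^sub>M ?C) ?B"
    unfolding borel_prod[symmetric] by (rule measurable_pair_measure_countable2) auto
  have h_meas [measurable]: "(\<lambda>(u, \<omega>, \<omega>'). (u, ?y u + Ir \<omega>, Tr \<omega>')) \<in> measurable (lborel \<Otimes>\<^sub>M (M \<Otimes>\<^sub>M M)) ?B"
    unfolding borel_prod[symmetric] by measurable
  have int_\<mu>: "(\<integral>\<^sup>+z. f z \<partial>\<mu>) = (\<integral>\<^sup>+\<omega>. (\<Sum>n. indicator (\<Phi> i \<omega>) (X n \<omega>) * indicator {0<..} (Y i n \<omega>) * f (Y i n \<omega> powr (- 2 / \<alpha>), Ir \<omega>, Tr \<omega>)) \<partial>M)"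
    if f: "f \<in> borel_measurable ?B" for f
  proof -
    have "(\<integral>\<^sup>+z. f z \<partial>\<mu>) = (\<integral>\<^sup>+z. f (case z of (\<omega>, n) \<Rightarrow> (Y i n \<omega> powr (- 2 / \<alpha>), Ir \<omega>, Tr \<omega>)) \<partial>density (M \<Otimes>\<^sub>M ?C) w)"
      unfolding \<mu>_def using f by (intro nn_integral_distr) auto
    also have "\<dots> = (\<integral>\<^sup>+z. w z * f (case z of (\<omega>, n) \<Rightarrow> (Y i n \<omega> powr (- 2 / \<alpha>), Ir \<omega>, Tr \<omega>)) \<partial>(M \<Otimes>\<^sub>M ?C))"
      using measurable_compose[OF g_meas f] by (intro nn_integral_density) auto
    also have "\<dots> = (\<integral>\<^sup>+\<omega>. (\<integral>\<^sup>+n. w (\<omega>, n) * f (Y i n \<omega> powr (- 2 / \<alpha>), Ir \<omega>, Tr \<omega>) \<partial>?C) \<partial>M)"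
      using measurable_compose[OF g_meas f] by (subst C.nn_integral_fst[symmetric]) auto
    finally show ?thesis by (simp add: w_def nn_integral_count_space_nat)
  qed
  have int_\<nu>: "(\<integral>\<^sup>+z. f z \<partial>\<nu>) = ennreal (c i) * (\<integral>\<^sup>+u\<in>{0<..}. (\<integral>\<^sup>+\<omega>. (\<integral>\<^sup>+\<omega>'. f (u, ?y u + Ir \<omega>, Tr \<omega>') \<partial>M) \<partial>M) \<partial>lborel)"
    if f: "f \<in> borel_measurable ?B" for f
  proof -
    have f' [measurable]: "f \<in> borel_measurable (borel \<Otimes>\<^sub>M (borel \<Otimes>\<^sub>M borel))" using f by (simp add: borel_prod)
    have "(\<integral>\<^sup>+z. f z \<partial>\<nu>) = (\<integral>\<^sup>+z. f (case z of (u, \<omega>, \<omega>') \<Rightarrow> (u, ?y u + Ir \<omega>, Tr \<omega>')) \<partial>density (lborel \<Otimes>\<^sub>M (M \<Otimes>\<^sub>M M)) (\<lambda>(u, _). ennreal (c i) * indicator {0<..} u))"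
      unfolding \<nu>_def using f by (intro nn_integral_distr) auto
    also have "\<dots> = (\<integral>\<^sup>+z. (case z of (u, _) \<Rightarrow> ennreal (c i) * indicator {0<..} u) * f (case z of (u, \<omega>, \<omega>') \<Rightarrow> (u, ?y u + Ir \<omega>, Tr \<omega>')) \<partial>(lborel \<Otimes>\<^sub>M (M \<Otimes>\<^sub>M M)))"
      using measurable_compose[OF h_meas f] by (intro nn_integral_density) auto
    also have "\<dots> = (\<integral>\<^sup>+u. (\<integral>\<^sup>+v. ennreal (c i) * indicator {0<..} u * f (case v of (\<omega>, \<omega>') \<Rightarrow> (u, ?y u + Ir \<omega>, Tr \<omega>')) \<partial>(M \<Otimes>\<^sub>M M)) \<partial>lborel)"
      using measurable_compose[OF h_meas f] by (subst MM.nn_integral_fst[symmetric]) (auto intro!: nn_integral_cong)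
    also have "\<dots> = (\<integral>\<^sup>+u. ennreal (c i) * ((\<integral>\<^sup>+\<omega>. (\<integral>\<^sup>+\<omega>'. f (u, ?y u + Ir \<omega>, Tr \<omega>') \<partial>M) \<partial>M) * indicator {0<..} u) \<partial>lborel)"
    proof (rule nn_integral_cong)
      fix u
      have "(\<integral>\<^sup>+v. ennreal (c i) * indicator {0<..} u * f (case v of (\<omega>, \<omega>') \<Rightarrow> (u, ?y u + Ir \<omega>, Tr \<omega>')) \<partial>(M \<Otimes>\<^sub>M M))
         = ennreal (c i) * indicator {0<..} u * (\<integral>\<^sup>+v. f (case v of (\<omega>, \<omega>') \<Rightarrow> (u, ?y u + Ir \<omega>, Tr \<omega>')) \<partial>(M \<Otimes>\<^sub>M M))"
        by (rule nn_integral_cmult) measurable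
      also have "(\<integral>\<^sup>+v. f (case v of (\<omega>, \<omega>') \<Rightarrow> (u, ?y u + Ir \<omega>, Tr \<omega>')) \<partial>(M \<Otimes>\<^sub>M M)) = (\<integral>\<^sup>+\<omega>. (\<integral>\<^sup>+\<omega>'. f (u, ?y u + Ir \<omega>, Tr \<omega>') \<partial>M) \<partial>M)"
        by (subst nn_integral_fst[symmetric], measurable, simp?)
      finally show "(\<integral>\<^sup>+v. ennreal (c i) * indicator {0<..} u * f (case v of (\<omega>, \<omega>') \<Rightarrow> (u, ?y u + Ir \<omega>, Tr \<omega>')) \<partial>(M \<Otimes>\<^sub>M M))
        = ennreal (c i) * ((\<integral>\<^sup>+\<omega>. (\<integral>\<^sup>+\<omega>'. f (u, ?y u + Ir \<omega>, Tr \<omega>') \<partial>M) \<partial>M) * indicator {0<..} u)"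
        by (simp add: mult_ac)
    qed
    also have "\<dots> = ennreal (c i) * (\<integral>\<^sup>+u\<in>{0<..}. (\<integral>\<^sup>+\<omega>. (\<integral>\<^sup>+\<omega>'. f (u, ?y u + Ir \<omega>, Tr \<omega>') \<partial>M) \<partial>M) \<partial>lborel)"
      by (rule nn_integral_cmult) measurable
    finally show ?thesis .
  qed
  have box: "(\<integral>\<^sup>+\<omega>. count i a \<omega> * indicator {..x} (Ir \<omega>) * indicator {..t} (Tr \<omega>) \<partial>M)
      = ennreal (c i) * (\<integral>\<^sup>+u\<in>{0<..}. (\<integral>\<^sup>+\<omega>. (\<integral>\<^sup>+\<omega>'. indicator {..a} u * indicator {..x} (?y u + Ir \<omega>) * indicator {..t} (Tr \<omega>') \<partial>M) \<partial>M) \<partial>lborel)"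
    and count_fin: "(\<integral>\<^sup>+\<omega>. count i a \<omega> \<partial>M) < \<top>" for a x t
  proof -
    show "(\<integral>\<^sup>+\<omega>. count i a \<omega> \<partial>M) < \<top>"
    proof -
      \<comment> \<open>The transform at \<open>s = 0\<close> without idle processes is the mean of
        the count.\<close>
      interpret E: power_network M J d \<Phi> X H \<alpha> P Ac "{}" b
        by unfold_locales (use \<alpha> P_pos Ac Ac_pos in auto)
      show ?thesis
        using E.campbell_laplace[OF i order.refl order.refl, of a] Q_finite[of 0 i a] by (simp add: E.idle_below_def E.idle_prob_def)
    qed
    note fin = this
    show "(\<integral>\<^sup>+\<omega>. count i a \<omega> * indicator {..x} (Ir \<omega>) * indicator {..t} (Tr \<omega>) \<partial>M)
      = ennreal (c i) * (\<integral>\<^sup>+u\<in>{0<..}. (\<integral>\<^sup>+\<omega>. (\<integral>\<^sup>+\<omega>'. indicator {..a} u * indicator {..x} (?y u + Ir \<omega>) * indicator {..t} (Tr \<omega>') \<partial>M) \<partial>M) \<partial>lborel)"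
    proof (cases "t \<ge> 0")
      case False
      then have "Tr \<omega> \<notin> {..t}" for \<omega> using Tr_nonneg[of \<omega>] by auto
      then show ?thesis by simp
    next
      case True
      \<comment> \<open>The right-hand side as a weighted law on pairs of an area coordinate and an
        outcome, so that \<open>laplace_determines_law\<close> compares it with the left.\<close>
      let ?W' = "\<lambda>(u, _ :: 'w). idle_prob t * (ennreal (c i) * indicator {0<..a} u)"
      let ?Z' = "\<lambda>(u, \<omega>). ?y u + Ir \<omega>"
      have split: "(\<integral>\<^sup>+z. ?W' z * f (?Z' z) \<partial>(lborel \<Otimes>\<^sub>M M)) = idle_prob t * (ennreal (c i) * (\<integral>\<^sup>+u\<in>{0<..a}. (\<integral>\<^sup>+\<omega>. f (?y u + Ir \<omega>) \<partial>M) \<partial>lborel))"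
        if [measurable]: "f \<in> borel_measurable borel" for f
      proof -
        have "(\<integral>\<^sup>+z. ?W' z * f (?Z' z) \<partial>(lborel \<Otimes>\<^sub>M M)) = (\<integral>\<^sup>+u. (\<integral>\<^sup>+\<omega>. (idle_prob t * (ennreal (c i) * indicator {0<..a} u)) * f (?y u + Ir \<omega>) \<partial>M) \<partial>lborel)"
          by (subst nn_integral_fst[symmetric], measurable, simp?)
        also have "\<dots> = (\<integral>\<^sup>+u. idle_prob t * (ennreal (c i) * ((\<integral>\<^sup>+\<omega>. f (?y u + Ir \<omega>) \<partial>M) * indicator {0<..a} u)) \<partial>lborel)"
          by (intro nn_integral_cong, subst nn_integral_cmult, measurable) (simp add: mult_ac)
        finally show ?thesis by (simp add: nn_integral_cmult)
      qed
      have "(\<integral>\<^sup>+\<omega>. (count i a \<omega> * indicator {\<omega>. idle_below t \<omega>} \<omega>) * indicator {..x} (Ir \<omega>) \<partial>M) = (\<integral>\<^sup>+z. ?W' z * indicator {..x} (?Z' z) \<partial>(lborel \<Otimes>\<^sub>M M))"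
      proof (rule laplace_determines_law)
        show "(\<integral>\<^sup>+\<omega>. count i a \<omega> * indicator {\<omega>. idle_below t \<omega>} \<omega> \<partial>M) < \<infinity>"
        proof (rule order_le_less_trans)
          show "(\<integral>\<^sup>+\<omega>. count i a \<omega> * indicator {\<omega>. idle_below t \<omega>} \<omega> \<partial>M) \<le> (\<integral>\<^sup>+\<omega>. count i a \<omega> \<partial>M)"
            by (intro nn_integral_mono) (auto split: split_indicator)
        qed (use fin in simp)
        fix s :: real assume s: "s \<ge> 0"
        have "(\<integral>\<^sup>+\<omega>. (count i a \<omega> * indicator {\<omega>. idle_below t \<omega>} \<omega>) * ennreal (exp (- (s * Ir \<omega>))) \<partial>M)
           = (\<integral>\<^sup>+\<omega>. count i a \<omega> * eneg (ennreal s * I \<omega>) * indicator {\<omega>. idle_below t \<omega>} \<omega> \<partial>M)"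
          using s by (intro nn_integral_cong_AE, use AE_eneg_I in eventually_elim) (auto simp: mult_ac)
        also have "\<dots> = ennreal (exp (- (\<eta> * s powr (2 / \<alpha>)))) * idle_prob t * Q i s a"
          by (rule campbell_laplace[OF i s True])
        also have "\<dots> = (\<integral>\<^sup>+z. ?W' z * ennreal (exp (- (s * ?Z' z))) \<partial>(lborel \<Otimes>\<^sub>M M))"
        proof -
          have "(\<integral>\<^sup>+\<omega>. ennreal (exp (- (s * (?y u + Ir \<omega>)))) \<partial>M) = ennreal (exp (- (s * ?y u))) * ennreal (exp (- (\<eta> * s powr (2 / \<alpha>))))" for u
          proof -
            have "ennreal (exp (- (s * (?y u + Ir \<omega>)))) = ennreal (exp (- (s * ?y u))) * ennreal (exp (- (s * Ir \<omega>)))" for \<omega>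
              by (simp add: distrib_left exp_add[symmetric] flip: ennreal_mult)
            then show ?thesis by (simp add: nn_integral_cmult laplace_Ir[OF s])
          qed
          then have "(\<integral>\<^sup>+u\<in>{0<..a}. (\<integral>\<^sup>+\<omega>. ennreal (exp (- (s * (?y u + Ir \<omega>)))) \<partial>M) \<partial>lborel)
             = (\<integral>\<^sup>+u. ennreal (exp (- (\<eta> * s powr (2 / \<alpha>)))) * (ennreal (exp (- (s * ?y u))) * indicator {0<..a} u) \<partial>lborel)"
            by (simp only:) (simp add: mult_ac)
          also have "\<dots> = ennreal (exp (- (\<eta> * s powr (2 / \<alpha>)))) * (\<integral>\<^sup>+u\<in>{0<..a}. ennreal (exp (- (s * ?y u))) \<partial>lborel)"
            by (rule nn_integral_cmult) measurable
          finally show ?thesis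
            using split[of "\<lambda>z. ennreal (exp (- (s * z)))"] by (simp add: Q_def mult_ac)
        qed
        finally show "(\<integral>\<^sup>+\<omega>. (count i a \<omega> * indicator {\<omega>. idle_below t \<omega>} \<omega>) * ennreal (exp (- (s * Ir \<omega>))) \<partial>M)
           = (\<integral>\<^sup>+z. ?W' z * ennreal (exp (- (s * ?Z' z))) \<partial>(lborel \<Otimes>\<^sub>M M))" .
      qed (auto simp: Ir_nonneg intro!: add_nonneg_nonneg)
      also have "(\<integral>\<^sup>+\<omega>. (count i a \<omega> * indicator {\<omega>. idle_below t \<omega>} \<omega>) * indicator {..x} (Ir \<omega>) \<partial>M)
         = (\<integral>\<^sup>+\<omega>. count i a \<omega> * indicator {..x} (Ir \<omega>) * indicator {..t} (Tr \<omega>) \<partial>M)"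
        by (intro nn_integral_cong_AE, use AE_idle_Tr[OF True] in eventually_elim) (simp add: mult_ac)
      also have "(\<integral>\<^sup>+z. ?W' z * indicator {..x} (?Z' z) \<partial>(lborel \<Otimes>\<^sub>M M))
         = idle_prob t * (ennreal (c i) * (\<integral>\<^sup>+u\<in>{0<..a}. (\<integral>\<^sup>+\<omega>. indicator {..x} (?y u + Ir \<omega>) \<partial>M) \<partial>lborel))"
        by (rule split) simp
      also have "\<dots> = ennreal (c i) * (\<integral>\<^sup>+u. idle_prob t * ((\<integral>\<^sup>+\<omega>. indicator {..x} (?y u + Ir \<omega>) \<partial>M) * indicator {0<..a} u) \<partial>lborel)"
        by (subst nn_integral_cmult, measurable) (simp add: mult_ac)
      also have "(\<integral>\<^sup>+u. idle_prob t * ((\<integral>\<^sup>+\<omega>. indicator {..x} (?y u + Ir \<omega>) \<partial>M) * indicator {0<..a} u) \<partial>lborel)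
         = (\<integral>\<^sup>+u\<in>{0<..}. (\<integral>\<^sup>+\<omega>. (\<integral>\<^sup>+\<omega>'. indicator {..a} u * indicator {..x} (?y u + Ir \<omega>) * indicator {..t} (Tr \<omega>') \<partial>M) \<partial>M) \<partial>lborel)"
      proof (intro nn_integral_cong)
        fix u
        have "(\<integral>\<^sup>+\<omega>'. indicator {..a} u * indicator {..x} (?y u + Ir \<omega>) * indicator {..t} (Tr \<omega>') \<partial>M)
           = indicator {..a} u * idle_prob t * indicator {..x} (?y u + Ir \<omega>)" for \<omega>
          by (subst nn_integral_cmult, measurable) (simp add: Tr_le_prob[OF True] mult_ac)
        then have "(\<integral>\<^sup>+\<omega>. (\<integral>\<^sup>+\<omega>'. indicator {..a} u * indicator {..x} (?y u + Ir \<omega>) * indicator {..t} (Tr \<omega>') \<partial>M) \<partial>M)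
           = indicator {..a} u * idle_prob t * (\<integral>\<^sup>+\<omega>. indicator {..x} (?y u + Ir \<omega>) \<partial>M)"
          by (simp only:) (rule nn_integral_cmult, measurable)
        then show "idle_prob t * ((\<integral>\<^sup>+\<omega>. indicator {..x} (?y u + Ir \<omega>) \<partial>M) * indicator {0<..a} u)
           = (\<integral>\<^sup>+\<omega>. (\<integral>\<^sup>+\<omega>'. indicator {..a} u * indicator {..x} (?y u + Ir \<omega>) * indicator {..t} (Tr \<omega>') \<partial>M) \<partial>M) * indicator {0<..} u"
          by (simp only:) (auto simp: mult_ac split: split_indicator)
      qed
      finally show ?thesis .
    qed
  qed
  have "\<mu> = \<nu>"
  proof (rule finite_measure_eqI_atMost)
    fix p :: "real \<times> real \<times> real"
    obtain a x t where p: "p = (a, x, t)" by (cases p)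
    have ind: "indicator {..(a, x, t)} (u, v, r) = (indicator {..a} u * indicator {..x} v * indicator {..t} r :: ennreal)" for u v r
      by (auto split: split_indicator)
    have meas: "indicator {..p} \<in> borel_measurable ?B" by simp
    have "emeasure \<mu> {..p} = (\<integral>\<^sup>+z. indicator {..p} z \<partial>\<mu>)" by (simp add: \<mu>_def)
    also have "\<dots> = (\<integral>\<^sup>+\<omega>. (\<Sum>n. indicator (\<Phi> i \<omega>) (X n \<omega>) * indicator {0<..} (Y i n \<omega>) * indicator {..p} (Y i n \<omega> powr (- 2 / \<alpha>), Ir \<omega>, Tr \<omega>)) \<partial>M)"
      by (rule int_\<mu>[OF meas])
    also have "\<dots> = (\<integral>\<^sup>+\<omega>. count i a \<omega> * indicator {..x} (Ir \<omega>) * indicator {..t} (Tr \<omega>) \<partial>M)"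
    proof (rule nn_integral_cong)
      fix \<omega>
      have "indicator (\<Phi> i \<omega>) (X n \<omega>) * indicator {0<..} (Y i n \<omega>) * indicator {..p} (Y i n \<omega> powr (- 2 / \<alpha>), Ir \<omega>, Tr \<omega>)
         = (indicator {..x} (Ir \<omega>) * indicator {..t} (Tr \<omega>)) * (indicator {y. 0 < y \<and> y powr (- 2 / \<alpha>) \<le> a} (Y i n \<omega>) * indicator (\<Phi> i \<omega>) (X n \<omega>) :: ennreal)" for n
        unfolding p ind by (auto split: split_indicator)
      then show "(\<Sum>n. indicator (\<Phi> i \<omega>) (X n \<omega>) * indicator {0<..} (Y i n \<omega>) * indicator {..p} (Y i n \<omega> powr (- 2 / \<alpha>), Ir \<omega>, Tr \<omega>))
         = (count i a \<omega> * indicator {..x} (Ir \<omega>) * indicator {..t} (Tr \<omega>) :: ennreal)"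
        by (simp only: ennreal_suminf_cmult) (simp add: count_def mult_ac)
    qed
    finally have e\<mu>: "emeasure \<mu> {..p} = (\<integral>\<^sup>+\<omega>. count i a \<omega> * indicator {..x} (Ir \<omega>) * indicator {..t} (Tr \<omega>) \<partial>M)" .
    have "emeasure \<nu> {..p} = (\<integral>\<^sup>+z. indicator {..p} z \<partial>\<nu>)" by (simp add: \<nu>_def)
    also have "\<dots> = ennreal (c i) * (\<integral>\<^sup>+u\<in>{0<..}. (\<integral>\<^sup>+\<omega>. (\<integral>\<^sup>+\<omega>'. indicator {..p} (u, ?y u + Ir \<omega>, Tr \<omega>') \<partial>M) \<partial>M) \<partial>lborel)"
      by (rule int_\<nu>[OF meas])
    finally have e\<nu>: "emeasure \<nu> {..p} = ennreal (c i) * (\<integral>\<^sup>+u\<in>{0<..}. (\<integral>\<^sup>+\<omega>. (\<integral>\<^sup>+\<omega>'. indicator {..p} (u, ?y u + Ir \<omega>, Tr \<omega>') \<partial>M) \<partial>M) \<partial>lborel)" .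
    show "emeasure \<mu> {..p} = emeasure \<nu> {..p}"
      unfolding e\<mu> e\<nu> unfolding box p ind by (rule refl)
    have "emeasure \<mu> {..p} \<le> (\<integral>\<^sup>+\<omega>. count i a \<omega> \<partial>M)"
      unfolding e\<mu> by (intro nn_integral_mono) (auto split: split_indicator)
    then show "emeasure \<mu> {..p} \<noteq> \<infinity>" using count_fin[of a] by (auto simp: top_unique)
  qed (simp_all add: \<mu>_def \<nu>_def)
  then show ?thesis using int_\<mu>[OF F] int_\<nu>[OF F] by simp
qed

end

section \<open>Series for the two expectations\<close>

context power_network
begin

text \<open>The total power in the area coordinate. Given \<open>I\<close>, the idle void
  probability is \<open>exp (- (A * R))\<close>, and the series below are expansions in powers of
  \<open>R\<close>.\<close>

definition R :: "'w \<Rightarrow> real" where "R \<omega> = Ir \<omega> powr (- 2 / \<alpha>)"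

definition moment :: "nat \<Rightarrow> real" where
  "moment m = fact m / (Gamma (1 + real m * (2 / \<alpha>)) * \<eta> ^ m)"

lemma R_measurable [measurable]: "R \<in> borel_measurable M"
  unfolding R_def[abs_def] by measurable

lemma R_nonneg: "R \<omega> \<ge> 0" by (simp add: R_def)

lemma AE_Ir_pos: "AE \<omega> in M. Ir \<omega> > 0"
  using AE_I_finite AE_I_pos by eventually_elim (simp add: Ir_def enn2real_positive_iff)

lemma idle_uncovered_prob:
  "(\<integral>\<^sup>+\<omega>. indicator {..<Ir \<omega>} (Tr \<omega>) \<partial>M) = (\<integral>\<^sup>+\<omega>. ennreal (exp (- (A * R \<omega>))) \<partial>M)"
proof -
  let ?F = "indicator {z. snd z < fst z} :: real \<times> real \<Rightarrow> ennreal"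
  have F: "?F \<in> borel_measurable borel" unfolding borel_prod[symmetric] by measurable
  have "(\<integral>\<^sup>+\<omega>. indicator {..<Ir \<omega>} (Tr \<omega>) \<partial>M) = (\<integral>\<^sup>+\<omega>. ?F (Ir \<omega>, Tr \<omega>) \<partial>M)"
    by (intro nn_integral_cong) (auto split: split_indicator)
  also have "\<dots> = (\<integral>\<^sup>+\<omega>. (\<integral>\<^sup>+\<omega>'. ?F (Ir \<omega>, Tr \<omega>') \<partial>M) \<partial>M)"
    by (rule joint_law_Ir_Tr[OF F])
  also have "\<dots> = (\<integral>\<^sup>+\<omega>. ennreal (exp (- (A * R \<omega>))) \<partial>M)"
  proof (rule nn_integral_cong_AE, use AE_Ir_pos in eventually_elim)
    fix \<omega> assume "Ir \<omega> > 0"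
    have "(\<integral>\<^sup>+\<omega>'. ?F (Ir \<omega>, Tr \<omega>') \<partial>M) = (\<integral>\<^sup>+\<omega>'. indicator {..<Ir \<omega>} (Tr \<omega>') \<partial>M)"
      by (intro nn_integral_cong) (auto split: split_indicator)
    then show "(\<integral>\<^sup>+\<omega>'. ?F (Ir \<omega>, Tr \<omega>') \<partial>M) = ennreal (exp (- (A * R \<omega>)))"
      using Tr_less_prob[OF \<open>Ir \<omega> > 0\<close>] by (simp add: R_def)
  qed
  finally show ?thesis .
qed

text \<open>After \<open>campbell_joint_law\<close> the station at \<open>u\<close> covers the
  mobile if \<open>\<beta> * I \<le> u powr (- \<alpha> / 2)\<close>, with \<open>I\<close> the
  power of the others. The scaling \<open>u = R * w\<close> frees the region from \<open>I\<close>,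
  puts \<open>R\<close> in front, and turns the total power into
  \<open>I * (1 + w powr (- \<alpha> / 2))\<close>.\<close>

lemma active_covered_integral:
  assumes i: "i \<in> Ac" and \<beta>: "\<beta> > 0"
  shows "(\<integral>\<^sup>+\<omega>. (\<Sum>n. indicator (\<Phi> i \<omega>) (X n \<omega>) * indicator {0<..} (Y i n \<omega>) *
      (indicator {y. \<beta> * (Ir \<omega> - y) \<le> y} (Y i n \<omega>) * indicator {..<Ir \<omega>} (Tr \<omega>))) \<partial>M)
    = ennreal (c i) * (\<integral>\<^sup>+w\<in>{0<..\<beta> powr (- 2 / \<alpha>)}.
        (\<integral>\<^sup>+\<omega>. ennreal (R \<omega> * exp (- (A * R \<omega> * (1 + w powr (- \<alpha> / 2)) powr (- 2 / \<alpha>)))) \<partial>M) \<partial>lborel)"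
proof -
  let ?y = "\<lambda>u::real. u powr (- \<alpha> / 2)"
  let ?k = "\<lambda>w. (1 + ?y w) powr (- 2 / \<alpha>)"
  let ?F = "indicator {z. \<beta> * (fst (snd z) - ?y (fst z)) \<le> ?y (fst z) \<and> snd (snd z) < fst (snd z)} :: real \<times> real \<times> real \<Rightarrow> ennreal"
  have F: "?F \<in> borel_measurable borel" unfolding borel_prod[symmetric] by measurable
  interpret LM: pair_sigma_finite lborel M ..
  have "(\<integral>\<^sup>+\<omega>. (\<Sum>n. indicator (\<Phi> i \<omega>) (X n \<omega>) * indicator {0<..} (Y i n \<omega>) *
      (indicator {y. \<beta> * (Ir \<omega> - y) \<le> y} (Y i n \<omega>) * indicator {..<Ir \<omega>} (Tr \<omega>))) \<partial>M)
    = (\<integral>\<^sup>+\<omega>. (\<Sum>n. indicator (\<Phi> i \<omega>) (X n \<omega>) * indicator {0<..} (Y i n \<omega>) * ?F (Y i n \<omega> powr (- 2 / \<alpha>), Ir \<omega>, Tr \<omega>)) \<partial>M)"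
  proof (intro nn_integral_cong suminf_cong)
    fix \<omega> n
    have "?y (Y i n \<omega> powr (- 2 / \<alpha>)) = Y i n \<omega>" if "Y i n \<omega> > 0"
      using that \<alpha> by (simp add: powr_powr)
    then show "indicator (\<Phi> i \<omega>) (X n \<omega>) * indicator {0<..} (Y i n \<omega>) *
        (indicator {y. \<beta> * (Ir \<omega> - y) \<le> y} (Y i n \<omega>) * indicator {..<Ir \<omega>} (Tr \<omega>))
      = indicator (\<Phi> i \<omega>) (X n \<omega>) * indicator {0<..} (Y i n \<omega>) * ?F (Y i n \<omega> powr (- 2 / \<alpha>), Ir \<omega>, Tr \<omega>)"
      by (auto split: split_indicator)
  qed
  also have "\<dots> = ennreal (c i) * (\<integral>\<^sup>+u\<in>{0<..}. (\<integral>\<^sup>+\<omega>. (\<integral>\<^sup>+\<omega>'. ?F (u, ?y u + Ir \<omega>, Tr \<omega>') \<partial>M) \<partial>M) \<partial>lborel)"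
    by (rule campbell_joint_law[OF i F])
  also have "(\<integral>\<^sup>+u\<in>{0<..}. (\<integral>\<^sup>+\<omega>. (\<integral>\<^sup>+\<omega>'. ?F (u, ?y u + Ir \<omega>, Tr \<omega>') \<partial>M) \<partial>M) \<partial>lborel)
     = (\<integral>\<^sup>+u. (\<integral>\<^sup>+\<omega>. indicator {0<..} u * (indicator {z. \<beta> * fst z \<le> ?y (snd z)} (Ir \<omega>, u) * ennreal (exp (- (A * (?y u + Ir \<omega>) powr (- 2 / \<alpha>))))) \<partial>M) \<partial>lborel)"
  proof (intro nn_integral_cong)
    fix u :: real
    have "(\<integral>\<^sup>+\<omega>'. ?F (u, ?y u + Ir \<omega>, Tr \<omega>') \<partial>M) = indicator {z. \<beta> * fst z \<le> ?y (snd z)} (Ir \<omega>, u) * ennreal (exp (- (A * (?y u + Ir \<omega>) powr (- 2 / \<alpha>))))"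
      if "u > 0" for \<omega>
    proof -
      have "?F (u, ?y u + Ir \<omega>, Tr \<omega>') = indicator {z. \<beta> * fst z \<le> ?y (snd z)} (Ir \<omega>, u) * indicator {..<?y u + Ir \<omega>} (Tr \<omega>')" for \<omega>'
        by (auto split: split_indicator)
      moreover have "?y u + Ir \<omega> > 0" using that Ir_nonneg[of \<omega>] by (intro add_pos_nonneg) auto
      ultimately show ?thesis by (simp add: nn_integral_cmult Tr_less_prob)
    qed
    then show "(\<integral>\<^sup>+\<omega>. (\<integral>\<^sup>+\<omega>'. ?F (u, ?y u + Ir \<omega>, Tr \<omega>') \<partial>M) \<partial>M) * indicator {0<..} u
      = (\<integral>\<^sup>+\<omega>. indicator {0<..} u * (indicator {z. \<beta> * fst z \<le> ?y (snd z)} (Ir \<omega>, u) * ennreal (exp (- (A * (?y u + Ir \<omega>) powr (- 2 / \<alpha>))))) \<partial>M)"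
      by (cases "u > 0") auto
  qed
  \<comment> \<open>The outcome has to be the outer variable, because the scale factor
    \<open>R \<omega>\<close> depends on it.\<close>
  also have "\<dots> = (\<integral>\<^sup>+\<omega>. (\<integral>\<^sup>+u. indicator {0<..} u * (indicator {z. \<beta> * fst z \<le> ?y (snd z)} (Ir \<omega>, u) * ennreal (exp (- (A * (?y u + Ir \<omega>) powr (- 2 / \<alpha>))))) \<partial>lborel) \<partial>M)"
    by (rule LM.Fubini'[symmetric]) measurable
  also have "\<dots> = (\<integral>\<^sup>+\<omega>. (\<integral>\<^sup>+w. ennreal (R \<omega> * exp (- (A * R \<omega> * ?k w))) * indicator {0<..\<beta> powr (- 2 / \<alpha>)} w \<partial>lborel) \<partial>M)"
  proof (rule nn_integral_cong_AE, use AE_Ir_pos in eventually_elim)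
    fix \<omega> assume Ir: "Ir \<omega> > 0"
    then have R: "R \<omega> > 0" by (simp add: R_def)
    have yR: "?y (R \<omega> * w) = Ir \<omega> * ?y w" if "w > 0" for w
      using that Ir \<alpha> by (simp add: R_def powr_mult powr_powr)
    have "(\<integral>\<^sup>+u. indicator {0<..} u * (indicator {z. \<beta> * fst z \<le> ?y (snd z)} (Ir \<omega>, u) * ennreal (exp (- (A * (?y u + Ir \<omega>) powr (- 2 / \<alpha>))))) \<partial>lborel)
       = (\<integral>\<^sup>+u\<in>{0<..}. indicator {u. \<beta> * Ir \<omega> \<le> ?y u} u * ennreal (exp (- (A * (?y u + Ir \<omega>) powr (- 2 / \<alpha>)))) \<partial>lborel)"
      by (intro nn_integral_cong) (auto split: split_indicator)
    also have "\<dots> = ennreal (R \<omega>) * (\<integral>\<^sup>+w\<in>{0<..}. indicator {u. \<beta> * Ir \<omega> \<le> ?y u} (R \<omega> * w) * ennreal (exp (- (A * (?y (R \<omega> * w) + Ir \<omega>) powr (- 2 / \<alpha>)))) \<partial>lborel)"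
      using R by (intro nn_integral_scale_Ioi) auto
    also have "\<dots> = (\<integral>\<^sup>+w. ennreal (R \<omega>) * (indicator {u. \<beta> * Ir \<omega> \<le> ?y u} (R \<omega> * w) * ennreal (exp (- (A * (?y (R \<omega> * w) + Ir \<omega>) powr (- 2 / \<alpha>)))) * indicator {0<..} w) \<partial>lborel)"
      by (rule nn_integral_cmult[symmetric]) measurable
    also have "\<dots> = (\<integral>\<^sup>+w. ennreal (R \<omega> * exp (- (A * R \<omega> * ?k w))) * indicator {0<..\<beta> powr (- 2 / \<alpha>)} w \<partial>lborel)"
    proof (rule nn_integral_cong)
      fix w :: real
      show "ennreal (R \<omega>) * (indicator {u. \<beta> * Ir \<omega> \<le> ?y u} (R \<omega> * w) * ennreal (exp (- (A * (?y (R \<omega> * w) + Ir \<omega>) powr (- 2 / \<alpha>)))) * indicator {0<..} w)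
        = ennreal (R \<omega> * exp (- (A * R \<omega> * ?k w))) * indicator {0<..\<beta> powr (- 2 / \<alpha>)} w"
      proof (cases "w > 0")
        case True
        have "\<beta> * Ir \<omega> \<le> ?y (R \<omega> * w) \<longleftrightarrow> \<beta> \<le> ?y w"
          using Ir by (simp only: yR[OF True]) (simp add: mult.commute)
        also have "\<dots> \<longleftrightarrow> w \<le> \<beta> powr (- 2 / \<alpha>)"
        proof
          assume "\<beta> \<le> ?y w"
          then have "(?y w) powr (- 2 / \<alpha>) \<le> \<beta> powr (- 2 / \<alpha>)"
            using \<beta> \<alpha> by (intro powr_mono2') auto
          then show "w \<le> \<beta> powr (- 2 / \<alpha>)" by (simp only: powr_area_le_iff[OF True])
        next
          assume "w \<le> \<beta> powr (- 2 / \<alpha>)"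
          then have "?y (\<beta> powr (- 2 / \<alpha>)) \<le> ?y w"
            using True \<alpha> by (intro powr_mono2') auto
          then show "\<beta> \<le> ?y w" using \<beta> \<alpha> by (simp add: powr_powr)
        qed
        finally have iff: "\<beta> * Ir \<omega> \<le> ?y (R \<omega> * w) \<longleftrightarrow> w \<le> \<beta> powr (- 2 / \<alpha>)" .
        have "?y (R \<omega> * w) + Ir \<omega> = Ir \<omega> * (1 + ?y w)"
          by (simp only: yR[OF True]) (simp add: algebra_simps)
        moreover have "(Ir \<omega> * (1 + ?y w)) powr (- 2 / \<alpha>) = R \<omega> * ?k w"
          unfolding R_def by (rule powr_mult)
        ultimately have e: "(?y (R \<omega> * w) + Ir \<omega>) powr (- 2 / \<alpha>) = R \<omega> * ?k w" by simp
        have "ennreal (R \<omega>) * ennreal (exp (- (A * (R \<omega> * ?k w)))) = ennreal (R \<omega> * exp (- (A * R \<omega> * ?k w)))"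
          using R by (simp add: ennreal_mult mult.assoc)
        then show ?thesis unfolding e using True iff by (simp split: split_indicator)
      qed simp
    qed
    finally show "(\<integral>\<^sup>+u. indicator {0<..} u * (indicator {z. \<beta> * fst z \<le> ?y (snd z)} (Ir \<omega>, u) * ennreal (exp (- (A * (?y u + Ir \<omega>) powr (- 2 / \<alpha>))))) \<partial>lborel)
      = (\<integral>\<^sup>+w. ennreal (R \<omega> * exp (- (A * R \<omega> * ?k w))) * indicator {0<..\<beta> powr (- 2 / \<alpha>)} w \<partial>lborel)" .
  qed
  also have "\<dots> = (\<integral>\<^sup>+w. (\<integral>\<^sup>+\<omega>. ennreal (R \<omega> * exp (- (A * R \<omega> * ?k w))) * indicator {0<..\<beta> powr (- 2 / \<alpha>)} w \<partial>M) \<partial>lborel)"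
    by (rule LM.Fubini') measurable
  also have "\<dots> = (\<integral>\<^sup>+w\<in>{0<..\<beta> powr (- 2 / \<alpha>)}. (\<integral>\<^sup>+\<omega>. ennreal (R \<omega> * exp (- (A * R \<omega> * ?k w))) \<partial>M) \<partial>lborel)"
    by (intro nn_integral_cong nn_integral_multc) measurable
  finally show ?thesis .
qed

text \<open>\<open>Gamma p * x powr (- p)\<close> is the mixture of exponentials in
  \<open>nn_integral_powr_exp\<close>. With \<open>p = 2 * m / \<alpha>\<close> the mean over
  \<open>I\<close> is known for each \<open>s\<close>, and \<open>nn_integral_powr_exp_powr\<close>
  evaluates the rest. Since this requires \<open>p > 0\<close>, the case \<open>m = 0\<close> is
  treated apart.\<close>

lemma nn_integral_R_power: "(\<integral>\<^sup>+\<omega>. ennreal (R \<omega> ^ m) \<partial>M) = ennreal (moment m)"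
proof (cases "m = 0")
  case True
  then show ?thesis by (simp add: moment_def emeasure_space_1)
next
  case False
  interpret LM: pair_sigma_finite lborel M ..
  let ?p = "real m * (2 / \<alpha>)"
  have p: "?p > 0" using False \<alpha> by simp
  then have G: "Gamma ?p > 0" by (intro Gamma_real_pos)
  have "ennreal (Gamma ?p) * (\<integral>\<^sup>+\<omega>. ennreal (R \<omega> ^ m) \<partial>M) = (\<integral>\<^sup>+\<omega>. ennreal (Gamma ?p) * ennreal (R \<omega> ^ m) \<partial>M)"
    by (rule nn_integral_cmult[symmetric]) measurable
  also have "\<dots> = (\<integral>\<^sup>+\<omega>. (\<integral>\<^sup>+s. ennreal (s powr (?p - 1) * exp (- (s * Ir \<omega>))) * indicator {0<..} s \<partial>lborel) \<partial>M)"
  proof (rule nn_integral_cong_AE, use AE_Ir_pos in eventually_elim)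
    fix \<omega> assume "Ir \<omega> > 0"
    then have "R \<omega> ^ m = Ir \<omega> powr (- ?p)"
      by (simp add: R_def powr_realpow[symmetric] powr_powr mult.commute)
    then show "ennreal (Gamma ?p) * ennreal (R \<omega> ^ m) = (\<integral>\<^sup>+s. ennreal (s powr (?p - 1) * exp (- (s * Ir \<omega>))) * indicator {0<..} s \<partial>lborel)"
      using nn_integral_powr_exp[OF p \<open>Ir \<omega> > 0\<close>] G by (simp add: ennreal_mult)
  qed
  also have "\<dots> = (\<integral>\<^sup>+s. (\<integral>\<^sup>+\<omega>. ennreal (s powr (?p - 1) * exp (- (s * Ir \<omega>))) * indicator {0<..} s \<partial>M) \<partial>lborel)"
    by (rule LM.Fubini') measurable
  also have "\<dots> = (\<integral>\<^sup>+s\<in>{0<..}. ennreal (s powr (?p - 1) * exp (- (\<eta> * s powr (2 / \<alpha>)))) \<partial>lborel)"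
  proof (rule nn_integral_cong)
    fix s :: real
    show "(\<integral>\<^sup>+\<omega>. ennreal (s powr (?p - 1) * exp (- (s * Ir \<omega>))) * indicator {0<..} s \<partial>M)
      = ennreal (s powr (?p - 1) * exp (- (\<eta> * s powr (2 / \<alpha>)))) * indicator {0<..} s"
    proof (cases "s > 0")
      case True
      then have "(\<integral>\<^sup>+\<omega>. ennreal (s powr (?p - 1)) * ennreal (exp (- (s * Ir \<omega>))) \<partial>M) = ennreal (s powr (?p - 1)) * ennreal (exp (- (\<eta> * s powr (2 / \<alpha>))))"
        by (subst nn_integral_cmult) (auto simp: laplace_Ir)
      then show ?thesis using True by (simp add: ennreal_mult)
    qed simp
  qed
  also have "\<dots> = ennreal (fact m / (?p * \<eta> ^ m))"
    using nn_integral_powr_exp_powr[of "2 / \<alpha>" \<eta> m] \<alpha> \<eta>_pos False by simp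
  finally have eq: "ennreal (Gamma ?p) * (\<integral>\<^sup>+\<omega>. ennreal (R \<omega> ^ m) \<partial>M) = ennreal (fact m / (?p * \<eta> ^ m))" .
  have "?p \<notin> \<int>\<^sub>\<le>\<^sub>0" using p nonpos_Ints_nonpos[of ?p] by linarith
  \<comment> \<open>The functional equation absorbs the factor \<open>?p\<close> of the denominator
    into the Gamma function of \<open>moment\<close>.\<close>
  then have "Gamma (1 + ?p) = ?p * Gamma ?p"
    using Gamma_plus1[of ?p] by (simp add: add.commute)
  note Gp = this
  have "x / (q * z) = y * (x / (q * y * z))" if "y \<noteq> 0" for x y z q :: real
    using that by simp
  from this[of "Gamma ?p"] have "fact m / (?p * \<eta> ^ m) = Gamma ?p * moment m"
    unfolding moment_def Gp using G by simp
  then have "ennreal (Gamma ?p) * (\<integral>\<^sup>+\<omega>. ennreal (R \<omega> ^ m) \<partial>M) = ennreal (Gamma ?p) * ennreal (moment m)"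
    using eq G by (simp add: ennreal_mult')
  then show ?thesis using G by (simp add: ennreal_mult_cancel_left)
qed

lemma moment_nonneg: "moment m \<ge> 0"
proof -
  have "Gamma (1 + real m * (2 / \<alpha>)) > 0" using \<alpha> by (intro Gamma_real_pos add_pos_nonneg) auto
  then show ?thesis using \<eta>_pos by (auto simp: moment_def)
qed

lemma R_power_integrable: "integrable M (\<lambda>\<omega>. R \<omega> ^ m)"
  and expectation_R_power: "expectation (\<lambda>\<omega>. R \<omega> ^ m) = moment m"
proof -
  have "has_bochner_integral M (\<lambda>\<omega>. R \<omega> ^ m) (moment m)"
    by (rule has_bochner_integral_nn_integral) (auto simp: R_nonneg moment_nonneg nn_integral_R_power)
  then show "integrable M (\<lambda>\<omega>. R \<omega> ^ m)" "expectation (\<lambda>\<omega>. R \<omega> ^ m) = moment m"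
    by (auto simp: has_bochner_integral_iff)
qed

lemma summable_moments: "summable (\<lambda>m. a ^ m / fact m * moment (m + e))" if "e \<le> 1" "a \<ge> 0"
proof (rule summable_comparison_test')
  have "a / \<eta> \<ge> 0" using that \<eta>_pos by simp
  then show "summable (\<lambda>m. (1 / \<eta> ^ e) * (real (Suc m) * (a / \<eta>) ^ m / Gamma (1 + real (m + e) * (2 / \<alpha>))))"
    using \<alpha> by (intro summable_mult summable_Mittag_Leffler) auto
  fix m
  have G: "Gamma (1 + real (m + e) * (2 / \<alpha>)) > 0" using \<alpha> by (intro Gamma_real_pos add_pos_nonneg) auto
  \<comment> \<open>This quotient is \<open>1\<close> for \<open>e = 0\<close> and
    \<open>m + 1\<close> for \<open>e = 1\<close>, whence the factor \<open>Suc m\<close> in the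
    majorant.\<close>
  have "fact (m + e) / fact m \<le> real (Suc m)"
    using that(1) by (cases e) (auto simp: le_Suc_eq)
  then have "(a / \<eta>) ^ m / \<eta> ^ e / Gamma (1 + real (m + e) * (2 / \<alpha>)) * (fact (m + e) / fact m)
      \<le> (a / \<eta>) ^ m / \<eta> ^ e / Gamma (1 + real (m + e) * (2 / \<alpha>)) * real (Suc m)"
    using G that \<eta>_pos by (intro mult_left_mono) auto
  moreover have "a ^ m / fact m * moment (m + e) = (a / \<eta>) ^ m / \<eta> ^ e / Gamma (1 + real (m + e) * (2 / \<alpha>)) * (fact (m + e) / fact m)"
    by (simp add: moment_def power_add power_divide)
  moreover have "a ^ m / fact m * moment (m + e) \<ge> 0" using that moment_nonneg by auto
  ultimately show "norm (a ^ m / fact m * moment (m + e)) \<le> (1 / \<eta> ^ e) * (real (Suc m) * (a / \<eta>) ^ m / Gamma (1 + real (m + e) * (2 / \<alpha>)))"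
    by (simp add: mult_ac)
qed

text \<open>\<open>e = 0\<close> serves the idle event, \<open>e = 1\<close> the Campbell term.
  Termwise integration is justified by absolute summability: up to a geometric factor,
  \<open>moment m / fact m\<close> is the reciprocal of \<open>Gamma (1 + 2 * m / \<alpha>)\<close>,
  so the series converges for every ratio \<open>A / \<eta>\<close>.\<close>

lemma expectation_R_exp:
  assumes k: "0 \<le> k" and e: "e \<le> 1"
  shows "integrable M (\<lambda>\<omega>. R \<omega> ^ e * exp (- (A * R \<omega> * k)))"
    and "expectation (\<lambda>\<omega>. R \<omega> ^ e * exp (- (A * R \<omega> * k))) = (\<Sum>m. (- A) ^ m / fact m * moment (m + e) * k ^ m)"
proof -
  let ?f = "\<lambda>m \<omega>. (- (A * k)) ^ m / fact m * R \<omega> ^ (m + e)"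
  have int: "integrable M (?f m)" for m using R_power_integrable by simp
  have expand: "(\<lambda>m. ?f m \<omega>) sums (R \<omega> ^ e * exp (- (A * R \<omega> * k)))" for \<omega>
  proof -
    have "(\<lambda>m. R \<omega> ^ e * (inverse (fact m) *\<^sub>R (- (A * R \<omega> * k)) ^ m)) sums (R \<omega> ^ e * exp (- (A * R \<omega> * k)))"
      by (intro sums_mult exp_converges)
    also have "(\<lambda>m. R \<omega> ^ e * (inverse (fact m) *\<^sub>R (- (A * R \<omega> * k)) ^ m)) = (\<lambda>m. ?f m \<omega>)"
    proof
      fix m
      have "(- (A * R \<omega> * k)) ^ m = (- (A * k)) ^ m * R \<omega> ^ m"
        by (simp add: power_mult_distrib[symmetric] mult_ac)
      then show "R \<omega> ^ e * (inverse (fact m) *\<^sub>R (- (A * R \<omega> * k)) ^ m) = ?f m \<omega>"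
        by (simp add: power_add divide_inverse mult_ac)
    qed
    finally show ?thesis .
  qed
  have nf: "norm (?f m \<omega>) = (A * k) ^ m / fact m * R \<omega> ^ (m + e)" for m \<omega>
    using A_nonneg k R_nonneg[of \<omega>] by (simp add: abs_mult power_abs)
  have s1: "AE \<omega> in M. summable (\<lambda>m. norm (?f m \<omega>))"
  proof (rule AE_I2)
    fix \<omega>
    have sm: "summable (\<lambda>m. R \<omega> ^ e * (inverse (fact m) *\<^sub>R (A * k * R \<omega>) ^ m))"
      by (intro summable_mult summable_exp_generic)
    have eq: "(\<lambda>m. R \<omega> ^ e * (inverse (fact m) *\<^sub>R (A * k * R \<omega>) ^ m)) = (\<lambda>m. norm (?f m \<omega>))"
      unfolding nf by (simp add: power_add power_mult_distrib divide_inverse mult_ac fun_eq_iff)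
    show "summable (\<lambda>m. norm (?f m \<omega>))" using sm unfolding eq .
  qed
  have s2: "summable (\<lambda>m. expectation (\<lambda>\<omega>. norm (?f m \<omega>)))"
    unfolding nf using summable_moments[OF e, of "A * k"] A_nonneg k by (simp add: expectation_R_power)
  have suminf: "(\<lambda>\<omega>. \<Sum>m. ?f m \<omega>) = (\<lambda>\<omega>. R \<omega> ^ e * exp (- (A * R \<omega> * k)))"
    using expand by (simp add: sums_iff fun_eq_iff)
  show "integrable M (\<lambda>\<omega>. R \<omega> ^ e * exp (- (A * R \<omega> * k)))"
    using integrable_suminf[OF int s1 s2] unfolding suminf .
  have "expectation (\<lambda>\<omega>. R \<omega> ^ e * exp (- (A * R \<omega> * k))) = (\<Sum>m. expectation (?f m))"
    using integral_suminf[OF int s1 s2] unfolding suminf .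
  also have "\<dots> = (\<Sum>m. (- A) ^ m / fact m * moment (m + e) * k ^ m)"
  proof (intro suminf_cong)
    fix m
    have "(- (A * k)) ^ m = (- A) ^ m * k ^ m" by (simp add: power_mult_distrib[symmetric])
    then show "expectation (?f m) = (- A) ^ m / fact m * moment (m + e) * k ^ m"
      by (simp add: expectation_R_power)
  qed
  finally show "expectation (\<lambda>\<omega>. R \<omega> ^ e * exp (- (A * R \<omega> * k))) = (\<Sum>m. (- A) ^ m / fact m * moment (m + e) * k ^ m)" .
qed

text \<open>At \<open>m = 0\<close> the second parameter of \<open>hyp2F1\<close> is
  \<open>0\<close>, and its prefactor divides by \<open>Gamma 0\<close>, which is \<open>0\<close>
  in HOL. The integral is then just the length of the interval, whence the separate case.\<close>

definition J_int :: "real \<Rightarrow> nat \<Rightarrow> real" where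
  "J_int \<beta> m = (if m = 0 then \<beta> powr (- 2 / \<alpha>) else
     \<beta> powr (- 2 / \<alpha>) * hyp2F1 1 (2 * real m / \<alpha>) (1 + 2 * (real m + 1) / \<alpha>) (1 / (1 + \<beta>)) /
       (1 + \<beta>) powr (2 * real m / \<alpha>) / real (m + 1))"

lemma nn_integral_J_int:
  assumes "\<beta> > 0"
  shows "(\<integral>\<^sup>+w. ennreal (((1 + w powr (- \<alpha> / 2)) powr (- 2 / \<alpha>)) ^ m * indicator {0<..\<beta> powr (- 2 / \<alpha>)} w) \<partial>lborel) = ennreal (J_int \<beta> m)"
proof -
  have "((1 + w powr (- \<alpha> / 2)) powr (- 2 / \<alpha>)) ^ m = (1 + w powr (- 1 / (2 / \<alpha>))) powr (- (real m * (2 / \<alpha>)))" for w :: real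
  proof -
    have "1 + w powr (- \<alpha> / 2) > 0" by (intro add_pos_nonneg) auto
    then have "((1 + w powr (- \<alpha> / 2)) powr (- 2 / \<alpha>)) ^ m = (1 + w powr (- \<alpha> / 2)) powr (- (real m * (2 / \<alpha>)))"
      by (simp add: powr_realpow[symmetric] powr_powr mult.commute)
    then show ?thesis by simp
  qed
  then have "(\<integral>\<^sup>+w. ennreal (((1 + w powr (- \<alpha> / 2)) powr (- 2 / \<alpha>)) ^ m * indicator {0<..\<beta> powr (- 2 / \<alpha>)} w) \<partial>lborel)
     = (\<integral>\<^sup>+w\<in>{0<..\<beta> powr (- (2 / \<alpha>))}. ennreal ((1 + w powr (- 1 / (2 / \<alpha>))) powr (- (real m * (2 / \<alpha>)))) \<partial>lborel)"
    by (intro nn_integral_cong) (auto split: split_indicator)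
  also have "\<dots> = ennreal (J_int \<beta> m)"
  proof (cases "m = 0")
    case True
    have "(1 + w powr (- 1 / (2 / \<alpha>))) powr 0 = 1" for w :: real
      using powr_ge_zero[of w "- 1 / (2 / \<alpha>)"] by (auto simp: powr_zero_eq_one simp del: powr_ge_zero)
    then show ?thesis using True by (simp add: J_int_def)
  next
    case False
    then show ?thesis
      using nn_integral_interference_hyp2F1[of "2 / \<alpha>" \<beta> m] assms \<alpha> by (simp add: J_int_def mult_ac add_ac)
  qed
  finally show ?thesis .
qed

lemma J_int_bounds:
  assumes "\<beta> > 0"
  shows "J_int \<beta> m \<le> \<beta> powr (- 2 / \<alpha>)"
proof -
  have "ennreal (J_int \<beta> m) \<le> (\<integral>\<^sup>+w. indicator {0<..\<beta> powr (- 2 / \<alpha>)} w \<partial>lborel)"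
    unfolding nn_integral_J_int[OF assms, symmetric]
  proof (intro nn_integral_mono)
    fix w :: real
    have "(1 + w powr (- \<alpha> / 2)) powr (- 2 / \<alpha>) \<le> 1 powr (- 2 / \<alpha>)"
      using \<alpha> by (intro powr_mono2') auto
    then have "((1 + w powr (- \<alpha> / 2)) powr (- 2 / \<alpha>)) ^ m \<le> 1" by (intro power_le_one) auto
    then show "ennreal (((1 + w powr (- \<alpha> / 2)) powr (- 2 / \<alpha>)) ^ m * indicator {0<..\<beta> powr (- 2 / \<alpha>)} w) \<le> indicator {0<..\<beta> powr (- 2 / \<alpha>)} w"
      by (auto split: split_indicator)
  qed
  also have "\<dots> = ennreal (\<beta> powr (- 2 / \<alpha>))" by simp
  finally show ?thesis by simp
qed

text \<open>\<open>nn_integral_J_int\<close> alone leaves the sign open, since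
  \<open>ennreal\<close> sends negative reals to \<open>0\<close>. A negative value would make the
  integral of a positive function over an interval of positive length vanish.\<close>

lemma J_int_nonneg: "\<beta> > 0 \<Longrightarrow> J_int \<beta> m \<ge> 0"
proof (rule ccontr)
  assume \<beta>: "\<beta> > 0" and neg: "\<not> J_int \<beta> m \<ge> 0"
  let ?f = "\<lambda>w::real. ((1 + w powr (- \<alpha> / 2)) powr (- 2 / \<alpha>)) ^ m * indicator {0<..\<beta> powr (- 2 / \<alpha>)} w"
  have "(\<integral>\<^sup>+w. ennreal (?f w) \<partial>lborel) = 0"
    using nn_integral_J_int[OF \<beta>, of m] neg by (simp add: ennreal_neg)
  then have "AE w in lborel. ennreal (?f w) = 0"
    by (subst (asm) nn_integral_0_iff_AE) auto
  then have "AE w in lborel. w \<notin> {0<..\<beta> powr (- 2 / \<alpha>)}"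
  proof eventually_elim
    case (elim w)
    have "1 + w powr (- \<alpha> / 2) > 0" by (intro add_pos_nonneg) auto
    then show ?case using elim by (auto split: split_indicator_asm simp: ennreal_eq_0_iff not_le zero_less_power dest: leD)
  qed
  then have "emeasure lborel {0<..\<beta> powr (- 2 / \<alpha>)} = 0"
    by (subst (asm) AE_iff_null_sets[symmetric]) (auto simp: null_sets_def)
  then show False using \<beta> by simp
qed

text \<open>\<open>expectation_R_exp\<close> is integrated termwise in \<open>w\<close>. The
  coefficients are absolutely summable and \<open>J_int\<close> is bounded by the length of the
  interval, uniformly in \<open>m\<close>; the sign of the sum is needed to return from
  \<open>ennreal\<close> to real numbers.\<close>

lemma active_covered_value:
  assumes i: "i \<in> Ac" and \<beta>: "\<beta> > 0"
  shows "summable (\<lambda>m. (- A) ^ m / fact m * moment (m + 1) * J_int \<beta> m)"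
    and "(\<integral>\<^sup>+\<omega>. (\<Sum>n. indicator (\<Phi> i \<omega>) (X n \<omega>) * indicator {0<..} (Y i n \<omega>) *
      (indicator {y. \<beta> * (Ir \<omega> - y) \<le> y} (Y i n \<omega>) * indicator {..<Ir \<omega>} (Tr \<omega>))) \<partial>M)
    = ennreal (c i * (\<Sum>m. (- A) ^ m / fact m * moment (m + 1) * J_int \<beta> m))"
    and "(\<Sum>m. (- A) ^ m / fact m * moment (m + 1) * J_int \<beta> m) \<ge> 0"
proof -
  let ?a = "\<lambda>m. (- A) ^ m / fact m * moment (m + 1)"
  let ?w1 = "\<beta> powr (- 2 / \<alpha>)"
  let ?k = "\<lambda>w::real. (1 + w powr (- \<alpha> / 2)) powr (- 2 / \<alpha>)"
  let ?f = "\<lambda>m w. ?a m * (?k w ^ m * indicator {0<..?w1} w)"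
  have k01: "0 \<le> ?k w" "?k w \<le> 1" for w
  proof -
    have "?k w \<le> 1 powr (- 2 / \<alpha>)" using \<alpha> by (intro powr_mono2') auto
    then show "0 \<le> ?k w" "?k w \<le> 1" by auto
  qed
  have "has_bochner_integral lborel (\<lambda>w. ?k w ^ m * indicator {0<..?w1} w) (J_int \<beta> m)" for m
    using k01 J_int_nonneg[OF \<beta>] nn_integral_J_int[OF \<beta>]
    by (intro has_bochner_integral_nn_integral) (auto intro!: AE_I2 mult_nonneg_nonneg split: split_indicator)
  then have kint: "integrable lborel (\<lambda>w. ?k w ^ m * indicator {0<..?w1} w)"
    and kval: "(\<integral>w. ?k w ^ m * indicator {0<..?w1} w \<partial>lborel) = J_int \<beta> m" for m
    by (auto simp: has_bochner_integral_iff)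
  have abs_a: "\<bar>?a m\<bar> = A ^ m / fact m * moment (m + 1)" for m
    using A_nonneg moment_nonneg[of "m + 1"] by (simp add: abs_mult power_abs)
  have sum_a: "summable (\<lambda>m. \<bar>?a m\<bar>)"
    unfolding abs_a using summable_moments[of 1 A] A_nonneg by simp
  have int: "integrable lborel (?f m)" for m using kint by simp
  have nf: "norm (?f m w) = \<bar>?a m\<bar> * (?k w ^ m * indicator {0<..?w1} w)" for m w
    using k01[of w] by (simp only: real_norm_def abs_mult) (auto split: split_indicator)
  have s1: "AE w in lborel. summable (\<lambda>m. norm (?f m w))"
  proof (rule AE_I2, rule summable_comparison_test'[OF sum_a])
    fix w m
    have "?k w ^ m * indicator {0<..?w1} w \<le> 1"
      using k01[of w] by (auto intro: power_le_one split: split_indicator)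
    then show "norm (norm (?f m w)) \<le> \<bar>?a m\<bar>"
      unfolding nf using k01[of w] mult_left_mono[of _ 1 "\<bar>?a m\<bar>"] by (simp add: abs_mult)
  qed
  have s2: "summable (\<lambda>m. \<integral>w. norm (?f m w) \<partial>lborel)"
  proof (rule summable_comparison_test')
    show "summable (\<lambda>m. \<bar>?a m\<bar> * ?w1)" using sum_a by (rule summable_mult2)
    fix m
    have v: "(\<integral>w. norm (?f m w) \<partial>lborel) = \<bar>?a m\<bar> * J_int \<beta> m"
      unfolding nf by (simp only: integral_mult_right_zero kval)
    show "norm (\<integral>w. norm (?f m w) \<partial>lborel) \<le> \<bar>?a m\<bar> * ?w1"
    proof (subst v)
      have "norm (\<bar>?a m\<bar> * J_int \<beta> m) = \<bar>?a m\<bar> * J_int \<beta> m"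
        using J_int_nonneg[OF \<beta>, of m] by (simp only: real_norm_def abs_mult[of "\<bar>?a m\<bar>"] abs_abs abs_of_nonneg)
      then show "norm (\<bar>?a m\<bar> * J_int \<beta> m) \<le> \<bar>?a m\<bar> * ?w1"
        using mult_left_mono[OF J_int_bounds[OF \<beta>, of m], of "\<bar>?a m\<bar>"] by (simp only: abs_ge_zero)
    qed
  qed
  show summ: "summable (\<lambda>m. ?a m * J_int \<beta> m)"
  proof (rule summable_comparison_test')
    show "summable (\<lambda>m. \<bar>?a m\<bar> * ?w1)" using sum_a by (rule summable_mult2)
    show "norm (?a m * J_int \<beta> m) \<le> \<bar>?a m\<bar> * ?w1" for m
    proof -
      have "norm (?a m * J_int \<beta> m) = \<bar>?a m\<bar> * J_int \<beta> m"
        using J_int_nonneg[OF \<beta>, of m] by (simp only: real_norm_def abs_mult[of "?a m"] abs_of_nonneg)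
      then show ?thesis
        using mult_left_mono[OF J_int_bounds[OF \<beta>, of m], of "\<bar>?a m\<bar>"] by (simp only: abs_ge_zero)
    qed
  qed
  let ?E = "\<lambda>w. expectation (\<lambda>\<omega>. R \<omega> * exp (- (A * R \<omega> * ?k w)))"
  have E: "?E w = (\<Sum>m. ?a m * ?k w ^ m)" and E_int: "integrable M (\<lambda>\<omega>. R \<omega> * exp (- (A * R \<omega> * ?k w)))" for w
    using expectation_R_exp[of "?k w" 1] k01[of w] by simp_all
  have E_nn: "?E w \<ge> 0" for w using R_nonneg by (intro Bochner_Integration.integral_nonneg) auto
  have f_sum: "(\<Sum>m. ?f m w) = ?E w * indicator {0<..?w1} w" for w
  proof (cases "w \<in> {0<..?w1}")
    case True
    then have "(\<Sum>m. ?f m w) = (\<Sum>m. ?a m * ?k w ^ m)" by (intro suminf_cong) simp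
    also have "\<dots> = ?E w" by (rule E[symmetric])
    finally show ?thesis using True by simp
  qed simp
  have G_int: "integrable lborel (\<lambda>w. ?E w * indicator {0<..?w1} w)"
    using integrable_suminf[OF int s1 s2] unfolding f_sum .
  have G_val: "(\<integral>w. ?E w * indicator {0<..?w1} w \<partial>lborel) = (\<Sum>m. ?a m * J_int \<beta> m)"
    using integral_suminf[OF int s1 s2] unfolding f_sum by (simp only: integral_mult_right_zero kval)
  show nn: "(\<Sum>m. ?a m * J_int \<beta> m) \<ge> 0"
    unfolding G_val[symmetric] using E_nn by (intro Bochner_Integration.integral_nonneg) (auto split: split_indicator)
  have "(\<integral>\<^sup>+w\<in>{0<..?w1}. (\<integral>\<^sup>+\<omega>. ennreal (R \<omega> * exp (- (A * R \<omega> * ?k w))) \<partial>M) \<partial>lborel)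
      = (\<integral>\<^sup>+w. ennreal (?E w * indicator {0<..?w1} w) \<partial>lborel)"
  proof (rule nn_integral_cong)
    fix w
    have "(\<integral>\<^sup>+\<omega>. ennreal (R \<omega> * exp (- (A * R \<omega> * ?k w))) \<partial>M) = ennreal (?E w)"
      using E_int R_nonneg by (intro nn_integral_eq_integral) auto
    then show "(\<integral>\<^sup>+\<omega>. ennreal (R \<omega> * exp (- (A * R \<omega> * ?k w))) \<partial>M) * indicator {0<..?w1} w = ennreal (?E w * indicator {0<..?w1} w)"
      by (auto split: split_indicator)
  qed
  also have "\<dots> = ennreal (\<Sum>m. ?a m * J_int \<beta> m)"
    unfolding G_val[symmetric] using G_int E_nn by (intro nn_integral_eq_integral) (auto split: split_indicator)
  finally show "(\<integral>\<^sup>+\<omega>. (\<Sum>n. indicator (\<Phi> i \<omega>) (X n \<omega>) * indicator {0<..} (Y i n \<omega>) *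
      (indicator {y. \<beta> * (Ir \<omega> - y) \<le> y} (Y i n \<omega>) * indicator {..<Ir \<omega>} (Tr \<omega>))) \<partial>M)
    = ennreal (c i * (\<Sum>m. ?a m * J_int \<beta> m))"
    unfolding active_covered_integral[OF i \<beta>] using nn i Ac c_nonneg[of i] by (simp add: ennreal_mult subset_iff)
qed

lemma idle_uncovered_value:
  "(\<integral>\<^sup>+\<omega>. indicator {..<Ir \<omega>} (Tr \<omega>) \<partial>M) = ennreal (\<Sum>m. (- A) ^ m / fact m * moment m)"
  "summable (\<lambda>m. (- A) ^ m / fact m * moment m)" "(\<Sum>m. (- A) ^ m / fact m * moment m) \<ge> 0"
proof -
  have val: "expectation (\<lambda>\<omega>. exp (- (A * R \<omega>))) = (\<Sum>m. (- A) ^ m / fact m * moment m)" and int: "integrable M (\<lambda>\<omega>. exp (- (A * R \<omega>)))"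
    using expectation_R_exp[of 1 0] by simp_all
  show "(\<integral>\<^sup>+\<omega>. indicator {..<Ir \<omega>} (Tr \<omega>) \<partial>M) = ennreal (\<Sum>m. (- A) ^ m / fact m * moment m)"
    unfolding idle_uncovered_prob val[symmetric] by (intro nn_integral_eq_integral int) simp
  show "(\<Sum>m. (- A) ^ m / fact m * moment m) \<ge> 0"
    unfolding val[symmetric] by (intro Bochner_Integration.integral_nonneg) simp
  show "summable (\<lambda>m. (- A) ^ m / fact m * moment m)"
  proof (rule summable_norm_cancel)
    have "norm ((- A) ^ m / fact m * moment m) = A ^ m / fact m * moment (m + 0)" for m
      using A_nonneg moment_nonneg[of m] by (simp add: abs_mult power_abs)
    then show "summable (\<lambda>m. norm ((- A) ^ m / fact m * moment m))"
      using summable_moments[of 0 A] A_nonneg by simp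
  qed
qed

end

section \<open>The coverage event\<close>

text \<open>With \<open>x = 2 / \<alpha>\<close> and a further factor \<open>pi\<close> this is
  \<open>C_const \<alpha>\<close>: the Gamma factor of the intensity and that of the stable exponent
  combine by the reflection formula.\<close>

lemma Gamma_reflection_real_plus1:
  fixes x :: real
  assumes "0 < x" "x < 1"
  shows "Gamma (1 + x) * Gamma (1 - x) = pi * x / sin (pi * x)"
proof -
  have "complex_of_real (Gamma x * Gamma (1 - x)) = Gamma (complex_of_real x) * Gamma (complex_of_real (1 - x))"
    by (simp only: Gamma_complex_of_real of_real_mult)
  also have "\<dots> = complex_of_real pi / sin (complex_of_real pi * complex_of_real x)"
    using Gamma_reflection_complex[of "complex_of_real x"] by simp
  also have "\<dots> = complex_of_real (pi / sin (pi * x))"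
    by (simp only: of_real_divide sin_of_real[symmetric] of_real_mult)
  finally have "complex_of_real (Gamma x * Gamma (1 - x)) = complex_of_real (pi / sin (pi * x))" .
  then have "Gamma x * Gamma (1 - x) = pi / sin (pi * x)"
    by (simp only: of_real_eq_iff)
  moreover have "x \<notin> \<int>\<^sub>\<le>\<^sub>0" using assms nonpos_Ints_nonpos[of x] by linarith
  then have "Gamma (1 + x) = x * Gamma x"
    using Gamma_plus1[of x] by (simp add: add.commute)
  ultimately show ?thesis by (simp add: mult_ac)
qed

lemma infsum_enumeration:
  fixes f :: "'a \<Rightarrow> ennreal"
  assumes "inj x" "S \<subseteq> range x"
  shows "(\<Sum>\<^sub>\<infinity>y\<in>S. f y) = (\<Sum>n. f (x n) * indicator S (x n))"
proof -
  have S: "S = x ` (x -` S)" using assms(2) by auto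
  have "(\<Sum>\<^sub>\<infinity>y\<in>S. f y) = (\<Sum>\<^sub>\<infinity>y\<in>x ` (x -` S). f y)" by (subst S) simp
  also have "\<dots> = (\<Sum>\<^sub>\<infinity>n\<in>x -` S. f (x n))"
    using assms(1) by (subst infsum_reindex) (auto simp: o_def inj_on_def)
  also have "\<dots> = (\<Sum>\<^sub>\<infinity>n. f (x n) * indicator S (x n))"
    by (intro infsum_cong_neutral) auto
  also have "\<dots> = (\<Sum>n. f (x n) * indicator S (x n))"
  proof -
    have "((\<lambda>n. f (x n) * indicator S (x n)) has_sum (\<Sum>\<^sub>\<infinity>n. f (x n) * indicator S (x n))) UNIV"
      by (intro has_sum_infsum nonneg_summable_on_complete) auto
    then show ?thesis using has_sum_imp_sums sums_unique by blast
  qed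
  finally show ?thesis .
qed

lemma SUP_enumeration:
  fixes f :: "'a \<Rightarrow> ennreal"
  assumes "S \<subseteq> range x"
  shows "(SUP y\<in>S. f y) = (SUP n. f (x n) * indicator S (x n))"
proof (rule antisym)
  show "(SUP y\<in>S. f y) \<le> (SUP n. f (x n) * indicator S (x n))"
  proof (rule SUP_least)
    fix y assume "y \<in> S"
    then obtain n where "y = x n" using assms by auto
    then show "f y \<le> (SUP n. f (x n) * indicator S (x n))"
      using \<open>y \<in> S\<close> by (intro SUP_upper2[of n]) auto
  qed
  show "(SUP n. f (x n) * indicator S (x n)) \<le> (SUP y\<in>S. f y)"
    by (rule SUP_least) (auto split: split_indicator intro: SUP_upper)
qed

text \<open>As \<open>\<beta> i > 1\<close>, a station \<open>n\<close> of tier \<open>i\<close> with \<open>\<beta> i * (S - z i n) \<le> z i n\<close> is stronger than all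
  others together, so at most one such station exists. A supremum that is not attained can be
  approximated by two different stations and therefore counts twice in the total.\<close>

lemma no_coverage_indicator:
  fixes z :: "nat \<Rightarrow> nat \<Rightarrow> ennreal" and \<beta> :: "nat \<Rightarrow> real" and I B :: "nat set"
  defines "S \<equiv> (\<Sum>n. \<Sum>i\<in>I. z i n)"
  assumes I: "finite I" "B \<subseteq> I" and \<beta>: "\<And>i. i \<in> I \<Longrightarrow> \<beta> i > 1" and S: "0 < S" "S < \<top>"
  shows "(\<Prod>i\<in>B. of_bool ((SUP n. z i n) / (S - Max ((\<lambda>i. SUP n. z i n) ` I)) < ennreal (\<beta> i)))
    + (\<Sum>i\<in>B. \<Sum>n. of_bool (0 < z i n \<and> ennreal (\<beta> i) * (S - z i n) \<le> z i n)) = (1 :: ennreal)"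
proof -
  define good where "good i n \<longleftrightarrow> 0 < z i n \<and> ennreal (\<beta> i) * (S - z i n) \<le> z i n" for i n
  define m where "m i = (SUP n. z i n)" for i
  define Mx where "Mx = Max (m ` I)"
  have finB: "finite B" using I finite_subset by blast
  have two: "z i n + z j k \<le> S" if "i \<in> I" "j \<in> I" "(i, n) \<noteq> (j, k)" for i j n k
  proof -
    have "z i n + z j k = (\<Sum>(i', n')\<in>{(i, n), (j, k)}. z i' n')" using that by simp
    also have "\<dots> \<le> (\<Sum>(i', n')\<in>I \<times> {..max n k}. z i' n')"
      using that I by (intro sum_mono2) auto
    also have "\<dots> = (\<Sum>n'\<le>max n k. \<Sum>i'\<in>I. z i' n')"
      by (subst sum.cartesian_product[symmetric], rule sum.swap)
    also have "\<dots> \<le> S" unfolding S_def by (rule sum_le_suminf) auto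
    finally show ?thesis .
  qed
  have one: "z i n \<le> S" if "i \<in> I" for i n
  proof -
    have "z i n + 0 \<le> z i n + z i (Suc n)" by (intro add_left_mono) auto
    also have "\<dots> \<le> S" using that by (intro two) auto
    finally show ?thesis by simp
  qed
  have z_fin: "z i n < \<top>" if "i \<in> I" for i n using one[OF that] S(2) by (rule order_le_less_trans)
  have m_Mx: "m i \<le> Mx" if "i \<in> I" for i unfolding Mx_def using that I by auto
  have z_m: "z i n \<le> m i" for i n unfolding m_def by (rule SUP_upper) simp
  have Mx_least: "Mx \<le> a" if "\<And>i n. i \<in> I \<Longrightarrow> z i n \<le> a" "I \<noteq> {}" for a
    unfolding Mx_def using that I by (auto simp: m_def intro!: SUP_least)
  have I_ne: "I \<noteq> {}" using S(1) unfolding S_def by auto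
  \<comment> \<open>The threshold \<open>r > 1\<close> makes a weak bound strict; for
    \<open>a = 0\<close> positivity of \<open>b\<close> is used instead.\<close>
  have lt: "a < b" if r: "ennreal r * a \<le> b" "r > 1" "0 < b" "a < \<top>" for a b r
  proof (cases "a = 0")
    case False
    obtain x where x: "a = ennreal x" "x > 0" using r(4) False by (cases a) (auto simp: less_le)
    then have "a < ennreal (r * x)" using r(2) by (simp add: ennreal_lessI)
    also have "\<dots> = ennreal r * a" using r(2) x by (simp add: ennreal_mult)
    finally show ?thesis using r(1) by (rule order_less_le_trans)
  qed (use r in simp)
  have dominate: "z j k < z i n" if g: "good i n" and ij: "i \<in> I" "j \<in> I" "(i, n) \<noteq> (j, k)" for i j n k
  proof -
    have "z j k + z i n \<le> S" using two[of j i k n] ij by auto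
    then have "z j k \<le> S - z i n" by (simp add: ennreal_le_minus_iff)
    also have "S - z i n < z i n"
    proof (rule lt)
      show "ennreal (\<beta> i) * (S - z i n) \<le> z i n" "0 < z i n"
        using g by (simp_all add: good_def)
      show "1 < \<beta> i" by (rule \<beta>[OF ij(1)])
      show "S - z i n < \<top>" using S(2) by (rule order_le_less_trans[OF diff_le_self_ennreal])
    qed
    finally show ?thesis .
  qed
  show ?thesis
  proof (cases "\<exists>i\<in>B. \<exists>n. good i n")
    case True
    then obtain i n where i: "i \<in> B" "i \<in> I" and g: "good i n" using I by blast
    have uniq: "good j k \<longleftrightarrow> j = i \<and> k = n" if "j \<in> I" for j k
    proof
      assume "good j k"
      show "j = i \<and> k = n"
      proof (rule ccontr)
        assume "\<not> (j = i \<and> k = n)"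
        then have "z j k < z i n" "z i n < z j k"
          using dominate[OF g i(2) that, of k] dominate[OF \<open>good j k\<close> that i(2), of n] by auto
        then show False by simp
      qed
    qed (use g in simp)
    have "(\<Sum>k. of_bool (good j k)) = (if j = i then 1 else 0 :: ennreal)" if "j \<in> B" for j
    proof -
      have "(\<Sum>k. of_bool (good j k) :: ennreal) = (\<Sum>k\<in>{n}. of_bool (good j k))"
        using uniq[of j] that I by (intro suminf_finite) auto
      then show ?thesis using uniq[of j] that I by auto
    qed
    then have cnt: "(\<Sum>j\<in>B. \<Sum>k. of_bool (good j k)) = (1 :: ennreal)"
      using i finB by simp
    have zmax: "z j k \<le> z i n" if "j \<in> I" for j k
      using dominate[OF g i(2) that, of k] by (cases "(i, n) = (j, k)") (auto intro: less_imp_le)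
    have m_i: "m i = z i n" using zmax[OF i(2)] z_m by (intro antisym) (auto simp: m_def intro!: SUP_least)
    have Mx_i: "Mx = z i n" using zmax I_ne m_Mx[OF i(2)] m_i by (intro antisym Mx_least) auto
    have "\<not> m i / (S - Mx) < ennreal (\<beta> i)"
    proof (cases "S - z i n = 0")
      \<comment> \<open>Zero interference: in \<open>ennreal\<close> a positive number divided by
        \<open>0\<close> is \<open>\<top>\<close>, so the ratio is not below the threshold, as it
        should be.\<close>
      case True
      then show ?thesis using g by (auto simp: m_i Mx_i good_def ennreal_divide_zero)
    next
      case False
      then have "m i / (S - Mx) < ennreal (\<beta> i) \<longleftrightarrow> z i n < ennreal (\<beta> i) * (S - z i n)"
        unfolding m_i Mx_i
      proof (intro divide_less_ennreal)
        show "S - z i n < \<top>" using S(2) by (rule order_le_less_trans[OF diff_le_self_ennreal])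
      qed
      then show ?thesis using g by (auto simp: good_def)
    qed
    then have "(\<Prod>i\<in>B. of_bool (m i / (S - Mx) < ennreal (\<beta> i))) = (0 :: ennreal)"
      using i finB by (intro prod_zero) auto
    then show ?thesis using cnt by (simp add: good_def m_def Mx_def)
  next
    case False
    have "m i / (S - Mx) < ennreal (\<beta> i)" if i: "i \<in> B" for i
    proof (rule ccontr)
      assume neg: "\<not> m i / (S - Mx) < ennreal (\<beta> i)"
      have iI: "i \<in> I" using i I by auto
      have D_fin: "S - Mx < \<top>" using S(2) by (rule order_le_less_trans[OF diff_le_self_ennreal])
      \<comment> \<open>In \<open>ennreal\<close> the quotient of \<open>0\<close> by anything is
        \<open>0\<close>, including \<open>0 / 0\<close>, so a tier without received power never
        reaches its threshold.\<close>
      have m0: "m i > 0"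
      proof (rule ccontr)
        assume "\<not> m i > 0"
        then have "m i = 0" by (simp add: not_less)
        then show False using neg \<beta>[OF iI] by simp
      qed
      have ge: "ennreal (\<beta> i) * (S - Mx) \<le> m i"
        using neg D_fin by (cases "S - Mx = 0") (auto simp: divide_less_ennreal not_less)
      show False
      proof (cases "\<exists>n. \<forall>j\<in>I. \<forall>k. z j k \<le> z i n")
        case True
        then obtain n where n: "\<And>j k. j \<in> I \<Longrightarrow> z j k \<le> z i n" by blast
        have "m i = z i n" using n[OF iI] z_m by (intro antisym) (auto simp: m_def intro!: SUP_least)
        moreover have "Mx = z i n" using n I_ne m_Mx[OF iI] \<open>m i = z i n\<close> by (intro antisym Mx_least) auto
        ultimately have "good i n" using ge m0 by (simp add: good_def)
        then show False using False i by blast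
      next
        case no_max: False
        have pair: "z i n + z j k \<le> S" if "j \<in> I" for n j k
        proof (cases "(i, n) = (j, k)")
          case True
          \<comment> \<open>The same station taken twice: since it is not the strongest, a stronger
            one can stand in for the second copy.\<close>
          obtain j' k' where j': "j' \<in> I" "z i n < z j' k'" using no_max by (meson not_le)
          have "z i n + z j k \<le> z i n + z j' k'" using True j' by (auto intro!: add_left_mono less_imp_le)
          also have "\<dots> \<le> S" using j' iI by (intro two) auto
          finally show ?thesis .
        qed (use two iI that in auto)
        have "z i n + Mx \<le> S" for n
        proof -
          have "Mx \<le> S - z i n"
          proof (rule Mx_least[OF _ I_ne])
            fix j k assume "j \<in> I"
            then show "z j k \<le> S - z i n" using pair[of j n k] by (simp add: ennreal_le_minus_iff add.commute)
          qed
          then show ?thesis using one[OF iI, of n] z_fin[OF iI, of n]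
            by (auto simp: ennreal_le_minus_iff add.commute)
        qed
        then have "m i + Mx \<le> S"
          unfolding m_def by (subst ennreal_SUP_add_left[symmetric]) (auto intro!: SUP_least)
        then have "m i \<le> S - Mx" by (simp add: ennreal_le_minus_iff)
        moreover have "S - Mx < m i"
          by (rule lt[OF ge \<beta>[OF iI] m0 D_fin])
        ultimately show False by simp
      qed
    qed
    then have "(\<Prod>i\<in>B. of_bool (m i / (S - Mx) < ennreal (\<beta> i))) = (1 :: ennreal)"
      by (intro prod.neutral) auto
    moreover have "(\<Sum>i\<in>B. \<Sum>n. of_bool (good i n)) = (0 :: ennreal)"
      using False by (intro sum.neutral) auto
    ultimately show ?thesis by (simp add: good_def m_def Mx_def)
  qed
qed

lemma prod_of_bool:
  "finite B \<Longrightarrow> (\<Prod>i\<in>B. of_bool (p i) :: 'b :: comm_semiring_1) = of_bool (\<forall>i\<in>B. p i)"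
  by (induction B rule: finite_induct) auto

theorem theorem2:
  fixes M :: "'w measure"
    and K :: nat and B :: "nat set" and \<alpha> :: real
    and dens P act \<beta> :: "nat \<Rightarrow> real"
    and \<Phi> \<Psi> \<Delta> :: "nat \<Rightarrow> 'w \<Rightarrow> (real^2) set"
    and h :: "real^2 \<Rightarrow> 'w \<Rightarrow> real"
  assumes "K \<ge> 1" and "B \<subseteq> {1..K}" and "\<alpha> > 2"
    and "\<And>i. i \<in> {1..K} \<Longrightarrow> dens i > 0"
    and "\<And>i. i \<in> {1..K} \<Longrightarrow> P i > 0"
    and "\<And>i. i \<in> {1..K} \<Longrightarrow> 0 \<le> act i \<and> act i \<le> 1"
    and "\<exists>i\<in>{1..K}. act i \<noteq> 0"
    and "\<And>i. i \<in> {1..K} \<Longrightarrow> \<beta> i > 1"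
    and "k_tier_network M K dens act \<Phi> \<Psi> \<Delta> h"
  shows "summable (\<lambda>m. g_c K B \<alpha> dens act P \<beta> (Suc m)) \<and>
    closed_access_coverage M K B \<alpha> P \<beta> \<Psi> \<Delta> h =
      pi / C_const \<alpha> *
        ((\<Sum>i\<in>B. act i * dens i * P i powr (2 / \<alpha>) * \<beta> i powr (- 2 / \<alpha>)) /
         (\<Sum>i=1..K. act i * dens i * P i powr (2 / \<alpha>)))
      - (\<Sum>m. g_c K B \<alpha> dens act P \<beta> (Suc m))"
proof -
  interpret k_tier_network M K dens act \<Phi> \<Psi> \<Delta> h by fact
  have finB: "finite B" using assms(2) by (rule finite_subset) simp
  obtain X :: "nat \<Rightarrow> 'w \<Rightarrow> real^2" where X_meas [measurable]: "\<And>n. X n \<in> borel_measurable M"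
    and X_enum: "\<And>\<omega>. \<omega> \<in> space M \<Longrightarrow> inj (\<lambda>n. X n \<omega>) \<and> (\<Union>i\<in>{1..K}. \<Psi> i \<omega> \<union> \<Delta> i \<omega>) \<subseteq> range (\<lambda>n. X n \<omega>)"
    and marks: "\<And>n. distributed M lborel (\<lambda>\<omega>. h (X n \<omega>) \<omega>) (exponential_density 1)"
      "indep_vars (\<lambda>_. borel) (\<lambda>n \<omega>. h (X n \<omega>) \<omega>) UNIV"
    and marks_indep: "indep_set
       (sets (vimage_algebra (space M) (\<lambda>\<omega> n. h (X n \<omega>) \<omega>) (\<Pi>\<^sub>M n\<in>UNIV. (borel :: real measure))))
       (sets (vimage_algebra (space M) (\<lambda>\<omega>. (\<lambda>n. X n \<omega>, \<lambda>j\<in>{1..K} \<times> UNIV. bs_process \<Psi> \<Delta> j \<omega>))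
          ((\<Pi>\<^sub>M n\<in>UNIV. borel) \<Otimes>\<^sub>M (\<Pi>\<^sub>M j\<in>{1..K} \<times> UNIV. point_configs))))"
    using fading unfolding rayleigh_fading_def
    by - (elim exE conjE, rule that, (erule spec | erule bspec, assumption | assumption)+)
  have range: "\<Psi> i \<omega> \<subseteq> range (\<lambda>n. X n \<omega>)" "\<Delta> i \<omega> \<subseteq> range (\<lambda>n. X n \<omega>)" if "\<omega> \<in> space M" "i \<in> {1..K}" for \<omega> i
    using X_enum[OF that(1)] that(2) by blast+

  \<comment> \<open>The network as an instance of \<open>power_network\<close>\<close>
  define J where "J = {1..K} \<times> (UNIV :: bool set)"
  define d where "d = (\<lambda>(i, a). (if a then act i else 1 - act i) * dens i)"
  define H where "H n \<omega> = h (X n \<omega>) \<omega>" for n \<omega>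
  \<comment> \<open>Stations of all tiers interfere, but only idle stations of the permitted tiers
    can cover the mobile.\<close>
  define Ac where "Ac = (\<lambda>i. (i, True)) ` {1..K}"
  define Bd where "Bd = (\<lambda>i. (i, False)) ` B"
  interpret N: power_network M J d "bs_process \<Psi> \<Delta>" X H \<alpha> "\<lambda>j. P (fst j)" Ac Bd "\<lambda>j. \<beta> (fst j)"
  proof unfold_locales
    show "finite J" by (simp add: J_def)
    show "d j \<ge> 0" if "j \<in> J" for j
      using that assms(4,6)[of "fst j"] by (auto simp: J_def d_def intro!: mult_nonneg_nonneg)
    show "homogeneous_ppp M (d j) (bs_process \<Psi> \<Delta> j)" if "j \<in> J" for j
      using that active_ppp[of "fst j"] idle_ppp[of "fst j"] by (auto simp: J_def d_def bs_process_def)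
    show "indep_vars (\<lambda>_. point_configs) (bs_process \<Psi> \<Delta>) J"
      unfolding J_def by (rule processes_indep)
    show "inj (\<lambda>n. X n \<omega>)" if "\<omega> \<in> space M" for \<omega> using X_enum[OF that] by simp
    show "bs_process \<Psi> \<Delta> j \<omega> \<subseteq> range (\<lambda>n. X n \<omega>)" if "\<omega> \<in> space M" "j \<in> J" for j \<omega>
      using range[OF that(1), of "fst j"] that(2) by (cases j) (auto simp: J_def bs_process_def)
    show "distributed M lborel (H n) (exponential_density 1)" for n
      unfolding H_def[abs_def] by (rule marks)
    show "indep_vars (\<lambda>_. borel) H UNIV"
      unfolding H_def[abs_def] by (rule marks)
    show "indep_set (sets (vimage_algebra (space M) (\<lambda>\<omega> n. H n \<omega>) (\<Pi>\<^sub>M n\<in>UNIV. (borel :: real measure))))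
       (sets (vimage_algebra (space M) (\<lambda>\<omega>. (\<lambda>n. X n \<omega>, \<lambda>j\<in>J. bs_process \<Psi> \<Delta> j \<omega>))
          ((\<Pi>\<^sub>M n\<in>UNIV. borel) \<Otimes>\<^sub>M (\<Pi>\<^sub>M j\<in>J. point_configs))))"
      unfolding J_def H_def by (rule marks_indep)
    show "P (fst j) > 0" if "j \<in> J" for j using that assms(5) by (auto simp: J_def)
    show "Ac \<subseteq> J" "Bd \<subseteq> J" "Ac \<inter> Bd = {}" using assms(2) by (auto simp: J_def Ac_def Bd_def)
    show "\<beta> (fst j) > 0" if "j \<in> Bd" for j
      using that assms(2) assms(8)[of "fst j"] by (auto simp: Bd_def)
    show "\<exists>j\<in>Ac. 0 < d j"
    proof -
      obtain i where i: "i \<in> {1..K}" "act i \<noteq> 0" using assms(7) by blast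
      then have "0 < act i" using assms(6)[OF i(1)] by auto
      then show ?thesis using i assms(4)[OF i(1)] by (intro bexI[of _ "(i, True)"]) (auto simp: Ac_def d_def)
    qed
  qed (use assms(3) in auto)

  \<comment> \<open>Received powers along the enumeration\<close>
  have bs [simp]: "bs_process \<Psi> \<Delta> (i, True) = \<Psi> i" "bs_process \<Psi> \<Delta> (i, False) = \<Delta> i" for i
    by (simp_all add: bs_process_def)
  have sum_Ac: "(\<Sum>j\<in>Ac. F j) = (\<Sum>i\<in>{1..K}. F (i, True))" for F :: "nat \<times> bool \<Rightarrow> ennreal"
    by (simp add: Ac_def sum.reindex inj_on_def)
  have rx: "rx_power \<alpha> h (P i) \<omega> (X n \<omega>) = ennreal (N.Y (i, a) n \<omega>)" for i n \<omega> a
    by (simp add: rx_power_def N.Y_def H_def)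
  \<comment> \<open>Locations outside the tier contribute \<open>0\<close>, which affects neither a
    sum nor a supremum in \<open>ennreal\<close>.\<close>
  define z where "z \<omega> i n = ennreal (N.Y (i, True) n \<omega>) * indicator (\<Psi> i \<omega>) (X n \<omega>)" for \<omega> i n
  define q where "q \<omega> i = (SUP n. ennreal (N.Y (i, False) n \<omega>) * indicator (\<Delta> i \<omega>) (X n \<omega>))" for \<omega> i
  define Mx where "Mx \<omega> = Max ((\<lambda>i. SUP n. z \<omega> i n) ` {1..K})" for \<omega>
  have mp: "max_power \<alpha> h (P i) (\<Psi> i) \<omega> = (SUP n. z \<omega> i n)" if "\<omega> \<in> space M" "i \<in> {1..K}" for \<omega> i
    unfolding max_power_def z_def rx[symmetric] by (rule SUP_enumeration[OF range(1)[OF that]])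
  have md: "max_power \<alpha> h (P i) (\<Delta> i) \<omega> = q \<omega> i" if "\<omega> \<in> space M" "i \<in> {1..K}" for \<omega> i
    unfolding max_power_def q_def rx[symmetric] by (rule SUP_enumeration[OF range(2)[OF that]])
  have I_eq: "N.I \<omega> = (\<Sum>n. \<Sum>i\<in>{1..K}. z \<omega> i n)" for \<omega>
    by (simp only: N.I_def sum_Ac bs z_def)
  have tot: "total_power K \<alpha> h P \<Psi> \<omega> = N.I \<omega>" if "\<omega> \<in> space M" for \<omega>
  proof -
    have "total_power K \<alpha> h P \<Psi> \<omega> = (\<Sum>i=1..K. \<Sum>n. z \<omega> i n)"
      unfolding total_power_def z_def rx[symmetric] using X_enum[OF that]
      by (intro sum.cong refl infsum_enumeration range(1)[OF that]) auto
    then show ?thesis unfolding I_eq by (simp add: suminf_sum)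
  qed
  have mx: "max_power_active K \<alpha> h P \<Psi> \<omega> = Mx \<omega>" if "\<omega> \<in> space M" for \<omega>
    unfolding max_power_active_def Mx_def using mp[OF that] by (metis (no_types, lifting) image_cong)
  define f :: "'w \<Rightarrow> real" where "f \<omega> = (\<Prod>i\<in>B. of_bool ((SUP n. z \<omega> i n) / (N.I \<omega> - Mx \<omega>) < ennreal (\<beta> i)) * of_bool (q \<omega> i / N.I \<omega> < ennreal (\<beta> i)))" for \<omega>
  have coverage: "closed_access_coverage M K B \<alpha> P \<beta> \<Psi> \<Delta> h = 1 - expectation f"
  proof -
    have "(\<integral>\<omega>. (\<Prod>i\<in>B. of_bool (max_power \<alpha> h (P i) (\<Psi> i) \<omega> /
              (total_power K \<alpha> h P \<Psi> \<omega> - max_power_active K \<alpha> h P \<Psi> \<omega>) < ennreal (\<beta> i)) *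
          of_bool (max_power \<alpha> h (P i) (\<Delta> i) \<omega> / total_power K \<alpha> h P \<Psi> \<omega> < ennreal (\<beta> i))) \<partial>M) = expectation f"
      unfolding f_def
    proof (intro Bochner_Integration.integral_cong refl prod.cong)
      fix \<omega> i assume "\<omega> \<in> space M" "i \<in> B"
      moreover have "i \<in> {1..K}" using \<open>i \<in> B\<close> assms(2) by auto
      ultimately show "of_bool (max_power \<alpha> h (P i) (\<Psi> i) \<omega> /
              (total_power K \<alpha> h P \<Psi> \<omega> - max_power_active K \<alpha> h P \<Psi> \<omega>) < ennreal (\<beta> i)) *
          of_bool (max_power \<alpha> h (P i) (\<Delta> i) \<omega> / total_power K \<alpha> h P \<Psi> \<omega> < ennreal (\<beta> i))
        = (of_bool ((SUP n. z \<omega> i n) / (N.I \<omega> - Mx \<omega>) < ennreal (\<beta> i)) * of_bool (q \<omega> i / N.I \<omega> < ennreal (\<beta> i)) :: real)"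
        by (simp only: mp md tot mx)
    qed
    then show ?thesis by (simp add: closed_access_coverage_def)
  qed

  \<comment> \<open>Measurability of the coverage indicators\<close>
  have \<Psi>_meas [measurable]: "\<Psi> i \<in> measurable M point_configs" "\<Delta> i \<in> measurable M point_configs" if "i \<in> {1..K}" for i
    using active_ppp[OF that] idle_ppp[OF that] by (auto simp: homogeneous_ppp_def)
  have z_meas [measurable]: "(\<lambda>\<omega>. z \<omega> i n) \<in> borel_measurable M" if "i \<in> {1..K}" for i n
    using \<Psi>_meas[OF that] unfolding z_def by measurable
  have q_meas [measurable]: "(\<lambda>\<omega>. q \<omega> i) \<in> borel_measurable M" if "i \<in> {1..K}" for i
    using \<Psi>_meas[OF that] unfolding q_def by measurable
  have Mx_meas [measurable]: "Mx \<in> borel_measurable M"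
  proof -
    have "Mx = (\<lambda>\<omega>. SUP i\<in>{1..K}. SUP n. z \<omega> i n)"
      unfolding Mx_def using assms(1) by (auto simp: fun_eq_iff intro!: Max_Sup)
    also have "\<dots> \<in> borel_measurable M" by measurable
    finally show ?thesis .
  qed
  have f_meas [measurable]: "f \<in> borel_measurable M"
  proof -
    have "(\<lambda>\<omega>. of_bool ((SUP n. z \<omega> i n) / (N.I \<omega> - Mx \<omega>) < ennreal (\<beta> i)) * of_bool (q \<omega> i / N.I \<omega> < ennreal (\<beta> i)) :: real) \<in> borel_measurable M"
      if "i \<in> B" for i
    proof -
      have [measurable]: "i \<in> {1..K}" using that assms(2) by auto
      show ?thesis by measurable
    qed
    then show ?thesis unfolding f_def by (intro borel_measurable_prod)
  qed
  have f01: "0 \<le> f \<omega>" "f \<omega> \<le> 1" for \<omega>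
    unfolding f_def by (auto intro!: prod_nonneg prod_le_1)
  \<comment> \<open>The number of covering active stations of tier \<open>i\<close>, set to
    \<open>0\<close> off the event that no idle station covers.\<close>
  define g where "g i \<omega> = (\<Sum>n. indicator (\<Psi> i \<omega>) (X n \<omega>) * indicator {0<..} (N.Y (i, True) n \<omega>) *
      (indicator {y. \<beta> i * (N.Ir \<omega> - y) \<le> y} (N.Y (i, True) n \<omega>) * indicator {..<N.Ir \<omega>} (N.Tr \<omega>)) :: ennreal)" for i \<omega>
  have g_meas [measurable]: "g i \<in> borel_measurable M" if "i \<in> {1..K}" for i
  proof -
    have [measurable]: "\<Psi> i \<in> measurable M point_configs" by (rule \<Psi>_meas[OF that])
    let ?e = "\<lambda>n \<omega>. X n \<omega> \<in> \<Psi> i \<omega> \<and> 0 < N.Y (i, True) n \<omega> \<and>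
      \<beta> i * (N.Ir \<omega> - N.Y (i, True) n \<omega>) \<le> N.Y (i, True) n \<omega> \<and> N.Tr \<omega> < N.Ir \<omega>"
    have "g i = (\<lambda>\<omega>. \<Sum>n. if ?e n \<omega> then 1 else 0)"
      unfolding g_def[abs_def] by (intro ext suminf_cong) (simp add: indicator_def)
    also have "\<dots> \<in> borel_measurable M" by measurable
    finally show ?thesis .
  qed

  \<comment> \<open>Pointwise form of the coverage event\<close>
  have T_iff: "(\<forall>i\<in>B. q \<omega> i / N.I \<omega> < ennreal (\<beta> i)) \<longleftrightarrow> N.Tr \<omega> < N.Ir \<omega>"
    if I: "0 < N.I \<omega>" "N.I \<omega> < \<top>" and T: "N.T \<omega> < \<top>" for \<omega>
  proof -
    have "N.T \<omega> = (SUP j\<in>Bd. SUP n. ennreal (N.Y j n \<omega> / \<beta> (fst j)) * indicator (bs_process \<Psi> \<Delta> j \<omega>) (X n \<omega>))"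
      unfolding N.T_def by (rule SUP_commute)
    also have "\<dots> = (SUP i\<in>B. SUP n. ennreal (N.Y (i, False) n \<omega> / \<beta> i) * indicator (\<Delta> i \<omega>) (X n \<omega>))"
      unfolding Bd_def by (simp add: image_comp o_def)
    also have "\<dots> = (SUP i\<in>B. q \<omega> i / ennreal (\<beta> i))"
    proof (intro SUP_cong refl)
      fix i assume "i \<in> B"
      then have b: "\<beta> i > 0" using assms(2) assms(8)[of i] by auto
      have "ennreal (y / \<beta> i) * indicator S x = (ennreal y * indicator S x) / ennreal (\<beta> i)" for y and x :: "real^2" and S
        using b by (cases "y \<ge> 0") (auto simp: divide_ennreal ennreal_neg divide_nonpos_pos split: split_indicator)
      then show "(SUP n. ennreal (N.Y (i, False) n \<omega> / \<beta> i) * indicator (\<Delta> i \<omega>) (X n \<omega>)) = q \<omega> i / ennreal (\<beta> i)"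
        by (simp add: q_def SUP_divide_ennreal)
    qed
    finally have T_eq: "N.T \<omega> = (SUP i\<in>B. q \<omega> i / ennreal (\<beta> i))" .
    \<comment> \<open>Strict inequality passes through the supremum over the finite set
      \<open>B\<close>; the supremum over all stations is already inside \<open>q\<close>. For empty
      \<open>B\<close> the supremum is \<open>0\<close>, and positivity of \<open>I\<close> is
      used.\<close>
    have "N.T \<omega> < N.I \<omega> \<longleftrightarrow> (\<forall>i\<in>B. q \<omega> i / ennreal (\<beta> i) < N.I \<omega>)"
      unfolding T_eq using I(1) finB by (cases "B = {}") (auto simp: finite_Sup_less_iff bot_ennreal)
    also have "\<dots> \<longleftrightarrow> (\<forall>i\<in>B. q \<omega> i / N.I \<omega> < ennreal (\<beta> i))"
    proof (intro ball_cong refl)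
      fix i assume "i \<in> B"
      then have b: "\<beta> i > 0" using assms(2) assms(8)[of i] by auto
      show "q \<omega> i / ennreal (\<beta> i) < N.I \<omega> \<longleftrightarrow> q \<omega> i / N.I \<omega> < ennreal (\<beta> i)"
        using I b by (simp add: divide_less_ennreal mult.commute)
    qed
    also have "N.T \<omega> < N.I \<omega> \<longleftrightarrow> N.Tr \<omega> < N.Ir \<omega>"
    proof -
      obtain t x where "N.T \<omega> = ennreal t" "t \<ge> 0" "N.I \<omega> = ennreal x" "x \<ge> 0"
        using T I(2) by (cases "N.T \<omega>"; cases "N.I \<omega>") auto
      then show ?thesis by (simp add: N.Tr_def N.Ir_def ennreal_less_iff)
    qed
    finally show ?thesis by blast
  qed
  \<comment> \<open>This is \<open>no_coverage_indicator\<close> multiplied by the idle indicator.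
    The excluded outcomes are those where \<open>I\<close> is zero or infinite or \<open>T\<close>
    is infinite.\<close>
  have split: "AE \<omega> in M. ennreal (f \<omega>) + (\<Sum>i\<in>B. g i \<omega>) = indicator {..<N.Ir \<omega>} (N.Tr \<omega>)"
    using N.AE_I_finite N.AE_I_pos N.AE_T_finite
  proof eventually_elim
    case (elim \<omega>)
    define x where "x = N.Ir \<omega>"
    have x: "N.I \<omega> = ennreal x" "x \<ge> 0" using elim by (auto simp: x_def N.Ir_def)
    let ?cov = "\<lambda>i. (SUP n. z \<omega> i n) / (N.I \<omega> - Mx \<omega>) < ennreal (\<beta> i)"
    have "(\<Prod>i\<in>B. of_bool (?cov i)) + (\<Sum>i\<in>B. \<Sum>n. of_bool (0 < z \<omega> i n \<and> ennreal (\<beta> i) * (N.I \<omega> - z \<omega> i n) \<le> z \<omega> i n)) = (1 :: ennreal)"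
      using no_coverage_indicator[of "{1..K}" B \<beta> "z \<omega>"] assms(2,8) elim unfolding I_eq[symmetric] Mx_def by simp
    then have one: "of_bool (\<forall>i\<in>B. ?cov i) + (\<Sum>i\<in>B. \<Sum>n. of_bool (0 < z \<omega> i n \<and> ennreal (\<beta> i) * (N.I \<omega> - z \<omega> i n) \<le> z \<omega> i n)) = (1 :: ennreal)"
      by (simp only: prod_of_bool[OF finB])
    have f_eq: "f \<omega> = of_bool (\<forall>i\<in>B. ?cov i) * indicator {..<N.Ir \<omega>} (N.Tr \<omega>)"
      unfolding f_def prod.distrib prod_of_bool[OF finB] T_iff[OF elim(2,1,3)] by (simp add: indicator_def)
    have good: "of_bool (0 < z \<omega> i n \<and> ennreal (\<beta> i) * (N.I \<omega> - z \<omega> i n) \<le> z \<omega> i n)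
       = (indicator (\<Psi> i \<omega>) (X n \<omega>) * indicator {0<..} (N.Y (i, True) n \<omega>) * indicator {y. \<beta> i * (N.Ir \<omega> - y) \<le> y} (N.Y (i, True) n \<omega>) :: ennreal)"
      if "i \<in> B" for i n
    proof (cases "X n \<omega> \<in> \<Psi> i \<omega> \<and> N.Y (i, True) n \<omega> > 0")
      case True
      define y where "y = N.Y (i, True) n \<omega>"
      have zy: "z \<omega> i n = ennreal y" "y > 0" using True by (auto simp: z_def y_def)
      have "\<beta> i > 1" using that assms(2,8) by auto
      then have "ennreal (\<beta> i) * (N.I \<omega> - z \<omega> i n) = ennreal (\<beta> i * (x - y))"
        using zy x by (simp add: ennreal_minus ennreal_mult')
      then have "ennreal (\<beta> i) * (N.I \<omega> - z \<omega> i n) \<le> z \<omega> i n \<longleftrightarrow> \<beta> i * (x - y) \<le> y"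
        using zy by simp
      then show ?thesis using True zy by (simp add: x_def y_def[symmetric] split: split_indicator)
    next
      case False
      then have "z \<omega> i n = 0" by (auto simp: z_def ennreal_neg split: split_indicator)
      then show ?thesis using False by (auto split: split_indicator)
    qed
    have g_eq: "g i \<omega> = (\<Sum>n. of_bool (0 < z \<omega> i n \<and> ennreal (\<beta> i) * (N.I \<omega> - z \<omega> i n) \<le> z \<omega> i n)) * indicator {..<N.Ir \<omega>} (N.Tr \<omega>)"
      if "i \<in> B" for i
      unfolding good[OF that] ennreal_suminf_multc[symmetric] g_def by (simp only: mult.assoc)
    have "ennreal (f \<omega>) + (\<Sum>i\<in>B. g i \<omega>)
       = (of_bool (\<forall>i\<in>B. ?cov i) + (\<Sum>i\<in>B. \<Sum>n. of_bool (0 < z \<omega> i n \<and> ennreal (\<beta> i) * (N.I \<omega> - z \<omega> i n) \<le> z \<omega> i n))) * indicator {..<N.Ir \<omega>} (N.Tr \<omega>)"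
      by (simp add: f_eq g_eq distrib_right sum_distrib_right split: split_indicator)
    then show ?case by (simp only: one mult_1)
  qed

  \<comment> \<open>The expectation as a difference of series\<close>
  let ?p = "\<lambda>m. (- N.A) ^ m / fact m * N.moment m"
  let ?r = "\<lambda>i m. (- N.A) ^ m / fact m * N.moment (m + 1) * N.J_int (\<beta> i) m"
  let ?c = "\<lambda>i. N.c (i, True)"
  have iAc: "(i, True) \<in> Ac" "(i, True) \<in> J" "\<beta> i > 0" "i \<in> {1..K}" if "i \<in> B" for i
    using that assms(2) assms(8)[of i] by (auto simp: Ac_def J_def)
  have r_sum: "summable (?r i)" and r_nn: "(\<Sum>m. ?r i m) \<ge> 0" if "i \<in> B" for i
    using N.active_covered_value[OF iAc(1,3)[OF that]] by auto
  have g_int: "(\<integral>\<^sup>+\<omega>. g i \<omega> \<partial>M) = ennreal (?c i * (\<Sum>m. ?r i m))" if "i \<in> B" for i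
    using N.active_covered_value(2)[OF iAc(1,3)[OF that]] unfolding g_def bs .
  have Ef: "expectation f = (\<Sum>m. ?p m) - (\<Sum>i\<in>B. ?c i * (\<Sum>m. ?r i m))"
  proof -
    have f_int: "integrable M f"
      by (rule integrable_const_bound[where B = 1]) (use f01 in auto)
    \<comment> \<open>Subtraction in \<open>ennreal\<close> truncates, so the identity is kept
      additive until all terms are known to be finite and nonnegative.\<close>
    have "ennreal (expectation f) + (\<Sum>i\<in>B. ennreal (?c i * (\<Sum>m. ?r i m))) = (\<integral>\<^sup>+\<omega>. ennreal (f \<omega>) \<partial>M) + (\<Sum>i\<in>B. \<integral>\<^sup>+\<omega>. g i \<omega> \<partial>M)"
      using f_int f01 g_int by (simp add: nn_integral_eq_integral)
    also have "\<dots> = (\<integral>\<^sup>+\<omega>. ennreal (f \<omega>) + (\<Sum>i\<in>B. g i \<omega>) \<partial>M)"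
    proof -
      have "(\<Sum>i\<in>B. \<integral>\<^sup>+\<omega>. g i \<omega> \<partial>M) = (\<integral>\<^sup>+\<omega>. (\<Sum>i\<in>B. g i \<omega>) \<partial>M)"
        using iAc(4) by (intro nn_integral_sum[symmetric] g_meas) 
      moreover have "(\<lambda>\<omega>. \<Sum>i\<in>B. g i \<omega>) \<in> borel_measurable M"
        using iAc(4) by (intro borel_measurable_sum g_meas)
      ultimately show ?thesis by (simp add: nn_integral_add)
    qed
    also have "\<dots> = (\<integral>\<^sup>+\<omega>. indicator {..<N.Ir \<omega>} (N.Tr \<omega>) \<partial>M)"
      by (rule nn_integral_cong_AE[OF split])
    also have "\<dots> = ennreal (\<Sum>m. ?p m)" by (rule N.idle_uncovered_value)
    finally have eq: "ennreal (expectation f) + (\<Sum>i\<in>B. ennreal (?c i * (\<Sum>m. ?r i m))) = ennreal (\<Sum>m. ?p m)" .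
    have cr: "?c i * (\<Sum>m. ?r i m) \<ge> 0" if "i \<in> B" for i
      using r_nn[OF that] N.c_nonneg[OF iAc(2)[OF that]] by (rule mult_nonneg_nonneg[rotated])
    have "(\<Sum>i\<in>B. ennreal (?c i * (\<Sum>m. ?r i m))) = ennreal (\<Sum>i\<in>B. ?c i * (\<Sum>m. ?r i m))"
      using cr by (rule sum_ennreal)
    moreover have "expectation f \<ge> 0" using f01 by (intro Bochner_Integration.integral_nonneg)
    moreover have "(\<Sum>i\<in>B. ?c i * (\<Sum>m. ?r i m)) \<ge> 0" using cr by (rule sum_nonneg)
    ultimately have "ennreal (expectation f + (\<Sum>i\<in>B. ?c i * (\<Sum>m. ?r i m))) = ennreal (\<Sum>m. ?p m)"
      using eq by simp
    then have "expectation f + (\<Sum>i\<in>B. ?c i * (\<Sum>m. ?r i m)) = (\<Sum>m. ?p m)"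
      using \<open>expectation f \<ge> 0\<close> \<open>(\<Sum>i\<in>B. ?c i * (\<Sum>m. ?r i m)) \<ge> 0\<close> N.idle_uncovered_value(3)
      by (subst (asm) ennreal_inj) auto
    then show ?thesis by simp
  qed

  \<comment> \<open>Constants of the closed form\<close>
  let ?G = "pi * Gamma (1 + 2 / \<alpha>)"
  have c_eq: "?c i = act i * dens i * P i powr (2 / \<alpha>) * ?G" for i
    unfolding N.c_def by (simp add: d_def)
  have c_idle: "N.c (i, False) = (1 - act i) * dens i * P i powr (2 / \<alpha>) * ?G" for i
    unfolding N.c_def by (simp add: d_def)
  have A_eq: "N.A = A_c B \<alpha> dens act P \<beta>"
    unfolding N.A_def unfolding Bd_def A_c_def
    by (subst sum.reindex) (auto simp: inj_on_def c_idle sum_distrib_left mult_ac intro!: sum.cong)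
  have C_eq: "?G * Gamma (1 - 2 / \<alpha>) = C_const \<alpha>"
    using Gamma_reflection_real_plus1[of "2 / \<alpha>"] assms(3)
    by (simp add: C_const_def power2_eq_square mult.assoc) (simp add: field_simps)
  have eta_eq: "N.\<eta> = eta K \<alpha> dens act P"
  proof -
    have "N.\<eta> = (\<Sum>i=1..K. act i * dens i * P i powr (2 / \<alpha>)) * (?G * Gamma (1 - 2 / \<alpha>))"
    proof -
      have "(\<Sum>j\<in>Ac. N.c j) = (\<Sum>i=1..K. act i * dens i * P i powr (2 / \<alpha>) * ?G)"
        unfolding Ac_def by (subst sum.reindex) (simp_all add: inj_on_def c_eq)
      also have "\<dots> = (\<Sum>i=1..K. act i * dens i * P i powr (2 / \<alpha>)) * ?G"
        by (simp only: sum_distrib_right)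
      finally show ?thesis unfolding N.\<eta>_def by (simp only: mult.assoc)
    qed
    then show ?thesis unfolding C_eq eta_def by (simp add: mult.commute)
  qed
  have \<eta>0: "N.\<eta> \<noteq> 0" using N.\<eta>_pos by simp
  have g_c_eq: "g_c K B \<alpha> dens act P \<beta> (Suc m) = ?p (Suc m) - (\<Sum>i\<in>B. ?c i * ?r i (Suc m))" for m
  proof -
    let ?m = "Suc m"
    have pow: "(- N.A / N.\<eta>) ^ ?m = (- N.A) ^ ?m / N.\<eta> ^ ?m" by (rule power_divide)
    have p: "?p ?m = (- N.A / N.\<eta>) ^ ?m * (1 / Gamma (1 + 2 * real ?m / \<alpha>))"
      unfolding pow N.moment_def by (simp add: mult_ac)
    have r: "?c i * ?r i ?m = (- N.A / N.\<eta>) ^ ?m * (dens i * act i * P i powr (2 / \<alpha>) * \<beta> i powr (- 2 / \<alpha>) *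
        hyp2F1 1 (2 * real ?m / \<alpha>) (1 + 2 * (real ?m + 1) / \<alpha>) (1 / (1 + \<beta> i)) / (1 + \<beta> i) powr (2 * real ?m / \<alpha>)
        / N.\<eta> * (?G / Gamma (1 + 2 * (real ?m + 1) / \<alpha>)))" for i
    proof -
      \<comment> \<open>The factor \<open>?m + 1\<close> of the factorial cancels the one by which
        \<open>J_int\<close> is divided; the additional power of \<open>\<eta>\<close> is the single
        \<open>\<eta>\<close> under \<open>B_c\<close>.\<close>
      have m1: "N.moment (?m + 1) = real (?m + 1) * fact ?m / (Gamma (1 + 2 * (real ?m + 1) / \<alpha>) * (N.\<eta> ^ ?m * N.\<eta>))"
        by (simp add: N.moment_def mult_ac)
      show ?thesis
        unfolding m1 pow N.J_int_def c_eq by (simp add: divide_simps del: of_nat_Suc power_Suc fact_Suc) 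
    qed
    have "(\<Sum>i\<in>B. ?c i * ?r i ?m) = (- N.A / N.\<eta>) ^ ?m * (B_c B \<alpha> dens act P \<beta> ?m / N.\<eta> * (?G / Gamma (1 + 2 * (real ?m + 1) / \<alpha>)))"
      unfolding r B_c_def by (simp only: sum_divide_distrib sum_distrib_left sum_distrib_right)
    then show ?thesis
      unfolding g_c_def p A_eq[symmetric] eta_eq[symmetric] by (simp only: right_diff_distrib)
  qed
  \<comment> \<open>\<open>?p 0 = 1\<close>; in \<open>1 - expectation f\<close> it cancels against
    the leading \<open>1\<close>.\<close>
  have p_sums: "(\<lambda>m. ?p (Suc m)) sums ((\<Sum>m. ?p m) - 1)"
    using summable_sums[OF N.idle_uncovered_value(2)] sums_Suc_iff[of ?p "(\<Sum>m. ?p m) - 1"] by (simp add: N.moment_def)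
  have r0: "?r i 0 = \<beta> i powr (- 2 / \<alpha>) / (Gamma (1 + 2 / \<alpha>) * N.\<eta>)" for i
    by (simp add: N.J_int_def N.moment_def)
  have r_sums: "(\<lambda>m. \<Sum>i\<in>B. ?c i * ?r i (Suc m)) sums (\<Sum>i\<in>B. ?c i * ((\<Sum>m. ?r i m) - ?r i 0))"
  proof (intro sums_sum sums_mult)
    fix i assume "i \<in> B"
    show "(\<lambda>m. ?r i (Suc m)) sums ((\<Sum>m. ?r i m) - ?r i 0)"
      using summable_sums[OF r_sum[OF \<open>i \<in> B\<close>]] sums_Suc_iff[of "?r i" "(\<Sum>m. ?r i m) - ?r i 0"] by simp
  qed
  have sums: "(\<lambda>m. g_c K B \<alpha> dens act P \<beta> (Suc m)) sums (((\<Sum>m. ?p m) - 1) - (\<Sum>i\<in>B. ?c i * ((\<Sum>m. ?r i m) - ?r i 0)))"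
    unfolding g_c_eq by (intro sums_diff p_sums r_sums)
  \<comment> \<open>The terms \<open>m = 0\<close> of the Campbell series: the Gamma factor of the
    intensity cancels that of \<open>moment 1\<close>, and \<open>pi / \<eta>\<close>
    remains.\<close>
  have lead: "(\<Sum>i\<in>B. ?c i * ?r i 0) = pi / C_const \<alpha> *
        ((\<Sum>i\<in>B. act i * dens i * P i powr (2 / \<alpha>) * \<beta> i powr (- 2 / \<alpha>)) /
         (\<Sum>i=1..K. act i * dens i * P i powr (2 / \<alpha>)))"
  proof -
    have G0: "Gamma (1 + 2 / \<alpha>) \<noteq> 0" using N.Gamma_pos by simp
    have "(\<Sum>i\<in>B. ?c i * ?r i 0) = (\<Sum>i\<in>B. pi / N.\<eta> * (act i * dens i * P i powr (2 / \<alpha>) * \<beta> i powr (- 2 / \<alpha>)))"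
      unfolding r0 c_eq using G0 by (intro sum.cong refl) (simp add: field_simps)
    also have "\<dots> = pi / N.\<eta> * (\<Sum>i\<in>B. act i * dens i * P i powr (2 / \<alpha>) * \<beta> i powr (- 2 / \<alpha>))"
      by (simp only: sum_distrib_left)
    finally show ?thesis unfolding eta_eq eta_def by simp
  qed
  have "closed_access_coverage M K B \<alpha> P \<beta> \<Psi> \<Delta> h
      = (\<Sum>i\<in>B. ?c i * ?r i 0) - (((\<Sum>m. ?p m) - 1) - (\<Sum>i\<in>B. ?c i * ((\<Sum>m. ?r i m) - ?r i 0)))"
    unfolding coverage Ef by (simp add: right_diff_distrib sum_subtractf)
  then show ?thesis
    using sums_summable[OF sums] sums_unique[OF sums] unfolding lead by simp
qed

end
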